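(* Let $M$ be an oriented smooth $7$-manifold with a $\mathrm{G}_2$-structure $\varphi$ and $\psi=*\varphi$, and let $(x^1,\dots,x^7)$ be $\mathrm{G}_2$-adapted Riemannian normal coordinates centred at $x\in M$. The components $\psi_{ijkl}$ of $\psi$ have Taylor expansion about $0\in\mathbb R^7$ (corresponding to $x$) given by $$\psi_{ijkl}(x^1,\dots,x^7)=\psi_{ijkl}+\left(-T_{qi}\varphi_{jkl}+T_{qj}\varphi_{ikl}-T_{qk}\varphi_{ijl}+T_{ql}\varphi_{ijk}\right)x^q+\mathcal Q_{pq\,ijkl}\,x^px^q+O(\|x\|^3),$$ where $$\begin{aligned}\mathcal Q_{pq\,ijkl}={}&\tfrac12\left(-\nabla_pT_{qi}\varphi_{jkl}+\nabla_pT_{qj}\varphi_{ikl}-\nabla_pT_{qk}\varphi_{ijl}+\nabla_pT_{ql}\varphi_{ijk}\right)\\&+\tfrac12\left(-T_{qi}T_{pm}\psi_{mjkl}+T_{qj}T_{pm}\psi_{mikl}-T_{qk}T_{pm}\psi_{mijl}+T_{ql}T_{pm}\psi_{mijk}\right)\\&+\tfrac16\left(R_{piqm}\psi_{mjkl}+R_{pjqm}\psi_{imkl}+R_{pkqm}\psi_{ijml}+R_{plqm}\psi_{ijkm}\right),\end{aligned}$$ and all coefficient tensors on the right-hand sides are evaluated at $0$.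
   Context: A $\mathrm{G}_2$-structure on a smooth $7$-manifold $M$ is a nondegenerate $3$-form $\varphi$, i.e. one that determines a Riemannian metric $g$ and an orientation by $(X\lrcorner\varphi)\wedge(Y\lrcorner\varphi)\wedge\varphi=-6\,g(X,Y)\,\mathrm{vol}$; $\psi=*\varphi$ is the dual $4$-form. (On a manifold with given orientation, a nondegenerate $4$-form $\psi$ conversely determines $g$ and $\varphi=*\psi$.) Repeated indices are summed from $1$ to $7$. $\nabla$ is the Levi-Civita connection of $g$. The torsion of $\varphi$ is the $2$-tensor $T$ with $\nabla_m\varphi_{ijk}=T_{mp}\psi_{pijk}$. The sign conventions are such that $\varphi_{ijk}\varphi_{abk}=g_{ia}g_{jb}-g_{ib}g_{ja}-\psi_{ijab}$. The Riemann tensor convention is fixed by the Ricci identity $\nabla_i\nabla_jS_{kl}-\nabla_j\nabla_iS_{kl}=-R_{ijkm}S_{ml}-R_{ijlm}S_{km}$. $\mathrm{G}_2$-adapted Riemannian normal coordinates at $x$ are Riemannian normal coordinates built from an orthonormal frame of $T_xM$ in which the components $\psi_{ijkl}$ (equivalently $\varphi_{ijk}$) at $x$ agree with those of the standard flat model on $\mathbb R^7$. *)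

theory Defs
  imports "HOL-Analysis.Analysis" "HOL-Combinatorics.Permutations"
    "HOL-Library.Landau_Symbols" "HOL-Library.Numeral_Type"
begin

text \<open>
  Indices range over the type \<open>7\<close>, whose elements are \<open>1, 2, \<dots>, 7\<close> (with \<open>7 = 0\<close>).
  The value at a point of a covariant \<open>k\<close>-tensor is given by its components, a function on
  index lists; only lists of length \<open>k\<close> are relevant.
\<close>

type_synonym idx = "7"
type_synonym coords = "real ^ 7"
type_synonym tensor = "idx list \<Rightarrow> real"


section \<open>Smooth functions on open subsets of Euclidean space\<close>

definition partial_deriv :: "'n::finite \<Rightarrow> (real ^ 'n \<Rightarrow> 'b::real_normed_vector) \<Rightarrow> real ^ 'n \<Rightarrow> 'b"
  where "partial_deriv i f u = frechet_derivative f (at u) (axis i 1)"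

primrec Ck_on :: "nat \<Rightarrow> (real ^ 'n::finite) set \<Rightarrow> (real ^ 'n \<Rightarrow> 'b::real_normed_vector) \<Rightarrow> bool" where
  "Ck_on 0 V f \<longleftrightarrow> continuous_on V f"
| "Ck_on (Suc k) V f \<longleftrightarrow>
     (\<forall>u\<in>V. f differentiable (at u)) \<and> (\<forall>i. Ck_on k V (partial_deriv i f))"

definition smooth_on :: "(real ^ 'n::finite) set \<Rightarrow> (real ^ 'n \<Rightarrow> 'b::real_normed_vector) \<Rightarrow> bool"
  where "smooth_on V f \<longleftrightarrow> (\<forall>k. Ck_on k V f)"


section \<open>Oriented smooth 7-manifolds\<close>

type_synonym 'm chart = "'m set \<times> ('m \<Rightarrow> coords)"

abbreviation chart_dom :: "'m chart \<Rightarrow> 'm set" where "chart_dom c \<equiv> fst c"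
abbreviation chart_map :: "'m chart \<Rightarrow> 'm \<Rightarrow> coords" where "chart_map c \<equiv> snd c"

definition chart_image :: "'m chart \<Rightarrow> coords set"
  where "chart_image c = chart_map c ` chart_dom c"

definition chart_inv :: "'m chart \<Rightarrow> coords \<Rightarrow> 'm"
  where "chart_inv c = inv_into (chart_dom c) (chart_map c)"

definition is_chart :: "'m::topological_space chart \<Rightarrow> bool" where
  "is_chart c \<longleftrightarrow> open (chart_dom c) \<and> open (chart_image c) \<and>
     homeomorphism (chart_dom c) (chart_image c) (chart_map c) (chart_inv c)"

definition transition :: "'m chart \<Rightarrow> 'm chart \<Rightarrow> coords \<Rightarrow> coords"
  where "transition c d = chart_map d \<circ> chart_inv c"

definition jacobian :: "(coords \<Rightarrow> coords) \<Rightarrow> coords \<Rightarrow> real ^ 7 ^ 7"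
  where "jacobian f u = matrix (frechet_derivative f (at u))"

definition oriented_compatible :: "'m chart \<Rightarrow> 'm chart \<Rightarrow> bool" where
  "oriented_compatible c d \<longleftrightarrow>
     (let W = chart_map c ` (chart_dom c \<inter> chart_dom d)
      in smooth_on W (transition c d) \<and> (\<forall>u\<in>W. det (jacobian (transition c d) u) > 0))"

text \<open>The manifold is the whole type \<open>'m\<close>; its smooth structure and orientation are together
  given by a maximal oriented atlas \<open>A\<close>.\<close>

definition oriented_smooth_manifold ::
  "'m::{t2_space, second_countable_topology} chart set \<Rightarrow> bool" where
  "oriented_smooth_manifold A \<longleftrightarrow>
     (\<Union>c\<in>A. chart_dom c) = UNIV \<and>
     (\<forall>c\<in>A. is_chart c) \<and>
     (\<forall>c\<in>A. \<forall>d\<in>A. oriented_compatible c d) \<and>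
     (\<forall>c. is_chart c \<and> (\<forall>d\<in>A. oriented_compatible c d \<and> oriented_compatible d c) \<longrightarrow> c \<in> A)"


section \<open>Tensor algebra at a point\<close>

definition metric_matrix :: "tensor \<Rightarrow> real ^ 7 ^ 7"
  where "metric_matrix h = (\<chi> i j. h [i, j])"

definition inv_metric :: "tensor \<Rightarrow> idx \<Rightarrow> idx \<Rightarrow> real"
  where "inv_metric h i j = matrix_inv (metric_matrix h) $ i $ j"

definition inner_product :: "tensor \<Rightarrow> bool" where
  "inner_product h \<longleftrightarrow> (\<forall>i j. h [i, j] = h [j, i]) \<and>
     (\<forall>X::coords. X \<noteq> 0 \<longrightarrow> (\<Sum>i\<in>UNIV. \<Sum>j\<in>UNIV. h [i, j] * X $ i * X $ j) > 0)"

definition alternating :: "nat \<Rightarrow> tensor \<Rightarrow> bool" where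
  "alternating k \<alpha> \<longleftrightarrow> (\<forall>is \<sigma>. length is = k \<and> \<sigma> permutes {..<k} \<longrightarrow>
     \<alpha> (permute_list \<sigma> is) = of_int (sign \<sigma>) * \<alpha> is)"

definition interior_product :: "coords \<Rightarrow> tensor \<Rightarrow> tensor"
  where "interior_product X \<alpha> is = (\<Sum>m\<in>UNIV. X $ m * \<alpha> (m # is))"

text \<open>Normalised so that \<open>dx\<^sup>i \<and> dx\<^sup>j = dx\<^sup>i \<otimes> dx\<^sup>j - dx\<^sup>j \<otimes> dx\<^sup>i\<close>.\<close>

definition wedge :: "nat \<Rightarrow> nat \<Rightarrow> tensor \<Rightarrow> tensor \<Rightarrow> tensor" where
  "wedge p q \<alpha> \<beta> is = (\<Sum>\<sigma> | \<sigma> permutes {..<p + q}. of_int (sign \<sigma>) *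
     \<alpha> (take p (permute_list \<sigma> is)) * \<beta> (drop p (permute_list \<sigma> is))) / (fact p * fact q)"

text \<open>Components of the metric volume form \<open>sqrt (det h) dx\<^sup>1 \<and> \<dots> \<and> dx\<^sup>7\<close>: the determinant is the
  Levi-Civita symbol.\<close>

definition volume_form :: "tensor \<Rightarrow> tensor" where
  "volume_form h is = sqrt (det (metric_matrix h)) *
     det (vector (map (\<lambda>i. axis i 1) is) :: real ^ 7 ^ 7)"

text \<open>\<open>(*\<alpha>)\<^sub>j = (1/k!) \<alpha>\<^sup>i vol\<^sub>i\<^sub>j\<close> with multi-indices \<open>i\<close>, \<open>j\<close>, equivalently
  \<open>\<alpha> \<and> *\<beta> = \<langle>\<alpha>, \<beta>\<rangle> vol\<close>.\<close>

definition hodge :: "nat \<Rightarrow> tensor \<Rightarrow> tensor \<Rightarrow> tensor" where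
  "hodge k h \<alpha> js = (\<Sum>is | length is = k. \<Sum>as | length as = k.
     (\<Prod>r<k. inv_metric h (is ! r) (as ! r)) * \<alpha> as * volume_form h (is @ js)) / fact k"

text \<open>The relation \<open>(X \<lrcorner> \<phi>) \<and> (Y \<lrcorner> \<phi>) \<and> \<phi> = -6 h(X, Y) vol\<close>.  Given \<open>\<phi>\<close>, it determines the
  inner product \<open>h\<close>.\<close>

definition induces_inner_product :: "tensor \<Rightarrow> tensor \<Rightarrow> bool" where
  "induces_inner_product \<phi> h \<longleftrightarrow> inner_product h \<and>
     (\<forall>X Y :: coords. \<forall>is. length is = 7 \<longrightarrow>
        wedge 4 3 (wedge 2 2 (interior_product X \<phi>) (interior_product Y \<phi>)) \<phi> is =
        - 6 * (\<Sum>i\<in>UNIV. \<Sum>j\<in>UNIV. h [i, j] * X $ i * Y $ j) * volume_form h is)"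


section \<open>The flat model\<close>

definition flat_metric :: tensor
  where "flat_metric is = (if is ! 0 = is ! 1 then 1 else 0)"

definition basic_form :: "idx list \<Rightarrow> tensor" where
  "basic_form as is = (\<Sum>\<sigma> | \<sigma> permutes {..<length as}.
     of_int (sign \<sigma>) * (if permute_list \<sigma> as = is then 1 else 0))"

text \<open>The standard form for which the sign conventions are
  \<open>(X \<lrcorner> \<phi>) \<and> (Y \<lrcorner> \<phi>) \<and> \<phi> = -6 g(X, Y) vol\<close> and
  \<open>\<phi>\<^sub>i\<^sub>j\<^sub>k \<phi>\<^sub>a\<^sub>b\<^sub>k = g\<^sub>i\<^sub>a g\<^sub>j\<^sub>b - g\<^sub>i\<^sub>b g\<^sub>j\<^sub>a - \<psi>\<^sub>i\<^sub>j\<^sub>a\<^sub>b\<close>, where \<open>vol = dx\<^sup>1 \<and> \<dots> \<and> dx\<^sup>7\<close>.\<close>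

definition flat_phi :: tensor where
  "flat_phi is = basic_form [1, 2, 3] is - basic_form [1, 6, 7] is - basic_form [5, 2, 7] is
     - basic_form [5, 6, 3] is - basic_form [4, 1, 5] is - basic_form [4, 2, 6] is
     - basic_form [4, 3, 7] is"

definition flat_psi :: tensor
  where "flat_psi = hodge 3 flat_metric flat_phi"


section \<open>Tensor fields\<close>

text \<open>A tensor field is given by its components in every chart of the atlas, as functions of the
  coordinates, subject to the transformation law.\<close>

type_synonym local_field = "coords \<Rightarrow> tensor"
type_synonym 'm field = "'m chart \<Rightarrow> local_field"

definition tensor_field :: "'m chart set \<Rightarrow> nat \<Rightarrow> 'm field \<Rightarrow> bool" where
  "tensor_field A k \<tau> \<longleftrightarrow>
     (\<forall>c\<in>A. \<forall>is. length is = k \<longrightarrow> smooth_on (chart_image c) (\<lambda>u. \<tau> c u is)) \<and>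
     (\<forall>c\<in>A. \<forall>d\<in>A. \<forall>p\<in>chart_dom c \<inter> chart_dom d. \<forall>is. length is = k \<longrightarrow>
        \<tau> c (chart_map c p) is =
        (\<Sum>js | length js = k.
           (\<Prod>r<k. jacobian (transition c d) (chart_map c p) $ (js ! r) $ (is ! r)) *
           \<tau> d (chart_map d p) js))"

definition differential_form :: "'m chart set \<Rightarrow> nat \<Rightarrow> 'm field \<Rightarrow> bool" where
  "differential_form A k \<alpha> \<longleftrightarrow> tensor_field A k \<alpha> \<and>
     (\<forall>c\<in>A. \<forall>u\<in>chart_image c. alternating k (\<alpha> c u))"

text \<open>\<open>\<phi>\<close> is a nondegenerate 3-form, with associated Riemannian metric \<open>g\<close> and with the
  orientation given by \<open>A\<close>.\<close>

definition G2_structure :: "'m chart set \<Rightarrow> 'm field \<Rightarrow> 'm field \<Rightarrow> bool" where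
  "G2_structure A \<phi> g \<longleftrightarrow> differential_form A 3 \<phi> \<and> tensor_field A 2 g \<and>
     (\<forall>c\<in>A. \<forall>u\<in>chart_image c. induces_inner_product (\<phi> c u) (g c u))"

definition dual_form :: "'m field \<Rightarrow> 'm field \<Rightarrow> 'm field"
  where "dual_form g \<phi> c u = hodge 3 (g c u) (\<phi> c u)"


section \<open>Levi-Civita connection, curvature and torsion\<close>

definition christoffel :: "local_field \<Rightarrow> coords \<Rightarrow> idx \<Rightarrow> idx \<Rightarrow> idx \<Rightarrow> real" where
  "christoffel g u k i j = (\<Sum>l\<in>UNIV. inv_metric (g u) k l *
     (partial_deriv i (\<lambda>v. g v [j, l]) u + partial_deriv j (\<lambda>v. g v [i, l]) u
      - partial_deriv l (\<lambda>v. g v [i, j]) u)) / 2"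

text \<open>The first index is that of the derivative:
  \<open>(\<nabla>\<tau>)[m, i\<^sub>1, \<dots>, i\<^sub>k] = \<nabla>\<^sub>m \<tau>[i\<^sub>1, \<dots>, i\<^sub>k]\<close>.\<close>

fun cov_deriv :: "local_field \<Rightarrow> local_field \<Rightarrow> local_field" where
  "cov_deriv g \<tau> u [] = 0"
| "cov_deriv g \<tau> u (m # is) = partial_deriv m (\<lambda>v. \<tau> v is) u -
     (\<Sum>r<length is. \<Sum>l\<in>UNIV. christoffel g u l m (is ! r) * \<tau> u (is[r := l]))"

text \<open>\<open>R\<^sub>i\<^sub>j\<^sub>k\<^sub>l = g(\<nabla>\<^sub>i\<nabla>\<^sub>j\<partial>\<^sub>k - \<nabla>\<^sub>j\<nabla>\<^sub>i\<partial>\<^sub>k, \<partial>\<^sub>l)\<close>, so that the Ricci identity for a 1-form is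
  \<open>\<nabla>\<^sub>i\<nabla>\<^sub>j\<alpha>\<^sub>k - \<nabla>\<^sub>j\<nabla>\<^sub>i\<alpha>\<^sub>k = - R\<^sub>i\<^sub>j\<^sub>k\<^sub>m \<alpha>\<^sub>m\<close> in an orthonormal frame, and \<open>R\<^sub>i\<^sub>j\<^sub>j\<^sub>i > 0\<close> for \<open>i \<noteq> j\<close> on
  round spheres.\<close>

definition riemann :: "local_field \<Rightarrow> coords \<Rightarrow> idx \<Rightarrow> idx \<Rightarrow> idx \<Rightarrow> idx \<Rightarrow> real" where
  "riemann g u i j k l = (\<Sum>m\<in>UNIV. g u [m, l] *
     (partial_deriv i (\<lambda>v. christoffel g v m j k) u
      - partial_deriv j (\<lambda>v. christoffel g v m i k) u
      + (\<Sum>p\<in>UNIV. christoffel g u m i p * christoffel g u p j k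
                  - christoffel g u m j p * christoffel g u p i k)))"

text \<open>\<open>\<nabla>\<^sub>m \<phi>\<^sub>i\<^sub>j\<^sub>k = T\<^sub>m\<^sub>p \<psi>\<^sub>p\<^sub>i\<^sub>j\<^sub>k\<close>, with the repeated index contracted by the metric since coordinate
  frames are not orthonormal in general.\<close>

definition torsion_of :: "'m chart set \<Rightarrow> 'm field \<Rightarrow> 'm field \<Rightarrow> 'm field \<Rightarrow> bool" where
  "torsion_of A \<phi> g T \<longleftrightarrow> tensor_field A 2 T \<and>
     (\<forall>c\<in>A. \<forall>u\<in>chart_image c. \<forall>m i j k.
        cov_deriv (g c) (\<phi> c) u [m, i, j, k] =
        (\<Sum>p\<in>UNIV. \<Sum>q\<in>UNIV. T c u [m, p] * inv_metric (g c u) p q *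
           dual_form g \<phi> c u [q, i, j, k]))"


section \<open>Geodesics and normal coordinates\<close>

text \<open>A tangent vector at \<open>x\<close> is given by its components in every chart around \<open>x\<close>.\<close>

definition tangent_vector :: "'m chart set \<Rightarrow> 'm \<Rightarrow> ('m chart \<Rightarrow> coords) \<Rightarrow> bool" where
  "tangent_vector A x w \<longleftrightarrow> (\<forall>c\<in>A. \<forall>d\<in>A. x \<in> chart_dom c \<inter> chart_dom d \<longrightarrow>
     w d = jacobian (transition c d) (chart_map c x) *v w c)"

text \<open>In each chart, \<open>w\<close> is the velocity of \<open>\<gamma>\<close> at the times at which \<open>\<gamma>\<close> lies in the chart
  domain; these form a relatively open subset of \<open>{0..1}\<close>.\<close>

definition geodesic :: "'m::topological_space chart set \<Rightarrow> 'm field \<Rightarrow> (real \<Rightarrow> 'm) \<Rightarrow> bool" where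
  "geodesic A g \<gamma> \<longleftrightarrow> continuous_on {0..1} \<gamma> \<and>
     (\<forall>c\<in>A. \<exists>w. \<forall>t\<in>{0..1}. \<gamma> t \<in> chart_dom c \<longrightarrow>
        ((chart_map c \<circ> \<gamma>) has_vector_derivative w t) (at t within {0..1}) \<and>
        (w has_vector_derivative
           (\<chi> k. - (\<Sum>i\<in>UNIV. \<Sum>j\<in>UNIV.
              christoffel (g c) (chart_map c (\<gamma> t)) k i j * w t $ i * w t $ j)))
          (at t within {0..1}))"

text \<open>\<open>exp\<^sub>x w\<close> is defined and equal to \<open>y\<close>.\<close>

definition is_exp :: "'m::topological_space chart set \<Rightarrow> 'm field \<Rightarrow>
    'm \<Rightarrow> ('m chart \<Rightarrow> coords) \<Rightarrow> 'm \<Rightarrow> bool" where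
  "is_exp A g x w y \<longleftrightarrow> (\<exists>\<gamma>. geodesic A g \<gamma> \<and> \<gamma> 0 = x \<and>
     (\<forall>c\<in>A. x \<in> chart_dom c \<longrightarrow>
        ((chart_map c \<circ> \<gamma>) has_vector_derivative w c) (at 0 within {0..1})) \<and>
     \<gamma> 1 = y)"

definition frame_components :: "nat \<Rightarrow> tensor \<Rightarrow> (idx \<Rightarrow> coords) \<Rightarrow> tensor" where
  "frame_components k \<tau> e is = (\<Sum>js | length js = k. (\<Prod>r<k. e (is ! r) $ (js ! r)) * \<tau> js)"

definition orthonormal_frame ::
  "'m chart set \<Rightarrow> 'm field \<Rightarrow> 'm \<Rightarrow> (idx \<Rightarrow> 'm chart \<Rightarrow> coords) \<Rightarrow> bool" where
  "orthonormal_frame A g x e \<longleftrightarrow> (\<forall>i. tangent_vector A x (e i)) \<and>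
     (\<forall>c\<in>A. x \<in> chart_dom c \<longrightarrow> (\<forall>i j.
        frame_components 2 (g c (chart_map c x)) (\<lambda>i. e i c) [i, j] = (if i = j then 1 else 0)))"

text \<open>The inverse of the chart \<open>c\<close> is \<open>u \<mapsto> exp\<^sub>x (u\<^sup>i e\<^sub>i)\<close>.\<close>

definition normal_coordinates :: "'m::topological_space chart set \<Rightarrow> 'm field \<Rightarrow> 'm \<Rightarrow>
    (idx \<Rightarrow> 'm chart \<Rightarrow> coords) \<Rightarrow> 'm chart \<Rightarrow> bool" where
  "normal_coordinates A g x e c \<longleftrightarrow> orthonormal_frame A g x e \<and>
     c \<in> A \<and> x \<in> chart_dom c \<and> chart_map c x = 0 \<and>
     (\<forall>u\<in>chart_image c. is_exp A g x (\<lambda>d. \<Sum>i\<in>UNIV. u $ i *\<^sub>R e i d) (chart_inv c u))"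

definition G2_adapted_normal_coordinates ::
  "'m::topological_space chart set \<Rightarrow> 'm field \<Rightarrow> 'm field \<Rightarrow> 'm \<Rightarrow> 'm chart \<Rightarrow> bool" where
  "G2_adapted_normal_coordinates A \<phi> g x c \<longleftrightarrow> (\<exists>e. normal_coordinates A g x e c \<and>
     (\<forall>d\<in>A. x \<in> chart_dom d \<longrightarrow> (\<forall>is. length is = 4 \<longrightarrow>
        frame_components 4 (dual_form g \<phi> d (chart_map d x)) (\<lambda>i. e i d) is = flat_psi is)))"


section \<open>The second order coefficient\<close>

definition Q_coeff :: "tensor \<Rightarrow> tensor \<Rightarrow> (idx \<Rightarrow> idx \<Rightarrow> idx \<Rightarrow> idx \<Rightarrow> real) \<Rightarrow> tensor \<Rightarrow> tensor \<Rightarrow>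
    idx \<Rightarrow> idx \<Rightarrow> idx \<Rightarrow> idx \<Rightarrow> idx \<Rightarrow> idx \<Rightarrow> real" where
  "Q_coeff T DT R \<phi> \<psi> p q i j k l =
     1/2 * (- DT [p,q,i] * \<phi> [j,k,l] + DT [p,q,j] * \<phi> [i,k,l]
            - DT [p,q,k] * \<phi> [i,j,l] + DT [p,q,l] * \<phi> [i,j,k])
   + 1/2 * (\<Sum>m\<in>UNIV. - T [q,i] * T [p,m] * \<psi> [m,j,k,l] + T [q,j] * T [p,m] * \<psi> [m,i,k,l]
                      - T [q,k] * T [p,m] * \<psi> [m,i,j,l] + T [q,l] * T [p,m] * \<psi> [m,i,j,k])
   + 1/6 * (\<Sum>m\<in>UNIV. R p i q m * \<psi> [m,j,k,l] + R p j q m * \<psi> [i,m,k,l]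
                      + R p k q m * \<psi> [i,j,m,l] + R p l q m * \<psi> [i,j,k,m])"

end

theory Submission
  imports Defs "HOL-Combinatorics.Multiset_Permutations"
begin

text \<open>
  In the chart the claim is the Taylor formula of order two for the component \<open>\<psi>\<^sub>i\<^sub>j\<^sub>k\<^sub>l\<close>, once its first two
  derivatives at the origin are known, the second ones after contraction with \<open>u\<^sup>p u\<^sup>q\<close>.  They result from
  a formula for the covariant derivative of \<open>\<psi>\<close> and from the behaviour of the connection at the origin of
  normal coordinates.

  \<^bold>\<open>The derivative of \<open>\<psi>\<close>.\<close>  The Hodge star is parallel, so \<open>\<nabla>\<^sub>m\<psi> = *\<nabla>\<^sub>m\<phi> = *(T\<^sub>m \<lrcorner> *\<phi>)\<close>, where \<open>T\<^sub>m\<close> is the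
  1-form \<open>T\<^sub>m\<^sub>p dx\<^sup>p\<close>, and \<open>*(\<theta> \<lrcorner> *\<phi>) = \<phi> \<and> \<theta>\<close> for every 1-form \<open>\<theta>\<close> (\<open>hodge_interior_product_hodge\<close>).  Hence
  \<open>\<partial>\<^sub>m\<psi>\<close> is the sum of a Christoffel term and of \<open>\<phi> \<and> T\<^sub>m\<close>, at every point of the chart (\<open>partial_deriv_\<psi>\<close>).
  Parallelism of the star is shown infinitesimally: the Christoffel symbols \<open>\<Gamma>\<^sub>m\<close> act as one and the same
  derivation on all tensors, the derivatives of the inverse metric and of the volume form are given by
  this action, and the action is compatible with contractions (\<open>has_real_derivative_hodge\<close>).

  \<^bold>\<open>The connection at the origin.\<close>  By uniqueness of geodesics, the rays \<open>t u\<close> are geodesics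
  (\<open>radial_geodesic\<close>), so that \<open>\<Gamma>(t u)(u, u) = 0\<close> for small \<open>t\<close>.  At \<open>t = 0\<close> this gives \<open>\<Gamma>(0) = 0\<close>.  Its
  derivative at \<open>t = 0\<close> is a cubic identity in \<open>u\<close>, whose polarisation says that \<open>u\<^sup>p u\<^sup>q \<partial>\<^sub>p\<Gamma>\<^sup>m\<^sub>q\<^sub>i\<close> is a third of
  \<open>u\<^sup>p u\<^sup>q R\<^sub>p\<^sub>i\<^sub>q\<^sub>m\<close> (\<open>radial_christoffel_riemann\<close>).

  The formula for \<open>\<partial>\<^sub>q\<psi>\<close> is then evaluated and differentiated once more at the origin.  Its Christoffel
  term yields the curvature terms, with \<open>1/2 \<cdot> 1/3 = 1/6\<close>, and the term \<open>\<phi> \<and> T\<^sub>q\<close> yields those with \<open>\<nabla>T\<close> and, as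
  \<open>\<nabla>\<^sub>p\<phi> = T\<^sub>p \<lrcorner> \<psi>\<close>, those quadratic in \<open>T\<close> (\<open>dual_form_expansion\<close>).
\<close>

section \<open>Partial derivatives and smooth functions\<close>

text \<open>Components of fields are arbitrary outside the image of the chart, so identities between them hold
  only on an open set.\<close>

lemma partial_deriv_cong:
  assumes "open V" "u \<in> V" "\<And>v. v \<in> V \<Longrightarrow> f v = g v"
  shows "partial_deriv i f u = partial_deriv i g u"
proof -
  have "(f has_derivative f') (at u) \<longleftrightarrow> (g has_derivative f') (at u)" for f'
    using has_derivative_transform_within_open[of f f' u UNIV V g]
      has_derivative_transform_within_open[of g f' u UNIV V f] assms by auto
  then show ?thesis
    by (simp add: partial_deriv_def frechet_derivative_def)
qed

lemma has_derivative_partial_deriv: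
  fixes f :: "real ^ 'n::finite \<Rightarrow> real"
  assumes "f differentiable (at u)"
  shows "(f has_derivative (\<lambda>h. \<Sum>i\<in>UNIV. h $ i * partial_deriv i f u)) (at u)"
proof -
  let ?D = "frechet_derivative f (at u)"
  have D: "(f has_derivative ?D) (at u)"
    using assms by (simp add: frechet_derivative_works[symmetric])
  then have lin: "linear ?D"
    by (rule has_derivative_linear)
  have "?D h = (\<Sum>i\<in>UNIV. h $ i * partial_deriv i f u)" for h
  proof -
    have "?D h = ?D (\<Sum>i\<in>UNIV. (h $ i) *s axis i 1)"
      by (simp add: basis_expansion)
    also have "\<dots> = (\<Sum>i\<in>UNIV. h $ i * partial_deriv i f u)"
      by (simp add: linear_sum[OF lin] linear_cmul[OF lin] partial_deriv_def scalar_mult_eq_scaleR)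
    finally show ?thesis .
  qed
  then have "?D = (\<lambda>h. \<Sum>i\<in>UNIV. h $ i * partial_deriv i f u)"
    by (rule ext)
  with D show ?thesis by simp
qed

lemma has_real_derivative_along_line:
  fixes f :: "real ^ 'n::finite \<Rightarrow> real"
  assumes "f differentiable (at (a + t *\<^sub>R h))"
  shows "((\<lambda>s. f (a + s *\<^sub>R h)) has_real_derivative
    (\<Sum>i\<in>UNIV. h $ i * partial_deriv i f (a + t *\<^sub>R h))) (at t)"
proof -
  have 1: "((\<lambda>s. a + s *\<^sub>R h) has_derivative (\<lambda>s. s *\<^sub>R h)) (at t)"
    by (auto intro!: derivative_eq_intros)
  have "((\<lambda>s. f (a + s *\<^sub>R h)) has_derivative
      (\<lambda>s. \<Sum>i\<in>UNIV. (s *\<^sub>R h) $ i * partial_deriv i f (a + t *\<^sub>R h))) (at t)"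
    using has_derivative_compose[OF 1 has_derivative_partial_deriv[OF assms]] by simp
  moreover have "(\<lambda>s. \<Sum>i\<in>UNIV. (s *\<^sub>R h) $ i * partial_deriv i f (a + t *\<^sub>R h)) =
      (*) (\<Sum>i\<in>UNIV. h $ i * partial_deriv i f (a + t *\<^sub>R h))"
    by (rule ext) (simp add: sum_distrib_left mult_ac)
  ultimately show ?thesis
    by (simp add: has_field_derivative_def)
qed

lemma has_real_derivative_axis:
  fixes f :: "real ^ 'n::finite \<Rightarrow> real"
  assumes "f differentiable (at u)"
  shows "((\<lambda>s. f (u + s *\<^sub>R axis m 1)) has_real_derivative partial_deriv m f u) (at 0)"
proof -
  have "(\<Sum>i\<in>UNIV. axis m 1 $ i * partial_deriv i f u) = partial_deriv m f u"
    by (simp add: axis_def if_distrib[where f="\<lambda>x. x * _"] cong: if_cong)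
  then show ?thesis
    using has_real_derivative_along_line[of f u 0 "axis m 1"] assms by simp
qed

text \<open>Partial derivatives are computed along the coordinate line, where the calculus rules for functions
  of one real variable apply.\<close>

lemma partial_deriv_axis_unique:
  fixes f :: "real ^ 'n::finite \<Rightarrow> real"
  assumes "f differentiable (at u)"
    and "((\<lambda>s. f (u + s *\<^sub>R axis m 1)) has_real_derivative d) (at 0)"
  shows "partial_deriv m f u = d"
  using DERIV_unique[OF has_real_derivative_axis[OF assms(1)] assms(2)] .

lemma partial_deriv_mult:
  fixes f g :: "real ^ 'n::finite \<Rightarrow> real"
  assumes "f differentiable (at u)" "g differentiable (at u)"
  shows "partial_deriv i (\<lambda>v. f v * g v) u = f u * partial_deriv i g u + partial_deriv i f u * g u"
  by (rule partial_deriv_axis_unique)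
    (auto intro!: derivative_eq_intros has_real_derivative_axis assms differentiable_mult)

lemma partial_deriv_add:
  fixes f g :: "real ^ 'n::finite \<Rightarrow> real"
  assumes "f differentiable (at u)" "g differentiable (at u)"
  shows "partial_deriv i (\<lambda>v. f v + g v) u = partial_deriv i f u + partial_deriv i g u"
  by (rule partial_deriv_axis_unique)
    (auto intro!: derivative_eq_intros has_real_derivative_axis assms differentiable_add)

lemma partial_deriv_sum:
  fixes f :: "'a \<Rightarrow> real ^ 'n::finite \<Rightarrow> real"
  assumes "finite S" "\<And>a. a \<in> S \<Longrightarrow> f a differentiable (at u)"
  shows "partial_deriv i (\<lambda>v. \<Sum>a\<in>S. f a v) u = (\<Sum>a\<in>S. partial_deriv i (f a) u)"
  by (rule partial_deriv_axis_unique)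
    (auto intro!: derivative_eq_intros has_real_derivative_axis assms differentiable_sum)

lemma partial_deriv_const: "partial_deriv i (\<lambda>v. c) u = 0"
  by (simp add: partial_deriv_def)

lemma Ck_on_cong:
  assumes "open V" "\<And>v. v \<in> V \<Longrightarrow> f v = g v"
  shows "Ck_on k V f \<longleftrightarrow> Ck_on k V g"
  using assms(2)
proof (induction k arbitrary: f g)
  case 0
  then show ?case by (simp cong: continuous_on_cong)
next
  case (Suc k)
  have "f differentiable (at u) \<longleftrightarrow> g differentiable (at u)" if "u \<in> V" for u
    using has_derivative_transform_within_open[of f _ u UNIV V g]
      has_derivative_transform_within_open[of g _ u UNIV V f] assms(1) Suc.prems that
    unfolding differentiable_def by metis
  moreover have "Ck_on k V (partial_deriv i f) \<longleftrightarrow> Ck_on k V (partial_deriv i g)" for i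
    by (rule Suc.IH) (rule partial_deriv_cong[OF assms(1) _ Suc.prems])
  ultimately show ?case by simp
qed

lemma Ck_on_subset:
  assumes "Ck_on k V f" "W \<subseteq> V"
  shows "Ck_on k W f"
  using assms(1)
proof (induction k arbitrary: f)
  case 0
  then show ?case using assms(2) continuous_on_subset by auto
next
  case (Suc k)
  then show ?case using assms(2) by auto
qed

lemma Ck_on_SucD: "Ck_on (Suc k) V f \<Longrightarrow> Ck_on k V f"
proof (induction k arbitrary: f)
  case 0
  then show ?case
    by (auto intro: continuous_at_imp_continuous_on differentiable_imp_continuous_within)
next
  case (Suc k)
  show ?case
    using Suc.prems Suc.IH by (metis Ck_on.simps(2))
qed

lemma Ck_on_const:
  fixes V :: "(real ^ 'n::finite) set"
  shows "Ck_on k V (\<lambda>v. c)"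
proof (induction k arbitrary: c)
  case (Suc k)
  have "partial_deriv i (\<lambda>v. c) = (\<lambda>v. 0)" for i :: 'n
    by (rule ext) (simp add: partial_deriv_const)
  with Suc show ?case by simp
qed simp

lemma Ck_on_add:
  fixes f g :: "real ^ 'n::finite \<Rightarrow> real"
  assumes "open V" "Ck_on k V f" "Ck_on k V g"
  shows "Ck_on k V (\<lambda>v. f v + g v)"
  using assms(2,3)
proof (induction k arbitrary: f g)
  case 0
  then show ?case by (simp add: continuous_on_add)
next
  case (Suc k)
  have "Ck_on k V (\<lambda>v. partial_deriv i f v + partial_deriv i g v)" for i
    using Suc by simp
  then have "Ck_on k V (partial_deriv i (\<lambda>v. f v + g v))" for i
    using Suc.prems
    by (subst Ck_on_cong[OF assms(1), where g="\<lambda>v. partial_deriv i f v + partial_deriv i g v"])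
       (auto intro: partial_deriv_add)
  then show ?case using Suc.prems by simp
qed

lemma Ck_on_mult:
  fixes f g :: "real ^ 'n::finite \<Rightarrow> real"
  assumes "open V" "Ck_on k V f" "Ck_on k V g"
  shows "Ck_on k V (\<lambda>v. f v * g v)"
  using assms(2,3)
proof (induction k arbitrary: f g)
  case 0
  then show ?case by (simp add: continuous_on_mult)
next
  case (Suc k)
  let ?D = "\<lambda>i v. f v * partial_deriv i g v + partial_deriv i f v * g v"
  have "Ck_on k V (?D i)" for i
    using Suc.IH Suc.prems Ck_on_SucD[OF Suc.prems(1)] Ck_on_SucD[OF Suc.prems(2)]
    by (intro Ck_on_add[OF assms(1)]) auto
  then have "Ck_on k V (partial_deriv i (\<lambda>v. f v * g v))" for i
    using Suc.prems
    by (subst Ck_on_cong[OF assms(1), where g="?D i"]) (auto intro: partial_deriv_mult)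
  then show ?case using Suc.prems by simp
qed

lemma Ck_on_sum:
  fixes f :: "'a \<Rightarrow> real ^ 'n::finite \<Rightarrow> real"
  assumes "open V" "finite S" "\<And>a. a \<in> S \<Longrightarrow> Ck_on k V (f a)"
  shows "Ck_on k V (\<lambda>v. \<Sum>a\<in>S. f a v)"
  using assms(2,3)
  by (induction S rule: finite_induct) (auto intro: Ck_on_const Ck_on_add[OF assms(1)])

lemma Ck_on_uminus:
  fixes f :: "real ^ 'n::finite \<Rightarrow> real"
  assumes "open V" "Ck_on k V f"
  shows "Ck_on k V (\<lambda>v. - f v)"
  using Ck_on_mult[OF assms(1) Ck_on_const[of _ _ "-1"] assms(2)] by simp

lemma Ck_on_diff:
  fixes f g :: "real ^ 'n::finite \<Rightarrow> real"
  assumes "open V" "Ck_on k V f" "Ck_on k V g"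
  shows "Ck_on k V (\<lambda>v. f v - g v)"
  using Ck_on_add[OF assms(1,2) Ck_on_uminus[OF assms(1,3)]] by simp

lemma smooth_on_partial_deriv: "smooth_on V f \<Longrightarrow> smooth_on V (partial_deriv i f)"
  by (metis smooth_on_def Ck_on.simps(2))

lemma smooth_on_differentiable: "smooth_on V f \<Longrightarrow> u \<in> V \<Longrightarrow> f differentiable (at u)"
  by (metis smooth_on_def Ck_on.simps(2))

section \<open>Sums over multi-indices and alternating tensors\<close>

lemma finite_lists_length: "finite {is :: 'a::finite list. length is = k}"
  using finite_lists_length_eq[of "UNIV :: 'a set" k] by simp

lemma sum_lists_append:
  fixes f :: "'a::finite list \<Rightarrow> 'b::comm_monoid_add"
  shows "(\<Sum>is | length is = m + n. f is) = (\<Sum>is | length is = m. \<Sum>js | length js = n. f (is @ js))"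
proof -
  have "(\<Sum>is | length is = m. \<Sum>js | length js = n. f (is @ js)) =
      (\<Sum>(is, js) \<in> {is. length is = m} \<times> {js. length js = n}. f (is @ js))"
    by (rule sum.cartesian_product)
  also have "\<dots> = (\<Sum>is | length is = m + n. f is)"
    by (rule sum.reindex_bij_witness[where i="\<lambda>is. (take m is, drop m is)" and j="\<lambda>(is, js). is @ js"])
       auto
  finally show ?thesis by simp
qed

lemma sum_lists_1: "(\<Sum>is | length is = Suc 0. f is) = (\<Sum>i\<in>UNIV. f [i])"
  for f :: "'a::finite list \<Rightarrow> 'b::comm_monoid_add"
  by (rule sum.reindex_bij_witness[where i="\<lambda>i. [i]" and j=hd]) (auto simp: length_Suc_conv)

lemma sum_lists_Suc:
  fixes f :: "'a::finite list \<Rightarrow> 'b::comm_monoid_add"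
  shows "(\<Sum>is | length is = Suc n. f is) = (\<Sum>i\<in>UNIV. \<Sum>is | length is = n. f (i # is))"
  using sum_lists_append[where m="Suc 0" and n=n and f=f] by (simp add: sum_lists_1)

text \<open>An endomorphism \<open>N\<close> acts on covariant tensors as a derivation.  For \<open>N l i = \<Gamma>\<^sup>l\<^sub>m\<^sub>i\<close> this is the
  Christoffel part of the covariant derivative: \<open>\<nabla>\<^sub>m\<tau> = \<partial>\<^sub>m\<tau> - index_action N \<tau>\<close>.\<close>

definition index_action :: "('a::finite \<Rightarrow> 'a \<Rightarrow> real) \<Rightarrow> ('a list \<Rightarrow> real) \<Rightarrow> 'a list \<Rightarrow> real" where
  "index_action N \<alpha> is = (\<Sum>r<length is. \<Sum>l\<in>UNIV. N l (is ! r) * \<alpha> (is[r := l]))"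

lemma index_action_append:
  "index_action N \<alpha> (is @ js) =
    index_action N (\<lambda>is. \<alpha> (is @ js)) is + index_action N (\<lambda>js. \<alpha> (is @ js)) js"
proof -
  let ?f = "\<lambda>r. \<Sum>l\<in>UNIV. N l ((is @ js) ! r) * \<alpha> ((is @ js)[r := l])"
  have *: "sum f {..<m + n} = (\<Sum>r<m. f r) + (\<Sum>r<n. f (m + r))" for f :: "nat \<Rightarrow> real" and m n
    by (induction n) auto
  show ?thesis
    unfolding index_action_def length_append *
    by (intro arg_cong2[where f="(+)"] sum.cong refl) (auto simp: nth_append list_update_append)
qed

text \<open>A full contraction is invariant under the linear group, so the derivation can be moved from one
  factor to the other.  Concretely, \<open>(is, l) \<mapsto> (is[r := l], is ! r)\<close> is an involution that exchanges
  the summation index \<open>l\<close> with the contracted index \<open>is ! r\<close>.\<close>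

lemma index_action_adjoint:
  fixes N :: "'a::finite \<Rightarrow> 'a \<Rightarrow> real"
  shows "(\<Sum>is | length is = k. index_action (\<lambda>i j. N j i) \<alpha> is * \<beta> is) =
    (\<Sum>is | length is = k. \<alpha> is * index_action N \<beta> is)"
proof -
  have "(\<Sum>is | length is = k. \<Sum>l\<in>UNIV. N (is ! r) l * \<alpha> (is[r := l]) * \<beta> is) =
     (\<Sum>is | length is = k. \<Sum>l\<in>UNIV. \<alpha> is * (N l (is ! r) * \<beta> (is[r := l])))" if "r < k" for r
    unfolding sum.cartesian_product
    by (rule sum.reindex_bij_witness[where i="\<lambda>(is, l). (is[r := l], is ! r)" and j="\<lambda>(is, l). (is[r := l], is ! r)"])
       (use that in auto)
  then have "(\<Sum>r<k. \<Sum>is | length is = k. \<Sum>l\<in>UNIV. N (is ! r) l * \<alpha> (is[r := l]) * \<beta> is) =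
     (\<Sum>r<k. \<Sum>is | length is = k. \<Sum>l\<in>UNIV. \<alpha> is * (N l (is ! r) * \<beta> (is[r := l])))"
    by simp
  then show ?thesis
    unfolding index_action_def
    by (simp add: sum_distrib_left sum_distrib_right sum.swap[of _ "{..<k}" "{is. length is = k}"])
qed

text \<open>The form induced by \<open>G\<close> on tensor powers; for the inverse metric it raises all indices at once.\<close>

definition multi_pairing :: "('a \<Rightarrow> 'b \<Rightarrow> real) \<Rightarrow> 'a list \<Rightarrow> 'b list \<Rightarrow> real" where
  "multi_pairing G is js = (\<Prod>r<length is. G (is ! r) (js ! r))"

lemma multi_pairing_Nil [simp]: "multi_pairing G [] js = 1"
  by (simp add: multi_pairing_def)

lemma multi_pairing_Cons [simp]: "multi_pairing G (i # is) (j # js) = G i j * multi_pairing G is js"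
  unfolding multi_pairing_def length_Cons prod.lessThan_Suc_shift by simp

lemma multi_pairing_append:
  "length is = length js \<Longrightarrow>
    multi_pairing G (is @ is') (js @ js') = multi_pairing G is js * multi_pairing G is' js'"
  by (induction "is" js rule: list_induct2) (auto simp: mult_ac)

lemma multi_pairing_commute:
  assumes "\<And>i j. G i j = G j i" "length is = length js"
  shows "multi_pairing G is js = multi_pairing G js is"
  unfolding multi_pairing_def using assms by simp

lemma multi_pairing_update:
  assumes "r < length is"
  shows "multi_pairing G (is[r := l]) js =
    G l (js ! r) * (\<Prod>r'\<in>{..<length is} - {r}. G (is ! r') (js ! r'))"
proof -
  have "multi_pairing G (is[r := l]) js =
      G l (js ! r) * (\<Prod>r'\<in>{..<length is} - {r}. G (is[r := l] ! r') (js ! r'))"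
    unfolding multi_pairing_def using assms by (subst prod.remove[of _ r]) auto
  also have "(\<Prod>r'\<in>{..<length is} - {r}. G (is[r := l] ! r') (js ! r')) =
      (\<Prod>r'\<in>{..<length is} - {r}. G (is ! r') (js ! r'))"
    by (rule prod.cong) auto
  finally show ?thesis .
qed

lemma multi_pairing_update2:
  assumes "r < length is" "length js = length is"
  shows "multi_pairing G is (js[r := l]) =
    G (is ! r) l * (\<Prod>r'\<in>{..<length is} - {r}. G (is ! r') (js ! r'))"
proof -
  have "multi_pairing G is (js[r := l]) =
      G (is ! r) l * (\<Prod>r'\<in>{..<length is} - {r}. G (is ! r') (js[r := l] ! r'))"
    unfolding multi_pairing_def using assms by (subst prod.remove[of _ r]) auto
  also have "(\<Prod>r'\<in>{..<length is} - {r}. G (is ! r') (js[r := l] ! r')) =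
      (\<Prod>r'\<in>{..<length is} - {r}. G (is ! r') (js ! r'))"
    by (rule prod.cong) auto
  finally show ?thesis .
qed

lemma permute_list_transpose:
  assumes "a < length is" "b < length is"
  shows "permute_list (Transposition.transpose a b) is = is[a := is ! b, b := is ! a]"
proof (rule nth_equalityI)
  fix i assume "i < length (permute_list (Transposition.transpose a b) is)"
  then show "permute_list (Transposition.transpose a b) is ! i = is[a := is ! b, b := is ! a] ! i"
    using assms permutes_swap_id[of a "{..<length is}" b]
    by (auto simp: permute_list_nth Transposition.transpose_def nth_list_update)
qed simp

text \<open>Transpositions generate the symmetric group.\<close>

lemma alternatingI:
  assumes "\<And>is a b. length is = k \<Longrightarrow> a < b \<Longrightarrow> b < k \<Longrightarrow> \<alpha> (is[a := is ! b, b := is ! a]) = - \<alpha> is"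
  shows "alternating k \<alpha>"
  unfolding alternating_def
proof (intro allI impI)
  fix "is" \<sigma> assume "length (is :: idx list) = k \<and> \<sigma> permutes {..<k}"
  then have len: "length is = k" and "\<sigma> permutes {..<k}" by auto
  have transposed: "\<alpha> (js[a := js ! b, b := js ! a]) = - \<alpha> js" if "length js = k" "a < k" "b < k" "a \<noteq> b" for js a b
  proof (cases "a < b")
    case True
    then show ?thesis using assms that by blast
  next
    case False
    have "js[a := js ! b, b := js ! a] = js[b := js ! a, a := js ! b]"
      using that by (simp add: list_update_swap)
    with False show ?thesis using assms[of js b a] that by auto
  qed
  show "\<alpha> (permute_list \<sigma> is) = of_int (sign \<sigma>) * \<alpha> is"
    using finite_lessThan \<open>\<sigma> permutes {..<k}\<close>
  proof (induction \<sigma> rule: permutes_rev_induct)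
    case (swap a b p)
    have "permute_list (p \<circ> Transposition.transpose a b) is =
        permute_list (Transposition.transpose a b) (permute_list p is)"
      using swap.hyps len by (intro permute_list_compose permutes_swap_id) auto
    moreover have "sign (p \<circ> Transposition.transpose a b) = - sign p"
      using swap.hyps permutation_permutes finite_lessThan
      by (subst sign_compose) (auto simp: sign_swap_id permutation_swap_id)
    moreover have "\<alpha> (permute_list (Transposition.transpose a b) (permute_list p is)) = - \<alpha> (permute_list p is)"
      using swap.hyps len transposed[of "permute_list p is" a b] by (simp add: permute_list_transpose)
    ultimately show ?case
      using swap.IH by (metis mult_minus_left of_int_minus)
  qed simp
qed

lemma alternating_swap:
  assumes "alternating k \<alpha>" "length is = k" "a < k" "b < k" "a \<noteq> b"
  shows "\<alpha> (is[a := is ! b, b := is ! a]) = - \<alpha> is"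
proof -
  have "Transposition.transpose a b permutes {..<k}"
    using assms by (intro permutes_swap_id) auto
  then have "\<alpha> (permute_list (Transposition.transpose a b) is) =
      of_int (sign (Transposition.transpose a b)) * \<alpha> is"
    using assms unfolding alternating_def by blast
  then show ?thesis
    using assms by (simp add: permute_list_transpose sign_swap_id)
qed

lemma alternating_not_distinct:
  assumes "alternating k \<alpha>" "length is = k" "\<not> distinct is"
  shows "\<alpha> is = 0"
proof -
  obtain a b where ab: "a < k" "b < k" "a \<noteq> b" "is ! a = is ! b"
    using assms by (auto simp: distinct_conv_nth)
  have "is[a := is ! b, b := is ! a] = is"
    by (metis ab(4) list_update_id)
  then show ?thesis
    using alternating_swap[OF assms(1,2) ab(1-3)] by simp
qed

text \<open>The two signs cancel, so the product of two alternating tensors does not depend on the order of the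
  indices.\<close>

lemma alternating_mult_permute:
  assumes "alternating k \<alpha>" "alternating k \<beta>" "length is = k" "mset js = mset is"
  shows "\<alpha> js * \<beta> js = \<alpha> is * \<beta> is"
proof -
  obtain \<sigma> where \<sigma>: "\<sigma> permutes {..<length is}" "permute_list \<sigma> is = js"
    using mset_eq_permutation[OF assms(4)] by auto
  have "of_int (sign \<sigma>) * of_int (sign \<sigma>) = (1 :: real)"
    by (simp flip: of_int_mult)
  moreover have "\<alpha> js = of_int (sign \<sigma>) * \<alpha> is" "\<beta> js = of_int (sign \<sigma>) * \<beta> is"
    using assms \<sigma> unfolding alternating_def by blast+
  ultimately show ?thesis
    by (metis mult.assoc mult.left_commute mult_1)
qed

section \<open>The derivative of the determinant\<close>

text \<open>The differential of the determinant at \<open>M\<close> in the direction \<open>D\<close>, obtained by varying one row at a time.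
  For \<open>D = N ** M\<close> and \<open>D = M ** N\<close> it is \<open>trace N * det M\<close>; these are the two halves of the derivative of
  a metric under a metric connection.\<close>

definition det_derivative :: "real ^ 'n ^ 'n \<Rightarrow> real ^ 'n ^ 'n \<Rightarrow> real" where
  "det_derivative M D = (\<Sum>i\<in>UNIV. det (\<chi> r. if r = i then D $ i else M $ r))"

lemma has_real_derivative_det:
  fixes M :: "real \<Rightarrow> real ^ 'n::finite ^ 'n"
  assumes "\<And>i j. ((\<lambda>s. M s $ i $ j) has_real_derivative D $ i $ j) (at t)"
  shows "((\<lambda>s. det (M s)) has_real_derivative det_derivative (M t) D) (at t)"
proof -
  let ?P = "{p. p permutes (UNIV :: 'n set)}"
  have prod: "(\<Prod>j\<in>UNIV. (\<chi> r. if r = i then D $ i else M t $ r) $ j $ p j) =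
      D $ i $ p i * (\<Prod>j\<in>UNIV - {i}. M t $ j $ p j)" for p and i :: 'n
    by (subst prod.remove[of _ i]) (auto intro!: prod.cong)
  have "((\<lambda>s. \<Sum>p\<in>?P. of_int (sign p) * (\<Prod>i\<in>UNIV. M s $ i $ p i)) has_real_derivative
      (\<Sum>p\<in>?P. of_int (sign p) * (\<Sum>i\<in>UNIV. D $ i $ p i * (\<Prod>j\<in>UNIV - {i}. M t $ j $ p j)))) (at t)"
    by (intro DERIV_sum DERIV_cmult has_field_derivative_prod assms)
  moreover have "(\<Sum>p\<in>?P. of_int (sign p) * (\<Sum>i\<in>UNIV. D $ i $ p i * (\<Prod>j\<in>UNIV - {i}. M t $ j $ p j))) =
      det_derivative (M t) D"
    unfolding det_derivative_def det_def prod
    by (simp add: sum_distrib_left sum.swap[of _ ?P])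
  ultimately show ?thesis
    unfolding det_def by simp
qed

lemma det_derivative_transpose:
  fixes M D :: "real ^ 'n::finite ^ 'n"
  shows "det_derivative (transpose M) (transpose D) = det_derivative M D"
proof -
  let ?M = "\<lambda>s. M + s *\<^sub>R D"
  have 1: "((\<lambda>s. det (?M s)) has_real_derivative det_derivative (?M 0) D) (at 0)"
    by (rule has_real_derivative_det) (auto intro!: derivative_eq_intros)
  have "((\<lambda>s. det (transpose (?M s))) has_real_derivative
      det_derivative (transpose (?M 0)) (transpose D)) (at 0)"
    by (rule has_real_derivative_det) (auto intro!: derivative_eq_intros simp: transpose_def)
  then show ?thesis
    using DERIV_unique[OF 1] by simp
qed

lemma det_derivative_add:
  fixes M D E :: "real ^ 'n::finite ^ 'n"
  shows "det_derivative M (D + E) = det_derivative M D + det_derivative M E"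
proof -
  have "det (\<chi> r. if r = i then (D + E) $ i else M $ r) =
      det (\<chi> r. if r = i then D $ i else M $ r) + det (\<chi> r. if r = i then E $ i else M $ r)" for i
    using det_row_add[of i "\<lambda>_. D $ i" "\<lambda>_. E $ i" "\<lambda>r. M $ r"]
    by (simp only: vector_add_component)
  then show ?thesis
    by (simp add: det_derivative_def sum.distrib)
qed

text \<open>Row \<open>i\<close> of \<open>N ** M\<close> is a combination of the rows of \<open>M\<close>, of which only the multiple \<open>N $ i $ i\<close> of row \<open>i\<close>
  survives in the determinant.\<close>

lemma det_derivative_left_mult:
  fixes M N :: "real ^ 'n::finite ^ 'n"
  shows "det_derivative M (N ** M) = trace N * det M"
proof -
  have "(\<chi> r. if r = i then (N ** M) $ i else M $ r) =
      (\<chi> r. if r = i then \<Sum>l\<in>UNIV. N $ i $ l *s row l M else row r M)" for i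
    by (simp add: vec_eq_iff matrix_matrix_mult_def row_def)
  then have "det (\<chi> r. if r = i then (N ** M) $ i else M $ r) = N $ i $ i * det M" for i
    using cramer_lemma_transpose[of i "N $ i" M] by simp
  then show ?thesis
    by (simp add: det_derivative_def trace_def sum_distrib_right)
qed

lemma det_derivative_right_mult:
  fixes M N :: "real ^ 'n::finite ^ 'n"
  shows "det_derivative M (M ** N) = trace N * det M"
proof -
  have "det_derivative M (M ** N) = det_derivative (transpose M) (transpose N ** transpose M)"
    by (metis det_derivative_transpose matrix_transpose_mul)
  then show ?thesis
    by (simp add: det_derivative_left_mult) (simp add: trace_def transpose_def)
qed

section \<open>The Levi-Civita symbol\<close>

text \<open>The entry at position \<open>r\<close> of a list, counted from \<open>0\<close>, is row \<open>r + 1\<close> of the matrix; the last one has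
  index \<open>7 = 0\<close>.\<close>

definition row_index :: "nat \<Rightarrow> idx" where "row_index r = of_nat (Suc r)"

lemma less_7_cases: "r < 7 \<longleftrightarrow> r \<in> {0, 1, 2, 3, 4, 5, 6 :: nat}"
  by auto

lemma inj_row_index: "inj_on row_index {..<7}"
proof
  fix r s assume "r \<in> {..<7}" "s \<in> {..<7}" "row_index r = row_index s"
  then show "r = s"
    unfolding lessThan_iff less_7_cases by (auto simp: row_index_def)
qed

lemma UNIV_row_index: "UNIV = row_index ` {..<7}"
proof -
  have "card (row_index ` {..<7}) = CARD(idx)"
    by (simp add: card_image inj_row_index)
  then show ?thesis
    by (metis card_subset_eq finite_class.finite_UNIV subset_UNIV)
qed

lemma bij_row_index: "bij_betw row_index {..<7} UNIV"
  using inj_row_index UNIV_row_index by (simp add: bij_betw_def)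

lemma length_7_conv: "length is = 7 \<longleftrightarrow> (\<exists>a b c d e f g. is = [a, b, c, d, e, f, g])"
  by (auto simp: numeral_eq_Suc length_Suc_conv)

lemma vector_nth:
  fixes vs :: "'a::zero list"
  assumes "length vs = 7" "r < 7"
  shows "(vector vs :: 'a ^ 7) $ row_index r = vs ! r"
proof -
  obtain a b c d e f g where vs: "vs = [a, b, c, d, e, f, g]"
    using assms(1)[unfolded length_7_conv] by blast
  show ?thesis
    using assms(2) unfolding vs vector_def less_7_cases by (auto simp: row_index_def)
qed

lemma vector_update:
  fixes vs :: "'a::zero list"
  assumes "length vs = 7" "r < 7"
  shows "(vector (vs[r := x]) :: 'a ^ 7) = (\<chi> i. if i = row_index r then x else vector vs $ i)"
proof -
  have "vector (vs[r := x]) $ i = (if i = row_index r then x else vector vs $ i)" for i :: idx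
  proof -
    obtain s where s: "s < 7" "i = row_index s"
      using UNIV_row_index by auto
    have "row_index s = row_index r \<longleftrightarrow> s = r"
      using inj_onD[OF inj_row_index] s(1) assms(2) by auto
    then show ?thesis
      using assms s by (simp add: vector_nth nth_list_update)
  qed
  then show ?thesis by (simp add: vec_eq_iff)
qed

lemma det_vector_update_sum:
  fixes vs :: "(real ^ 7) list"
  assumes "length vs = 7" "r < 7" "finite S"
  shows "det (vector (vs[r := \<Sum>l\<in>S. c l *s b l]) :: real ^ 7 ^ 7) =
    (\<Sum>l\<in>S. c l * det (vector (vs[r := b l]) :: real ^ 7 ^ 7))"
  unfolding vector_update[OF assms(1,2)]
  using det_linear_row_sum[OF assms(3), of "row_index r" "\<lambda>_ l. c l *s b l" "\<lambda>i. vector vs $ i"]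
    det_row_mul[of "row_index r" _ "\<lambda>_. b _" "\<lambda>i. vector vs $ i"]
  by simp

definition levi_civita :: tensor where
  "levi_civita is = det (vector (map (\<lambda>i. axis i 1) is) :: real ^ 7 ^ 7)"

lemma volume_form_levi_civita: "volume_form h is = sqrt (det (metric_matrix h)) * levi_civita is"
  by (simp add: volume_form_def levi_civita_def)

lemma det_vector_map_sum:
  assumes "length us + length is = 7"
  shows "det (vector (us @ map (\<lambda>i. \<Sum>j\<in>UNIV. G i j *s axis j 1) is) :: real ^ 7 ^ 7) =
    (\<Sum>js | length js = length is. multi_pairing G is js *
      det (vector (us @ map (\<lambda>j. axis j 1) js) :: real ^ 7 ^ 7))"
  using assms
proof (induction "is" arbitrary: us)
  case Nil
  then show ?case by simp
next
  case (Cons i "is")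
  let ?rest = "map (\<lambda>i. \<Sum>j\<in>UNIV. G i j *s axis j 1) is"
  have "det (vector (us @ (\<Sum>j\<in>UNIV. G i j *s axis j 1) # ?rest) :: real ^ 7 ^ 7) =
      (\<Sum>j\<in>UNIV. G i j * det (vector (us @ axis j 1 # ?rest) :: real ^ 7 ^ 7))"
    using det_vector_update_sum[of "us @ 0 # ?rest" "length us" UNIV "G i" "\<lambda>j. axis j 1"] Cons.prems
    by simp
  also have "\<dots> = (\<Sum>j\<in>UNIV. G i j * (\<Sum>js | length js = length is. multi_pairing G is js *
      det (vector (us @ axis j 1 # map (\<lambda>j. axis j 1) js) :: real ^ 7 ^ 7)))"
    using Cons.IH[of "us @ [axis _ 1]"] Cons.prems by simp
  finally show ?case
    by (simp add: sum_lists_Suc sum_distrib_left mult.assoc)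
qed

text \<open>This is \<open>det (E ** G) = det E * det G\<close>, where the rows of \<open>E\<close> are the basis vectors with indices \<open>is\<close> and the
  left-hand side is expanded by linearity in each row.\<close>

lemma levi_civita_pairing:
  assumes "length is = 7"
  shows "(\<Sum>js | length js = 7. multi_pairing (\<lambda>i j. G $ i $ j) is js * levi_civita js) =
    det G * levi_civita is"
proof -
  let ?E = "vector (map (\<lambda>i. axis i 1) is) :: real ^ 7 ^ 7"
  have "?E ** G = vector (map (\<lambda>i. \<Sum>j\<in>UNIV. G $ i $ j *s axis j 1) is)"
  proof -
    have "(?E ** G) $ k = vector (map (\<lambda>i. \<Sum>j\<in>UNIV. G $ i $ j *s axis j 1) is) $ k" for k
    proof -
      obtain r where "r < 7" "k = row_index r"
        using UNIV_row_index by auto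
      then show ?thesis
        using assms
        by (simp add: vec_eq_iff matrix_matrix_mult_def vector_nth axis_def
          if_distrib[where f="\<lambda>x. x * _"] if_distrib[where f="\<lambda>x. _ * x"] cong: if_cong)
    qed
    then show ?thesis by (simp add: vec_eq_iff)
  qed
  then have "det G * levi_civita is = det (vector (map (\<lambda>i. \<Sum>j\<in>UNIV. G $ i $ j *s axis j 1) is) :: real ^ 7 ^ 7)"
    by (metis det_mul levi_civita_def mult.commute)
  then show ?thesis
    using det_vector_map_sum[of "[]" "is" "\<lambda>i j. G $ i $ j"] assms by (simp add: levi_civita_def)
qed

lemma alternating_levi_civita: "alternating 7 levi_civita"
proof (rule alternatingI)
  fix "is" :: "idx list" and a b :: nat
  assume len: "length is = 7" and ab: "a < b" "b < 7"
  let ?E = "vector (map (\<lambda>i. axis i 1) is) :: real ^ 7 ^ 7"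
  let ?t = "Transposition.transpose (row_index a) (row_index b)"
  have neq: "row_index a \<noteq> row_index b"
    using inj_onD[OF inj_row_index] ab by fastforce
  have "(vector (map (\<lambda>i. axis i 1) (is[a := is ! b, b := is ! a])) :: real ^ 7 ^ 7) = (\<chi> i. ?E $ ?t i)"
    using len ab neq
    by (auto simp: vec_eq_iff map_update vector_update vector_nth Transposition.transpose_def)
  then have "levi_civita (is[a := is ! b, b := is ! a]) = of_int (sign ?t) * levi_civita is"
    unfolding levi_civita_def by (simp only: det_permute_rows[OF permutes_swap_id[OF UNIV_I UNIV_I]])
  then show "levi_civita (is[a := is ! b, b := is ! a]) = - levi_civita is"
    using neq by (simp add: sign_swap_id)
qed

lemma levi_civita_square:
  assumes "length is = 7" "distinct is"
  shows "levi_civita is * levi_civita is = 1"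
proof -
  let ?e = "map row_index [0..<7]"
  have "(vector (map (\<lambda>i. axis i 1) ?e) :: real ^ 7 ^ 7) = mat 1"
  proof -
    have "vector (map (\<lambda>i. axis i 1) ?e) $ k = (mat 1 :: real ^ 7 ^ 7) $ k" for k
    proof -
      obtain r where "r < 7" "k = row_index r"
        using UNIV_row_index by auto
      then show ?thesis
        by (auto simp: vector_nth mat_def axis_def vec_eq_iff)
    qed
    then show ?thesis by (simp add: vec_eq_iff)
  qed
  then have 1: "levi_civita ?e = 1"
    by (simp add: levi_civita_def)
  have "card (set is) = CARD(idx)"
    using assms by (simp add: distinct_card)
  then have "set is = UNIV"
    by (metis card_subset_eq finite_class.finite_UNIV subset_UNIV)
  moreover have "set ?e = UNIV" "distinct ?e"
    using UNIV_row_index inj_row_index by (auto simp: distinct_map atLeast_upt)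
  ultimately have "mset is = mset ?e"
    using assms set_eq_iff_mset_eq_distinct by metis
  then show ?thesis
    using alternating_mult_permute[OF alternating_levi_civita alternating_levi_civita, of ?e "is"] 1
    by simp
qed

text \<open>An endomorphism acts on top-degree forms by its trace.\<close>

lemma index_action_levi_civita:
  assumes "length is = 7"
  shows "index_action N levi_civita is = (\<Sum>l\<in>UNIV. N l l) * levi_civita is"
proof -
  let ?E = "vector (map (\<lambda>i. axis i 1) is) :: real ^ 7 ^ 7"
  let ?N = "\<chi> i l. N l i"
  have row: "(\<Sum>l\<in>UNIV. N l (is ! r) * levi_civita (is[r := l])) =
      det (\<chi> k. if k = row_index r then (?E ** ?N) $ row_index r else ?E $ k)" if "r < 7" for r
  proof -
    have "(?E ** ?N) $ row_index r = (\<Sum>l\<in>UNIV. N l (is ! r) *s axis l 1)"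
      using that assms
      by (simp add: vec_eq_iff matrix_matrix_mult_def vector_nth axis_def
          if_distrib[where f="\<lambda>x. x * _"] if_distrib[where f="\<lambda>x. _ * x"] cong: if_cong)
    then show ?thesis
      using that assms det_vector_update_sum[of "map (\<lambda>i. axis i 1) is" r UNIV "\<lambda>l. N l (is ! r)" "\<lambda>l. axis l 1"]
      by (simp add: levi_civita_def map_update vector_update cong: if_cong)
  qed
  have "index_action N levi_civita is = det_derivative ?E (?E ** ?N)"
    unfolding index_action_def det_derivative_def
    using assms row by (simp add: sum.reindex_bij_betw[OF bij_row_index, symmetric])
  then show ?thesis
    by (simp add: det_derivative_right_mult trace_def levi_civita_def)
qed

lemma levi_civita_rotate: "levi_civita [b, c, d, e, f, g, a] = levi_civita [a, b, c, d, e, f, g]"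
proof -
  note swap = alternating_swap[OF alternating_levi_civita]
  have "levi_civita [a, b, c, d, e, f, g] = - levi_civita [b, a, c, d, e, f, g]"
    using swap[of "[b, a, c, d, e, f, g]" 0 1] by simp
  also have "\<dots> = levi_civita [b, c, a, d, e, f, g]"
    using swap[of "[b, c, a, d, e, f, g]" 1 2] by (simp add: numeral_eq_Suc)
  also have "\<dots> = - levi_civita [b, c, d, a, e, f, g]"
    using swap[of "[b, c, d, a, e, f, g]" 2 3] by (simp add: numeral_eq_Suc)
  also have "\<dots> = levi_civita [b, c, d, e, a, f, g]"
    using swap[of "[b, c, d, e, a, f, g]" 3 4] by (simp add: numeral_eq_Suc)
  also have "\<dots> = - levi_civita [b, c, d, e, f, a, g]"
    using swap[of "[b, c, d, e, f, a, g]" 4 5] by (simp add: numeral_eq_Suc)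
  also have "\<dots> = levi_civita [b, c, d, e, f, g, a]"
    using swap[of "[b, c, d, e, f, g, a]" 5 6] by (simp add: numeral_eq_Suc)
  finally show ?thesis by simp
qed

text \<open>A rotation of seven indices by one place is an even permutation, and three of them exchange the
  blocks.\<close>

lemma levi_civita_swap_blocks:
  assumes "length is = 3" "length js = 4"
  shows "levi_civita (is @ js) = levi_civita (js @ is)"
proof -
  obtain a b c where "is = [a, b, c]"
    using assms(1) by (auto simp: numeral_eq_Suc length_Suc_conv)
  moreover obtain d e f g where "js = [d, e, f, g]"
    using assms(2) by (auto simp: numeral_eq_Suc length_Suc_conv)
  ultimately show ?thesis
    using levi_civita_rotate[of b c d e f g a] levi_civita_rotate[of c d e f g a b]
      levi_civita_rotate[of d e f g a b c] by simp
qed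

section \<open>The Hodge star\<close>

lemma alternating_append_right:
  assumes "alternating (m + k) \<alpha>" "length js = k"
  shows "alternating m (\<lambda>is. \<alpha> (is @ js))"
proof (rule alternatingI)
  fix "is" :: "idx list" and a b assume *: "length is = m" "a < b" "b < m"
  then have "(is[a := is ! b, b := is ! a]) @ js =
      (is @ js)[a := (is @ js) ! b, b := (is @ js) ! a]"
    by (simp add: list_update_append1 nth_append)
  then show "\<alpha> (is[a := is ! b, b := is ! a] @ js) = - \<alpha> (is @ js)"
    using alternating_swap[OF assms(1), of "is @ js" a b] * assms(2) by simp
qed

text \<open>This is the relation \<open>** = 1\<close> for the flat metric.  For distinct \<open>js\<close>, only the \<open>k!\<close> enumerations \<open>ks\<close> of the
  complement contribute, and for each of them only the \<open>m!\<close> rearrangements \<open>is\<close> of \<open>js\<close>.  Since \<open>\<alpha>\<close> and the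
  Levi-Civita symbol change by the same sign, every term equals \<open>\<alpha> js\<close>.\<close>

lemma levi_civita_contraction:
  assumes alt: "alternating m \<alpha>" and mk: "m + k = 7" and js: "length js = m"
  shows "(\<Sum>ks | length ks = k. \<Sum>is | length is = m.
      \<alpha> is * levi_civita (is @ ks) * levi_civita (js @ ks)) = fact k * fact m * \<alpha> js"
proof (cases "distinct js")
  case False
  then have "levi_civita (js @ ks) = 0" if "length ks = k" for ks
    using alternating_not_distinct[OF alternating_levi_civita] that mk js by simp
  then show ?thesis
    using alternating_not_distinct[OF alt js False] by simp
next
  case True
  let ?C = "permutations_of_set (UNIV - set js)"
  have k: "7 - m = k" and m: "7 - k = m"
    using mk by simp_all
  have card_js: "card (set js) = m"
    using True js by (simp add: distinct_card)
  have card_C: "card ?C = fact k"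
    using card_js k by (simp add: card_Diff_subset)
  have inner: "(\<Sum>is | length is = m. \<alpha> is * levi_civita (is @ ks) * levi_civita (js @ ks)) =
      (if ks \<in> ?C then fact m * \<alpha> js else 0)" if ks: "length ks = k" for ks
  proof (cases "ks \<in> ?C")
    case False
    have "\<not> distinct (js @ ks)"
    proof
      assume d: "distinct (js @ ks)"
      then have "card (set ks) = card (UNIV - set js)"
        using ks k card_js by (simp add: distinct_card card_Diff_subset)
      moreover have "set ks \<subseteq> UNIV - set js"
        using d by auto
      ultimately have "set ks = UNIV - set js"
        by (intro card_subset_eq) auto
      with d False show False
        by (auto simp: permutations_of_set_def)
    qed
    then have "levi_civita (js @ ks) = 0"
      using alternating_not_distinct[OF alternating_levi_civita] ks mk js by simp
    with False show ?thesis by simp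
  next
    case ksC: True
    then have ksD: "set ks = UNIV - set js" "distinct ks"
      by (auto simp: permutations_of_set_def)
    have alt': "alternating m (\<lambda>is. levi_civita (is @ ks))"
      using alternating_append_right[of m k levi_civita] alternating_levi_civita mk ks by simp
    have "(\<Sum>is | length is = m. \<alpha> is * levi_civita (is @ ks) * levi_civita (js @ ks)) =
        (\<Sum>is\<in>permutations_of_set (set js). \<alpha> is * levi_civita (is @ ks) * levi_civita (js @ ks))"
    proof (rule sum.mono_neutral_right)
      show "finite {is :: idx list. length is = m}"
        by (rule finite_lists_length)
      show "permutations_of_set (set js) \<subseteq> {is. length is = m}"
        using card_js by (auto simp: permutations_of_set_def simp flip: distinct_card)
      show "\<forall>is\<in>{is. length is = m} - permutations_of_set (set js).
          \<alpha> is * levi_civita (is @ ks) * levi_civita (js @ ks) = 0"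
      proof
        fix "is" assume is_in: "is \<in> {is. length is = m} - permutations_of_set (set js)"
        have "\<not> distinct (is @ ks)"
        proof
          assume d: "distinct (is @ ks)"
          then have "set is \<subseteq> set js"
            using ksD by auto
          moreover have "card (set is) = card (set js)"
            using d is_in card_js by (simp add: distinct_card)
          ultimately have "set is = set js"
            by (intro card_subset_eq) auto
          with d is_in show False
            by (auto simp: permutations_of_set_def)
        qed
        then have "levi_civita (is @ ks) = 0"
          using alternating_not_distinct[OF alternating_levi_civita] ks mk is_in by simp
        then show "\<alpha> is * levi_civita (is @ ks) * levi_civita (js @ ks) = 0"
          by simp
      qed
    qed
    also have "\<dots> = (\<Sum>is\<in>permutations_of_set (set js). \<alpha> js)"
    proof (rule sum.cong)
      fix "is" assume "is \<in> permutations_of_set (set js)"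
      then have "mset is = mset js"
        by (metis True permutations_of_setD set_eq_iff_mset_eq_distinct)
      then have "\<alpha> is * levi_civita (is @ ks) = \<alpha> js * levi_civita (js @ ks)"
        by (rule alternating_mult_permute[OF alt alt' js])
      moreover have "levi_civita (js @ ks) * levi_civita (js @ ks) = 1"
        using ksD True js ks mk by (intro levi_civita_square) auto
      ultimately show "\<alpha> is * levi_civita (is @ ks) * levi_civita (js @ ks) = \<alpha> js"
        by (simp add: mult.assoc)
    qed simp
    finally show ?thesis
      using ksC card_js by simp
  qed
  have sub: "?C \<subseteq> {ks. length ks = k}"
  proof
    fix ks assume "ks \<in> ?C"
    then have "length ks = card (UNIV - set js)"
      by (metis distinct_card permutations_of_setD)
    then show "ks \<in> {ks. length ks = k}"
      using card_js k by (simp add: card_Diff_subset)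
  qed
  have "(\<Sum>ks | length ks = k. \<Sum>is | length is = m.
      \<alpha> is * levi_civita (is @ ks) * levi_civita (js @ ks)) =
      (\<Sum>ks | length ks = k. if ks \<in> ?C then fact m * \<alpha> js else 0)"
    by (rule sum.cong) (auto simp: inner)
  also have "\<dots> = (\<Sum>ks\<in>?C. fact m * \<alpha> js)"
    using sub by (subst sum.inter_restrict[symmetric]) (auto simp: finite_lists_length Int_absorb1 Int_absorb2)
  finally show ?thesis
    by (simp add: card_C mult.assoc del: card_permutations_of_set)
qed

text \<open>The 4-form \<open>\<phi> \<and> \<theta>\<close> in the normalisation of \<^const>\<open>wedge\<close>; it equals \<open>- \<theta> \<and> \<phi>\<close>.\<close>

definition wedge_covector :: "tensor \<Rightarrow> (idx \<Rightarrow> real) \<Rightarrow> tensor" where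
  "wedge_covector \<phi> \<theta> is =
     \<phi> [is ! 0, is ! 1, is ! 2] * \<theta> (is ! 3) - \<phi> [is ! 0, is ! 1, is ! 3] * \<theta> (is ! 2)
     + \<phi> [is ! 0, is ! 2, is ! 3] * \<theta> (is ! 1) - \<phi> [is ! 1, is ! 2, is ! 3] * \<theta> (is ! 0)"

lemma wedge_covector_list:
  "wedge_covector \<phi> \<theta> [i, j, k, l] =
     \<phi> [i, j, k] * \<theta> l - \<phi> [i, j, l] * \<theta> k + \<phi> [i, k, l] * \<theta> j - \<phi> [j, k, l] * \<theta> i"
  by (simp add: wedge_covector_def numeral_eq_Suc)

lemma alternating_3:
  assumes "alternating 3 \<phi>"
  shows "\<phi> [y, x, z] = - \<phi> [x, y, z]" "\<phi> [x, z, y] = - \<phi> [x, y, z]" "\<phi> [z, y, x] = - \<phi> [x, y, z]"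
    "\<phi> [y, z, x] = \<phi> [x, y, z]" "\<phi> [z, x, y] = \<phi> [x, y, z]"
proof -
  have 1: "\<phi> [y, x, z] = - \<phi> [x, y, z]" for x y z
    using alternating_swap[OF assms, of "[x, y, z]" 0 1] by simp
  have 2: "\<phi> [x, z, y] = - \<phi> [x, y, z]" for x y z
    using alternating_swap[OF assms, of "[x, y, z]" 1 2] by (simp add: numeral_eq_Suc)
  show "\<phi> [y, x, z] = - \<phi> [x, y, z]" "\<phi> [x, z, y] = - \<phi> [x, y, z]"
    by (fact 1, fact 2)
  show "\<phi> [z, y, x] = - \<phi> [x, y, z]" "\<phi> [y, z, x] = \<phi> [x, y, z]" "\<phi> [z, x, y] = \<phi> [x, y, z]"
    using 1[of y z x] 2[of y x z] 1[of x y z] 1[of x z y] 2[of x y z] by linarith+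
qed

lemma alternating_wedge_covector:
  assumes "alternating 3 \<phi>"
  shows "alternating 4 (wedge_covector \<phi> \<theta>)"
proof (rule alternatingI)
  fix "is" :: "idx list" and a b :: nat
  assume len: "length is = 4" and ab: "a < b" "b < 4"
  obtain p q r s where pqrs: "is = [p, q, r, s]"
    using len by (auto simp: numeral_eq_Suc length_Suc_conv)
  note simps = wedge_covector_list
    alternating_3[OF assms, where x=p and y=q and z=r] alternating_3[OF assms, where x=p and y=q and z=s]
    alternating_3[OF assms, where x=p and y=r and z=s] alternating_3[OF assms, where x=q and y=r and z=s]
  have "wedge_covector \<phi> \<theta> [q, p, r, s] = - wedge_covector \<phi> \<theta> [p, q, r, s]"
    "wedge_covector \<phi> \<theta> [r, q, p, s] = - wedge_covector \<phi> \<theta> [p, q, r, s]"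
    "wedge_covector \<phi> \<theta> [s, q, r, p] = - wedge_covector \<phi> \<theta> [p, q, r, s]"
    "wedge_covector \<phi> \<theta> [p, r, q, s] = - wedge_covector \<phi> \<theta> [p, q, r, s]"
    "wedge_covector \<phi> \<theta> [p, s, r, q] = - wedge_covector \<phi> \<theta> [p, q, r, s]"
    "wedge_covector \<phi> \<theta> [p, q, s, r] = - wedge_covector \<phi> \<theta> [p, q, r, s]"
    unfolding simps by (simp_all add: algebra_simps)
  moreover have "(a = 0 \<and> b = 1) \<or> (a = 0 \<and> b = 2) \<or> (a = 0 \<and> b = 3) \<or>
      (a = 1 \<and> b = 2) \<or> (a = 1 \<and> b = 3) \<or> (a = 2 \<and> b = 3)"
    using ab by linarith
  ultimately show "wedge_covector \<phi> \<theta> (is[a := is ! b, b := is ! a]) = - wedge_covector \<phi> \<theta> is"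
    unfolding pqrs by (elim disjE conjE) (simp_all add: numeral_eq_Suc)
qed

lemma alternating_4:
  assumes "alternating 4 \<epsilon>"
  shows "\<epsilon> [a, b, d, c] = - \<epsilon> [a, b, c, d]" "\<epsilon> [a, d, b, c] = \<epsilon> [a, b, c, d]" "\<epsilon> [d, a, b, c] = - \<epsilon> [a, b, c, d]"
proof -
  have 1: "\<epsilon> [a, b, d, c] = - \<epsilon> [a, b, c, d]"
    using alternating_swap[OF assms, of "[a, b, c, d]" 2 3] by (simp add: numeral_eq_Suc)
  have 2: "\<epsilon> [a, d, b, c] = - \<epsilon> [a, b, d, c]"
    using alternating_swap[OF assms, of "[a, b, d, c]" 1 2] by (simp add: numeral_eq_Suc)
  have 3: "\<epsilon> [d, a, b, c] = - \<epsilon> [a, d, b, c]"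
    using alternating_swap[OF assms, of "[a, d, b, c]" 0 1] by (simp add: numeral_eq_Suc)
  show "\<epsilon> [a, b, d, c] = - \<epsilon> [a, b, c, d]" "\<epsilon> [a, d, b, c] = \<epsilon> [a, b, c, d]" "\<epsilon> [d, a, b, c] = - \<epsilon> [a, b, c, d]"
    using 1 2 3 by linarith+
qed

text \<open>After renaming the summation indices, the four terms of \<open>\<phi> \<and> \<theta>\<close> differ by a cyclic permutation of the
  last indices whose sign is absorbed by \<open>\<epsilon>\<close>.\<close>

lemma wedge_covector_contraction:
  assumes "alternating 4 \<epsilon>"
  shows "(\<Sum>is | length is = 4. wedge_covector \<phi> \<theta> is * \<epsilon> is) =
    4 * (\<Sum>ds | length ds = 3. \<Sum>p\<in>UNIV. \<phi> ds * \<theta> p * \<epsilon> (ds @ [p]))"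
proof -
  let ?f = "\<lambda>a b c d. \<phi> [a, b, c] * \<theta> d * \<epsilon> [a, b, c, d]"
  let ?S = "\<Sum>a\<in>UNIV. \<Sum>b\<in>UNIV. \<Sum>c\<in>UNIV. \<Sum>d\<in>UNIV. ?f a b c d"
  have 1: "(\<Sum>a\<in>UNIV. \<Sum>b\<in>UNIV. \<Sum>c\<in>UNIV. \<Sum>d\<in>UNIV. \<phi> [a, b, d] * \<theta> c * \<epsilon> [a, b, c, d]) = - ?S"
  proof -
    have "(\<Sum>c\<in>UNIV. \<Sum>d\<in>UNIV. \<phi> [a, b, d] * \<theta> c * \<epsilon> [a, b, c, d]) =
        (\<Sum>c\<in>UNIV. \<Sum>d\<in>UNIV. \<phi> [a, b, c] * \<theta> d * \<epsilon> [a, b, d, c])" for a b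
      by (rule sum.swap)
    also have "\<dots> a b = (\<Sum>c\<in>UNIV. \<Sum>d\<in>UNIV. - ?f a b c d)" for a b
      unfolding mult_minus_right[symmetric]
      by (intro sum.cong refl arg_cong2[where f="(*)"] alternating_4(1)[OF assms])
    finally show ?thesis by (simp add: sum_negf)
  qed
  have 2: "(\<Sum>a\<in>UNIV. \<Sum>b\<in>UNIV. \<Sum>c\<in>UNIV. \<Sum>d\<in>UNIV. \<phi> [a, c, d] * \<theta> b * \<epsilon> [a, b, c, d]) = ?S"
  proof -
    have "(\<Sum>b\<in>UNIV. \<Sum>c\<in>UNIV. \<Sum>d\<in>UNIV. \<phi> [a, c, d] * \<theta> b * \<epsilon> [a, b, c, d]) =
        (\<Sum>c\<in>UNIV. \<Sum>d\<in>UNIV. \<Sum>b\<in>UNIV. \<phi> [a, c, d] * \<theta> b * \<epsilon> [a, b, c, d])" for a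
      by (subst sum.swap) (intro sum.cong refl sum.swap)
    also have "\<dots> a = (\<Sum>b\<in>UNIV. \<Sum>c\<in>UNIV. \<Sum>d\<in>UNIV. ?f a b c d)" for a
      by (intro sum.cong refl arg_cong2[where f="(*)"] alternating_4(2)[OF assms])
    finally show ?thesis by simp
  qed
  have 3: "(\<Sum>a\<in>UNIV. \<Sum>b\<in>UNIV. \<Sum>c\<in>UNIV. \<Sum>d\<in>UNIV. \<phi> [b, c, d] * \<theta> a * \<epsilon> [a, b, c, d]) = - ?S"
  proof -
    have "(\<Sum>a\<in>UNIV. \<Sum>b\<in>UNIV. \<Sum>c\<in>UNIV. \<Sum>d\<in>UNIV. \<phi> [b, c, d] * \<theta> a * \<epsilon> [a, b, c, d]) =
        (\<Sum>b\<in>UNIV. \<Sum>a\<in>UNIV. \<Sum>c\<in>UNIV. \<Sum>d\<in>UNIV. \<phi> [b, c, d] * \<theta> a * \<epsilon> [a, b, c, d])"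
      by (rule sum.swap)
    also have "\<dots> = (\<Sum>b\<in>UNIV. \<Sum>c\<in>UNIV. \<Sum>a\<in>UNIV. \<Sum>d\<in>UNIV. \<phi> [b, c, d] * \<theta> a * \<epsilon> [a, b, c, d])"
      by (intro sum.cong refl sum.swap)
    also have "\<dots> = (\<Sum>b\<in>UNIV. \<Sum>c\<in>UNIV. \<Sum>d\<in>UNIV. \<Sum>a\<in>UNIV. \<phi> [b, c, d] * \<theta> a * \<epsilon> [a, b, c, d])"
      by (intro sum.cong refl sum.swap)
    also have "\<dots> = (\<Sum>a\<in>UNIV. \<Sum>b\<in>UNIV. \<Sum>c\<in>UNIV. \<Sum>d\<in>UNIV. - ?f a b c d)"
      unfolding mult_minus_right[symmetric]
      by (intro sum.cong refl arg_cong2[where f="(*)"] alternating_4(3)[OF assms])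
    finally show ?thesis by (simp add: sum_negf)
  qed
  have "(\<Sum>is | length is = 4. wedge_covector \<phi> \<theta> is * \<epsilon> is) =
      (\<Sum>a\<in>UNIV. \<Sum>b\<in>UNIV. \<Sum>c\<in>UNIV. \<Sum>d\<in>UNIV. wedge_covector \<phi> \<theta> [a, b, c, d] * \<epsilon> [a, b, c, d])"
    by (simp add: numeral_eq_Suc sum_lists_Suc)
  also have "\<dots> = 4 * ?S"
    using 1 2 3 by (simp add: wedge_covector_list left_diff_distrib distrib_right sum.distrib sum_subtractf)
  finally show ?thesis
    by (simp add: numeral_eq_Suc sum_lists_Suc)
qed

lemma hodge_eq:
  "hodge k h \<alpha> js = sqrt (det (metric_matrix h)) / fact k *
    (\<Sum>is | length is = k. \<Sum>as | length as = k.
      multi_pairing (inv_metric h) is as * \<alpha> as * levi_civita (is @ js))"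
proof -
  have "hodge k h \<alpha> js = (\<Sum>is | length is = k. \<Sum>as | length as = k.
      multi_pairing (inv_metric h) is as * \<alpha> as * (sqrt (det (metric_matrix h)) * levi_civita (is @ js))) / fact k"
    unfolding hodge_def volume_form_levi_civita multi_pairing_def
    by (intro arg_cong2[where f="(/)"] sum.cong refl) auto
  then show ?thesis
    by (simp add: sum_distrib_left sum_divide_distrib mult_ac)
qed

lemma sum_reverse_nested:
  fixes f :: "'a \<Rightarrow> 'b \<Rightarrow> 'c \<Rightarrow> 'd \<Rightarrow> 'e \<Rightarrow> 'f::comm_monoid_add"
  shows "(\<Sum>a\<in>A. \<Sum>b\<in>B. \<Sum>c\<in>C. \<Sum>d\<in>D. \<Sum>e\<in>E. f a b c d e) =
    (\<Sum>e\<in>E. \<Sum>b\<in>B. \<Sum>d\<in>D. \<Sum>c\<in>C. \<Sum>a\<in>A. f a b c d e)"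
  unfolding sum.cartesian_product
  by (rule sum.reindex_bij_witness[where i="\<lambda>(e, b, d, c, a). (a, b, c, d, e)"
      and j="\<lambda>(a, b, c, d, e). (e, b, d, c, a)"]) auto

text \<open>The 3-form \<open>\<sigma> = \<theta> \<lrcorner> *\<phi>\<close> is \<open>*(\<phi> \<and> \<theta>)\<close>, so the claim amounts to \<open>** = 1\<close> on 4-forms in dimension \<open>7\<close>.
  The metric disappears from the computation: by \<open>levi_civita_pairing\<close> the seven inverse metrics that
  contract one of the two Levi-Civita symbols produce \<open>det g\<^sup>-\<^sup>1\<close>, which cancels the square of the
  factor \<open>sqrt (det g)\<close> of the volume form.\<close>

lemma hodge_interior_product_hodge:
  fixes h :: tensor and \<phi> :: tensor and \<theta> :: "idx \<Rightarrow> real"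
  defines "\<psi> \<equiv> hodge 3 h \<phi>"
  defines "\<sigma> \<equiv> \<lambda>is. \<Sum>p\<in>UNIV. \<Sum>q\<in>UNIV. \<theta> p * inv_metric h p q * \<psi> (q # is)"
  assumes pos: "det (metric_matrix h) > 0"
    and inv: "metric_matrix h ** matrix_inv (metric_matrix h) = mat 1"
    and sym: "\<And>i j. inv_metric h i j = inv_metric h j i"
    and alt: "alternating 3 \<phi>" and js: "length js = 4"
  shows "hodge 3 h \<sigma> js = wedge_covector \<phi> \<theta> js"
proof -
  let ?G = "inv_metric h" and ?d = "det (matrix_inv (metric_matrix h))"
  define w where "w = sqrt (det (metric_matrix h))"
  have wd: "w * w * ?d = 1"
    using inv pos det_mul[of "metric_matrix h" "matrix_inv (metric_matrix h)"] by (simp add: w_def)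
  \<comment> \<open>Both sides are the contraction of a Levi-Civita symbol with seven inverse metrics.\<close>
  have pairing: "(\<Sum>es | length es = 3. \<Sum>q\<in>UNIV. \<Sum>bs | length bs = 3.
      multi_pairing ?G es ds * ?G p q * multi_pairing ?G as bs * levi_civita (es @ q # bs)) =
      ?d * levi_civita (ds @ p # as)" if "length ds = 3" "length as = 3" for ds as p
  proof -
    have G: "?G = (\<lambda>i j. matrix_inv (metric_matrix h) $ i $ j)"
      by (simp add: inv_metric_def fun_eq_iff)
    have "?d * levi_civita (ds @ p # as) =
        (\<Sum>es | length es = 3 + Suc 3. multi_pairing ?G (ds @ p # as) es * levi_civita es)"
      using levi_civita_pairing[of "ds @ p # as" "matrix_inv (metric_matrix h)"] that unfolding G by simp
    also have "\<dots> = (\<Sum>es | length es = 3. \<Sum>q\<in>UNIV. \<Sum>bs | length bs = 3.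
        multi_pairing ?G (ds @ p # as) (es @ q # bs) * levi_civita (es @ q # bs))"
      unfolding sum_lists_append sum_lists_Suc ..
    also have "\<dots> = (\<Sum>es | length es = 3. \<Sum>q\<in>UNIV. \<Sum>bs | length bs = 3.
      multi_pairing ?G es ds * ?G p q * multi_pairing ?G as bs * levi_civita (es @ q # bs))"
      using that
      by (intro sum.cong refl) (simp add: multi_pairing_append multi_pairing_commute[OF sym, of ds])
    finally show ?thesis by simp
  qed
  have "hodge 3 h \<sigma> js = w * w / 36 * (\<Sum>as | length as = 3. \<Sum>bs | length bs = 3. \<Sum>p\<in>UNIV. \<Sum>q\<in>UNIV.
      \<Sum>es | length es = 3. \<Sum>ds | length ds = 3. \<phi> ds * \<theta> p * levi_civita (as @ js) *
       (multi_pairing ?G es ds * ?G p q * multi_pairing ?G as bs * levi_civita (es @ q # bs)))"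
  proof -
    have *: "multi_pairing ?G as bs * \<sigma> bs * levi_civita (as @ js) =
        w / 6 * (\<Sum>p\<in>UNIV. \<Sum>q\<in>UNIV. \<Sum>es | length es = 3. \<Sum>ds | length ds = 3.
          \<phi> ds * \<theta> p * levi_civita (as @ js) *
          (multi_pairing ?G es ds * ?G p q * multi_pairing ?G as bs * levi_civita (es @ q # bs)))" for as bs
      unfolding \<sigma>_def \<psi>_def hodge_eq[of 3] w_def[symmetric] sum_distrib_left sum_distrib_right
      by (intro sum.cong refl) (simp add: fact_numeral)
    show ?thesis
      unfolding hodge_eq[of 3 h \<sigma>] w_def[symmetric] * sum_distrib_left[symmetric]
      by (simp add: fact_numeral)
  qed
  also have "\<dots> = w * w / 36 * (\<Sum>as | length as = 3. \<Sum>ds | length ds = 3. \<Sum>p\<in>UNIV.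
      \<Sum>es | length es = 3. \<Sum>q\<in>UNIV. \<Sum>bs | length bs = 3. \<phi> ds * \<theta> p * levi_civita (as @ js) *
       (multi_pairing ?G es ds * ?G p q * multi_pairing ?G as bs * levi_civita (es @ q # bs)))"
    by (subst sum_reverse_nested) (rule refl)
  also have "\<dots> = w * w / 36 * (\<Sum>as | length as = 3. \<Sum>ds | length ds = 3. \<Sum>p\<in>UNIV.
      \<phi> ds * \<theta> p * levi_civita (as @ js) * (?d * levi_civita (ds @ p # as)))"
    unfolding sum_distrib_left[symmetric]
    by (intro arg_cong[where f="\<lambda>x. w * w / 36 * x"] sum.cong refl arg_cong[where f="\<lambda>x. _ * x"] pairing) auto
  also have "\<dots> = 1 / 36 * (\<Sum>as | length as = 3. levi_civita (js @ as) * (\<Sum>ds | length ds = 3. \<Sum>p\<in>UNIV.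
      \<phi> ds * \<theta> p * levi_civita ((ds @ [p]) @ as)))"
  proof -
    have "(\<Sum>as | length as = 3. \<Sum>ds | length ds = 3. \<Sum>p\<in>UNIV.
        \<phi> ds * \<theta> p * levi_civita (as @ js) * (?d * levi_civita (ds @ p # as))) =
        ?d * (\<Sum>as | length as = 3. levi_civita (js @ as) * (\<Sum>ds | length ds = 3. \<Sum>p\<in>UNIV.
      \<phi> ds * \<theta> p * levi_civita ((ds @ [p]) @ as)))"
      unfolding sum_distrib_left
      by (intro sum.cong refl) (use js in \<open>simp add: levi_civita_swap_blocks[of _ js]\<close>)
    then show ?thesis using wd by (simp add: mult.assoc[symmetric])
  qed
  also have "\<dots> = 1 / 144 * (\<Sum>as | length as = 3. \<Sum>is | length is = 4.
      wedge_covector \<phi> \<theta> is * levi_civita (is @ as) * levi_civita (js @ as))"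
  proof -
    have "(\<Sum>is | length is = 4. wedge_covector \<phi> \<theta> is * levi_civita (is @ as)) =
      4 * (\<Sum>ds | length ds = 3. \<Sum>p\<in>UNIV. \<phi> ds * \<theta> p * levi_civita ((ds @ [p]) @ as))"
      if "length as = 3" for as
      using alternating_append_right[of 4 3 levi_civita as] alternating_levi_civita that
      by (intro wedge_covector_contraction) simp
    then have "levi_civita (js @ as) * (\<Sum>ds | length ds = 3. \<Sum>p\<in>UNIV. \<phi> ds * \<theta> p * levi_civita ((ds @ [p]) @ as))
      = 1 / 4 * (\<Sum>is | length is = 4. wedge_covector \<phi> \<theta> is * levi_civita (is @ as) * levi_civita (js @ as))"
      if "length as = 3" for as
      using that by (simp add: sum_distrib_right[symmetric])
    then have "(\<Sum>as | length as = 3. levi_civita (js @ as) *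
        (\<Sum>ds | length ds = 3. \<Sum>p\<in>UNIV. \<phi> ds * \<theta> p * levi_civita ((ds @ [p]) @ as))) =
        (\<Sum>as | length as = 3. 1 / 4 * (\<Sum>is | length is = 4.
          wedge_covector \<phi> \<theta> is * levi_civita (is @ as) * levi_civita (js @ as)))"
      by (intro sum.cong refl) simp
    then show ?thesis
      unfolding sum_distrib_left[symmetric] by simp
  qed
  also have "\<dots> = wedge_covector \<phi> \<theta> js"
    using levi_civita_contraction[OF alternating_wedge_covector[OF alt], where k=3, of js \<theta>] js
    by (simp add: fact_numeral)
  finally show ?thesis .
qed

lemma index_action_sum:
  "index_action N (\<lambda>is. \<Sum>x\<in>X. f x is) is = (\<Sum>x\<in>X. index_action N (f x) is)"
  unfolding index_action_def sum_distrib_left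
  by (subst sum.swap, rule sum.cong, rule refl, subst sum.swap, rule refl)

lemma index_action_cmult: "index_action N (\<lambda>is. c * f is) is = c * index_action N f is"
  by (simp add: index_action_def sum_distrib_left mult_ac)

lemma has_real_derivative_multi_pairing:
  assumes G: "\<And>i j. ((\<lambda>s. G s i j) has_real_derivative
      - (\<Sum>l\<in>UNIV. N i l * G t l j + N j l * G t i l)) (at t)"
    and len: "length js = length is"
  shows "((\<lambda>s. multi_pairing (G s) is js) has_real_derivative
    - index_action (\<lambda>i j. N j i) (\<lambda>is. multi_pairing (G t) is js) is
    - index_action (\<lambda>i j. N j i) (\<lambda>js. multi_pairing (G t) is js) js) (at t)"
proof -
  have "((\<lambda>s. multi_pairing (G s) is js) has_real_derivative
     (\<Sum>r<length is. - (\<Sum>l\<in>UNIV. N (is ! r) l * G t l (js ! r) + N (js ! r) l * G t (is ! r) l) *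
        (\<Prod>r'\<in>{..<length is} - {r}. G t (is ! r') (js ! r')))) (at t)"
    unfolding multi_pairing_def by (intro has_field_derivative_prod G)
  moreover have "(\<Sum>r<length is. - (\<Sum>l\<in>UNIV. N (is ! r) l * G t l (js ! r) + N (js ! r) l * G t (is ! r) l) *
        (\<Prod>r'\<in>{..<length is} - {r}. G t (is ! r') (js ! r'))) =
      - index_action (\<lambda>i j. N j i) (\<lambda>is. multi_pairing (G t) is js) is
      - index_action (\<lambda>i j. N j i) (\<lambda>js. multi_pairing (G t) is js) js"
    unfolding index_action_def len sum_negf[symmetric] sum_subtractf[symmetric]
    by (intro sum.cong refl)
       (simp add: multi_pairing_update multi_pairing_update2 len sum.distrib
        sum_distrib_left right_diff_distrib mult_ac flip: sum_negf)
  ultimately show ?thesis by simp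
qed

text \<open>The Hodge star is parallel: if the inverse metric and the volume form vary by the infinitesimal action
  of \<open>N\<close>, then so does \<open>*\<alpha>\<close>, up to the star of the defect \<open>\<sigma>\<close> of \<open>\<alpha>\<close>.  In the Leibniz rule for the
  contraction of \<open>\<alpha>\<close> with the inverse metrics and the volume form, the action of \<open>N\<close> on the contracted
  indices cancels by \<open>index_action_adjoint\<close>, and only the action on the free indices \<open>js\<close> remains.\<close>

lemma has_real_derivative_hodge:
  assumes G: "\<And>i j. ((\<lambda>s. inv_metric (h s) i j) has_real_derivative
      - (\<Sum>l\<in>UNIV. N i l * inv_metric (h t) l j + N j l * inv_metric (h t) i l)) (at t)"
    and vol: "((\<lambda>s. sqrt (det (metric_matrix (h s)))) has_real_derivative
      (\<Sum>l\<in>UNIV. N l l) * sqrt (det (metric_matrix (h t)))) (at t)"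
    and \<alpha>: "\<And>is. length is = k \<Longrightarrow>
      ((\<lambda>s. \<alpha> s is) has_real_derivative index_action N (\<alpha> t) is + \<sigma> is) (at t)"
    and len: "k + length js = 7"
  shows "((\<lambda>s. hodge k (h s) (\<alpha> s) js) has_real_derivative
    index_action N (hodge k (h t) (\<alpha> t)) js + hodge k (h t) \<sigma> js) (at t)"
proof -
  let ?L = "{is :: idx list. length is = k}"
  let ?A = "index_action (\<lambda>i j. N j i)" and ?B = "index_action N"
  let ?P = "\<lambda>s. multi_pairing (inv_metric (h s))"
  let ?w = "\<lambda>s. sqrt (det (metric_matrix (h s)))"
  define a where "a = \<alpha> t"
  define P where "P = ?P t"
  define E where "E = (\<lambda>is. levi_civita (is @ js))"
  define tr where "tr = (\<Sum>l\<in>UNIV. N l l)"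
  define X where "X = (\<Sum>is\<in>?L. \<Sum>as\<in>?L. P is as * a as * E is)"
  have term_deriv: "((\<lambda>s. ?P s is as * \<alpha> s as * E is) has_real_derivative
     (- ?A (\<lambda>is. P is as) is - ?A (\<lambda>as. P is as) as) * a as * E is +
       P is as * (?B a as + \<sigma> as) * E is) (at t)" if "length is = k" "length as = k" for "is" as
    unfolding P_def a_def using that
    by (auto intro!: derivative_eq_intros \<alpha> has_real_derivative_multi_pairing[where N=N] G simp: algebra_simps)
  have sum_deriv: "((\<lambda>s. \<Sum>is\<in>?L. \<Sum>as\<in>?L. ?P s is as * \<alpha> s as * E is) has_real_derivative
     (\<Sum>is\<in>?L. \<Sum>as\<in>?L. (- ?A (\<lambda>is. P is as) is - ?A (\<lambda>as. P is as) as) * a as * E is +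
       P is as * (?B a as + \<sigma> as) * E is)) (at t)"
    by (intro DERIV_sum term_deriv) auto
  \<comment> \<open>The action on the inverse metric is moved to the other factors, in each of its two slots.\<close>
  have move1: "(\<Sum>is\<in>?L. \<Sum>as\<in>?L. ?A (\<lambda>is. P is as) is * a as * E is) =
      (\<Sum>is\<in>?L. \<Sum>as\<in>?L. P is as * a as * ?B E is)"
  proof -
    have "(\<Sum>as\<in>?L. \<Sum>is\<in>?L. ?A (\<lambda>is. P is as) is * a as * E is) =
        (\<Sum>as\<in>?L. a as * (\<Sum>is\<in>?L. ?A (\<lambda>is. P is as) is * E is))"
      by (simp add: sum_distrib_left mult_ac)
    also have "\<dots> = (\<Sum>as\<in>?L. a as * (\<Sum>is\<in>?L. P is as * ?B E is))"
      by (simp add: index_action_adjoint)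
    finally have "(\<Sum>as\<in>?L. \<Sum>is\<in>?L. ?A (\<lambda>is. P is as) is * a as * E is) =
        (\<Sum>as\<in>?L. \<Sum>is\<in>?L. P is as * a as * ?B E is)"
      by (simp add: sum_distrib_left mult_ac)
    then show ?thesis
      using sum.swap[of "\<lambda>as is. ?A (\<lambda>is. P is as) is * a as * E is" ?L ?L]
        sum.swap[of "\<lambda>as is. P is as * a as * ?B E is" ?L ?L] by simp
  qed
  have move2: "(\<Sum>is\<in>?L. \<Sum>as\<in>?L. ?A (\<lambda>as. P is as) as * a as * E is) =
      (\<Sum>is\<in>?L. \<Sum>as\<in>?L. P is as * ?B a as * E is)"
    by (simp add: sum_distrib_right[symmetric] index_action_adjoint)
  \<comment> \<open>The trace is the action on all indices of the volume form, contracted and free.\<close>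
  have trace_split: "tr * E is = ?B E is + ?B (\<lambda>js. levi_civita (is @ js)) js" if "length is = k" for "is"
    using index_action_levi_civita[of "is @ js" N] that len
    by (simp add: index_action_append E_def tr_def)
  have trace_sum: "tr * X = (\<Sum>is\<in>?L. \<Sum>as\<in>?L. P is as * a as * ?B E is) +
      (\<Sum>is\<in>?L. \<Sum>as\<in>?L. P is as * a as * ?B (\<lambda>js. levi_civita (is @ js)) js)"
    (is "_ = ?X1 + ?X2")
  proof -
    have "tr * X = (\<Sum>is\<in>?L. \<Sum>as\<in>?L. P is as * a as * (tr * E is))"
      by (simp add: X_def sum_distrib_left mult_ac)
    also have "\<dots> = (\<Sum>is\<in>?L. \<Sum>as\<in>?L. P is as * a as * (?B E is + ?B (\<lambda>js. levi_civita (is @ js)) js))"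
      by (intro sum.cong refl) (simp add: trace_split)
    finally show ?thesis by (simp add: distrib_left sum.distrib)
  qed
  define D where "D = (\<Sum>is\<in>?L. \<Sum>as\<in>?L. (- ?A (\<lambda>is. P is as) is - ?A (\<lambda>as. P is as) as) * a as * E is +
       P is as * (?B a as + \<sigma> as) * E is)"
  define X1 where "X1 = ?X1"
  define X2 where "X2 = ?X2"
  define S where "S = (\<Sum>is\<in>?L. \<Sum>as\<in>?L. P is as * \<sigma> as * E is)"
  have D: "D = S - X1"
    using move1 move2 unfolding D_def S_def X1_def by (simp add: algebra_simps sum.distrib sum_subtractf)
  have "((\<lambda>s. ?w s / fact k * (\<Sum>is\<in>?L. \<Sum>as\<in>?L. ?P s is as * \<alpha> s as * E is)) has_real_derivative
      tr * ?w t / fact k * X + D * (?w t / fact k)) (at t)"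
    using DERIV_mult[OF DERIV_cdivide[OF vol, of "fact k"] sum_deriv]
    unfolding D_def X_def P_def a_def tr_def .
  moreover have "tr * ?w t / fact k * X + D * (?w t / fact k) = ?w t / fact k * X2 + ?w t / fact k * S"
  proof -
    have "tr * ?w t / fact k * X = ?w t / fact k * (tr * X)"
      by simp
    also have "\<dots> = ?w t / fact k * X1 + ?w t / fact k * X2"
      unfolding trace_sum X1_def X2_def by (rule distrib_left)
    finally show ?thesis unfolding D by (simp add: algebra_simps diff_divide_distrib)
  qed
  moreover have "?B (hodge k (h t) (\<alpha> t)) js = ?w t / fact k * X2"
    unfolding hodge_eq[abs_def] index_action_cmult index_action_sum a_def P_def X2_def ..
  moreover have "hodge k (h t) \<sigma> js = ?w t / fact k * S"
    by (simp add: hodge_eq P_def E_def S_def)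
  ultimately show ?thesis
    unfolding hodge_eq[of k "h _" "\<alpha> _" js] E_def by simp
qed

section \<open>The Levi-Civita connection in a chart\<close>

lemma differentiable_prod:
  fixes f :: "'i \<Rightarrow> 'a::real_normed_vector \<Rightarrow> real"
  assumes "finite I" "\<And>i. i \<in> I \<Longrightarrow> f i differentiable (at u)"
  shows "(\<lambda>v. \<Prod>i\<in>I. f i v) differentiable (at u)"
  using assms by (induction I rule: finite_induct) auto

lemma differentiable_det:
  fixes M :: "'a::real_normed_vector \<Rightarrow> real ^ 'n::finite ^ 'n"
  assumes "\<And>i j. (\<lambda>v. M v $ i $ j) differentiable (at u)"
  shows "(\<lambda>v. det (M v)) differentiable (at u)"
proof -
  have "(\<lambda>v. \<Prod>i\<in>UNIV. M v $ i $ p i) differentiable (at u)" for p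
    by (rule differentiable_prod) (auto intro: assms)
  then show ?thesis
    unfolding det_def by (intro differentiable_sum differentiable_mult differentiable_const) auto
qed

lemma matrix_inv_det_nonzero:
  fixes A :: "real ^ 'n::finite ^ 'n"
  assumes "det A \<noteq> 0"
  shows "A ** matrix_inv A = mat 1" "matrix_inv A ** A = mat 1"
proof -
  have "\<exists>B. A ** B = mat 1 \<and> B ** A = mat 1"
    using assms by (simp add: invertible_det_nz[symmetric] invertible_def)
  then have "A ** matrix_inv A = mat 1 \<and> matrix_inv A ** A = mat 1"
    unfolding matrix_inv_def by (rule someI_ex)
  then show "A ** matrix_inv A = mat 1" "matrix_inv A ** A = mat 1" by auto
qed

lemma matrix_inv_entry:
  fixes A :: "real ^ 'n::finite ^ 'n"
  assumes "det A \<noteq> 0"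
  shows "matrix_inv A $ k $ l = det (\<chi> i j. if j = k then axis l 1 $ i else A $ i $ j) / det A"
proof -
  have "A *v (matrix_inv A *v axis l 1) = axis l 1"
    using matrix_inv_det_nonzero(1)[OF assms] by (simp add: matrix_vector_mul_assoc)
  then have "matrix_inv A *v axis l 1 = (\<chi> k. det (\<chi> i j. if j = k then axis l 1 $ i else A $ i $ j) / det A)"
    using cramer[OF assms, of "matrix_inv A *v axis l 1" "axis l 1"] by blast
  moreover have "(matrix_inv A *v axis l 1) $ k = matrix_inv A $ k $ l"
    by (simp add: matrix_vector_mult_def axis_def if_distrib[where f="\<lambda>x. _ * x"] cong: if_cong)
  ultimately show ?thesis by simp
qed

lemma differentiable_matrix_inv:
  fixes M :: "'a::real_normed_vector \<Rightarrow> real ^ 'n::finite ^ 'n"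
  assumes M: "\<And>i j. (\<lambda>v. M v $ i $ j) differentiable (at u)"
    and V: "open V" "u \<in> V" "\<And>v. v \<in> V \<Longrightarrow> det (M v) \<noteq> 0"
  shows "(\<lambda>v. matrix_inv (M v) $ k $ l) differentiable (at u)"
proof -
  let ?f = "\<lambda>v. det (\<chi> i j. if j = k then axis l 1 $ i else M v $ i $ j) / det (M v)"
  have "(\<lambda>v. if j = k then axis l 1 $ i else M v $ i $ j) differentiable (at u)" for i j
    using M by (cases "j = k") auto
  then have "?f differentiable (at u)"
    using V by (intro differentiable_divide differentiable_det M) auto
  then obtain f' where "(?f has_derivative f') (at u)"
    by (auto simp: differentiable_def)
  then have "((\<lambda>v. matrix_inv (M v) $ k $ l) has_derivative f') (at u)"
    by (rule has_derivative_transform_within_open[OF _ V(1,2)]) (simp add: matrix_inv_entry V(3))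
  then show ?thesis by (auto simp: differentiable_def)
qed

lemma metric_matrix_nth [simp]: "metric_matrix h $ i $ j = h [i, j]"
  by (simp add: metric_matrix_def)

lemma inner_product_det_nonzero:
  assumes pos: "\<And>X :: coords. X \<noteq> 0 \<Longrightarrow> (\<Sum>i\<in>UNIV. \<Sum>j\<in>UNIV. M $ i $ j * X $ i * X $ j) > 0"
  shows "det (M :: real ^ 7 ^ 7) \<noteq> 0"
proof -
  have "X = 0" if "M *v X = 0" for X
  proof (rule ccontr)
    assume "X \<noteq> 0"
    have "(\<Sum>i\<in>UNIV. \<Sum>j\<in>UNIV. M $ i $ j * X $ i * X $ j) = (\<Sum>i\<in>UNIV. X $ i * (M *v X) $ i)"
      by (simp add: matrix_vector_mult_def sum_distrib_left mult_ac)
    with that pos[OF \<open>X \<noteq> 0\<close>] show False by simp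
  qed
  then have "\<exists>B. B ** M = mat 1"
    using matrix_left_invertible_ker[of M] by blast
  then show ?thesis
    using invertible_left_inverse[of M] invertible_det_nz[of M] by blast
qed

text \<open>The segment from the identity to the Gram matrix consists of positive definite matrices, so the
  determinant has no zero on it.\<close>

lemma inner_product_det_pos:
  assumes "inner_product h"
  shows "det (metric_matrix h) > 0"
proof (rule ccontr)
  let ?M = "metric_matrix h"
  let ?f = "\<lambda>t::real. det (mat 1 + t *\<^sub>R (?M - mat 1))"
  assume "\<not> det ?M > 0"
  then have "?f 1 \<le> 0" by simp
  moreover have "?f 0 = 1" by simp
  moreover have "continuous_on {0..1} ?f"
  proof (rule continuous_at_imp_continuous_on, rule ballI)
    fix t
    have "((\<lambda>t. det (mat 1 + t *\<^sub>R (?M - mat 1))) has_real_derivative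
        det_derivative (mat 1 + t *\<^sub>R (?M - mat 1)) (?M - mat 1)) (at t)"
      by (rule has_real_derivative_det) (auto intro!: derivative_eq_intros simp: algebra_simps)
    then show "isCont ?f t" by (rule DERIV_isCont)
  qed
  ultimately obtain t where t: "0 \<le> t" "t \<le> 1" "?f t = 0"
    using IVT2'[of ?f 1 0 0] by auto
  have "?f t \<noteq> 0"
  proof (rule inner_product_det_nonzero)
    fix X :: coords assume "X \<noteq> 0"
    let ?q = "\<lambda>M. \<Sum>i\<in>UNIV. \<Sum>j\<in>UNIV. (M :: real ^ 7 ^ 7) $ i $ j * X $ i * X $ j"
    have "?q ?M > 0"
      using assms \<open>X \<noteq> 0\<close> by (simp add: inner_product_def)
    have "?q (mat 1) = X \<bullet> X"
      by (simp add: mat_def inner_vec_def if_distrib[where f="\<lambda>x. x * _"] cong: if_cong)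
    then have "?q (mat 1) > 0"
      using \<open>X \<noteq> 0\<close> by simp
    have "?q (mat 1 + t *\<^sub>R (?M - mat 1)) = (1 - t) * ?q (mat 1) + t * ?q ?M"
      by (simp add: algebra_simps sum.distrib sum_subtractf sum_distrib_left)
    also have "\<dots> > 0"
      using t \<open>?q ?M > 0\<close> \<open>?q (mat 1) > 0\<close>
      by (cases "t = 0") (auto intro: add_nonneg_pos)
    finally show "?q (mat 1 + t *\<^sub>R (?M - mat 1)) > 0" .
  qed
  with t(3) show False by simp
qed

text \<open>The image \<open>V\<close> of a chart, with the components \<open>g\<close> of a Riemannian metric.\<close>

locale chart_metric =
  fixes V :: "coords set" and g :: local_field
  assumes open_V: "open V"
    and smooth_g: "\<And>i j. smooth_on V (\<lambda>v. g v [i, j])"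
    and inner_g: "\<And>v. v \<in> V \<Longrightarrow> inner_product (g v)"
begin

lemma g_sym: "v \<in> V \<Longrightarrow> g v [i, j] = g v [j, i]"
  using inner_g by (auto simp: inner_product_def)

lemma det_pos: "v \<in> V \<Longrightarrow> det (metric_matrix (g v)) > 0"
  using inner_g inner_product_det_pos by blast

lemma matrix_inv_g:
  assumes "v \<in> V"
  shows "metric_matrix (g v) ** matrix_inv (metric_matrix (g v)) = mat 1"
    "matrix_inv (metric_matrix (g v)) ** metric_matrix (g v) = mat 1"
  using matrix_inv_det_nonzero[of "metric_matrix (g v)"] det_pos[OF assms] by auto

lemma inv_metric_right:
  assumes "v \<in> V"
  shows "(\<Sum>l\<in>UNIV. g v [i, l] * inv_metric (g v) l j) = (if i = j then 1 else 0)"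
proof -
  have "(metric_matrix (g v) ** matrix_inv (metric_matrix (g v))) $ i $ j = (mat 1 :: real ^ 7 ^ 7) $ i $ j"
    using matrix_inv_g[OF assms] by simp
  then show ?thesis
    by (simp add: matrix_matrix_mult_def inv_metric_def mat_def)
qed

lemma inv_metric_left:
  assumes "v \<in> V"
  shows "(\<Sum>l\<in>UNIV. inv_metric (g v) i l * g v [l, j]) = (if i = j then 1 else 0)"
proof -
  have "(matrix_inv (metric_matrix (g v)) ** metric_matrix (g v)) $ i $ j = (mat 1 :: real ^ 7 ^ 7) $ i $ j"
    using matrix_inv_g[OF assms] by simp
  then show ?thesis
    by (simp add: matrix_matrix_mult_def inv_metric_def mat_def)
qed

lemma inv_metric_sym:
  assumes "v \<in> V"
  shows "inv_metric (g v) i j = inv_metric (g v) j i"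
proof -
  let ?M = "metric_matrix (g v)" and ?I = "matrix_inv (metric_matrix (g v))"
  have tM: "transpose ?M = ?M"
    by (simp add: vec_eq_iff transpose_def g_sym[OF assms])
  have "transpose ?I = transpose ?I ** (?M ** ?I)"
    using matrix_inv_g[OF assms] by simp
  also have "\<dots> = transpose (?M ** ?I) ** ?I"
    by (simp add: matrix_transpose_mul tM matrix_mul_assoc)
  also have "\<dots> = ?I"
    using matrix_inv_g[OF assms] by (simp add: transpose_mat)
  finally have "transpose ?I $ j $ i = ?I $ j $ i" by simp
  then show ?thesis
    by (simp add: inv_metric_def transpose_def)
qed

lemma differentiable_g: "u \<in> V \<Longrightarrow> (\<lambda>v. g v [i, j]) differentiable (at u)"
  using smooth_on_differentiable[OF smooth_g] by blast

lemma differentiable_inv_metric: "u \<in> V \<Longrightarrow> (\<lambda>v. inv_metric (g v) i j) differentiable (at u)"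
  unfolding inv_metric_def
  by (rule differentiable_matrix_inv[where V=V])
     (use open_V det_pos differentiable_g in \<open>auto simp: less_le\<close>)

text \<open>Obtained by differentiating \<open>g g\<^sup>-\<^sup>1 = 1\<close>.\<close>

lemma partial_deriv_inv_metric:
  assumes "u \<in> V"
  shows "partial_deriv m (\<lambda>v. inv_metric (g v) a b) u =
    - (\<Sum>c\<in>UNIV. \<Sum>d\<in>UNIV. inv_metric (g u) a c * partial_deriv m (\<lambda>v. g v [c, d]) u * inv_metric (g u) d b)"
proof -
  let ?G = "\<lambda>v. inv_metric (g v)"
  let ?D = "\<lambda>d. partial_deriv m (\<lambda>v. ?G v d b) u"
  have c: "(\<Sum>d\<in>UNIV. g u [c, d] * ?D d) = - (\<Sum>d\<in>UNIV. partial_deriv m (\<lambda>v. g v [c, d]) u * ?G u d b)" for c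
  proof -
    have "partial_deriv m (\<lambda>v. \<Sum>d\<in>UNIV. g v [c, d] * ?G v d b) u = partial_deriv m (\<lambda>v. if c = b then 1 else 0) u"
      by (rule partial_deriv_cong[OF open_V assms]) (rule inv_metric_right)
    then have "partial_deriv m (\<lambda>v. \<Sum>d\<in>UNIV. g v [c, d] * ?G v d b) u = 0"
      by (simp add: partial_deriv_const)
    then show ?thesis
      using assms
      by (simp add: partial_deriv_sum partial_deriv_mult differentiable_g differentiable_inv_metric sum.distrib)
  qed
  have "?D a = (\<Sum>d\<in>UNIV. (if a = d then 1 else 0) * ?D d)"
    by (simp add: if_distrib[where f="\<lambda>x. x * _"] cong: if_cong)
  also have "\<dots> = (\<Sum>d\<in>UNIV. \<Sum>c\<in>UNIV. ?G u a c * (g u [c, d] * ?D d))"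
    by (simp add: inv_metric_left[OF assms, symmetric] sum_distrib_right mult.assoc)
  also have "\<dots> = (\<Sum>c\<in>UNIV. ?G u a c * (\<Sum>d\<in>UNIV. g u [c, d] * ?D d))"
    by (subst sum.swap) (simp add: sum_distrib_left)
  finally show ?thesis
    by (simp add: c sum_negf sum_distrib_left mult.assoc)
qed

text \<open>The formula for the derivative of the inverse expresses it through the inverse itself, so each order of
  differentiability gives the next one.\<close>

lemma smooth_inv_metric: "smooth_on V (\<lambda>v. inv_metric (g v) a b)"
proof -
  have "Ck_on k V (\<lambda>v. inv_metric (g v) a b)" for k a b
  proof (induction k arbitrary: a b)
    case 0
    show ?case
      by (auto intro!: continuous_at_imp_continuous_on differentiable_imp_continuous_within differentiable_inv_metric)
  next
    case (Suc k)
    have "Ck_on k V (partial_deriv m (\<lambda>v. g v [c, d]))" for m c d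
      using smooth_on_partial_deriv[OF smooth_g] by (simp add: smooth_on_def)
    then have "Ck_on k V (\<lambda>u. - (\<Sum>c\<in>UNIV. \<Sum>d\<in>UNIV.
        inv_metric (g u) a c * partial_deriv m (\<lambda>v. g v [c, d]) u * inv_metric (g u) d b))" for m
      by (intro Ck_on_uminus Ck_on_sum Ck_on_mult open_V Suc.IH) auto
    then have "Ck_on k V (partial_deriv m (\<lambda>v. inv_metric (g v) a b))" for m
      using Ck_on_cong[OF open_V partial_deriv_inv_metric] by simp
    then show ?case
      using differentiable_inv_metric by simp
  qed
  then show ?thesis by (simp add: smooth_on_def)
qed

lemma smooth_christoffel: "smooth_on V (\<lambda>v. christoffel g v k i j)"
proof -
  have "Ck_on n V (partial_deriv m (\<lambda>v. g v [c, d]))" for n m c d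
    using smooth_on_partial_deriv[OF smooth_g] by (simp add: smooth_on_def)
  moreover have "Ck_on n V (\<lambda>v. inv_metric (g v) a b)" for n a b
    using smooth_inv_metric by (simp add: smooth_on_def)
  ultimately have "Ck_on n V (\<lambda>u. (\<Sum>l\<in>UNIV. inv_metric (g u) k l *
     (partial_deriv i (\<lambda>v. g v [j, l]) u + partial_deriv j (\<lambda>v. g v [i, l]) u
      - partial_deriv l (\<lambda>v. g v [i, j]) u)) * (1 / 2))" for n
    by (intro Ck_on_mult Ck_on_sum Ck_on_add Ck_on_diff Ck_on_const open_V) auto
  then show ?thesis
    by (simp add: smooth_on_def christoffel_def)
qed

lemma partial_deriv_g_sym:
  "u \<in> V \<Longrightarrow> partial_deriv m (\<lambda>v. g v [i, j]) u = partial_deriv m (\<lambda>v. g v [j, i]) u"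
  by (rule partial_deriv_cong[OF open_V]) (auto intro: g_sym)

lemma christoffel_sym:
  assumes "u \<in> V"
  shows "christoffel g u k i j = christoffel g u k j i"
  unfolding christoffel_def
  by (intro arg_cong2[where f="(/)"] sum.cong refl) (simp add: partial_deriv_g_sym[OF assms, of _ i j])

lemma christoffel_lower:
  assumes "u \<in> V"
  shows "(\<Sum>l\<in>UNIV. christoffel g u l i j * g u [l, k]) =
    (partial_deriv i (\<lambda>v. g v [j, k]) u + partial_deriv j (\<lambda>v. g v [i, k]) u
      - partial_deriv k (\<lambda>v. g v [i, j]) u) / 2"
proof -
  define P where "P l = (partial_deriv i (\<lambda>v. g v [j, l]) u + partial_deriv j (\<lambda>v. g v [i, l]) u
      - partial_deriv l (\<lambda>v. g v [i, j]) u) / 2" for l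
  have "(\<Sum>l\<in>UNIV. christoffel g u l i j * g u [l, k]) =
      (\<Sum>l\<in>UNIV. \<Sum>p\<in>UNIV. P p * (inv_metric (g u) l p * g u [l, k]))"
    by (simp add: christoffel_def P_def sum_divide_distrib sum_distrib_right sum_distrib_left mult_ac)
  also have "\<dots> = (\<Sum>p\<in>UNIV. P p * (\<Sum>l\<in>UNIV. inv_metric (g u) p l * g u [l, k]))"
    by (subst sum.swap) (simp add: sum_distrib_left inv_metric_sym[OF assms])
  also have "\<dots> = P k"
    by (simp add: inv_metric_left[OF assms] if_distrib[where f="\<lambda>x. _ * x"] cong: if_cong)
  finally show ?thesis by (simp add: P_def)
qed

lemma metric_compatible:
  assumes "u \<in> V"
  shows "partial_deriv m (\<lambda>v. g v [i, j]) u =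
    (\<Sum>l\<in>UNIV. christoffel g u l m i * g u [l, j]) + (\<Sum>l\<in>UNIV. christoffel g u l m j * g u [i, l])"
proof -
  have "(\<Sum>l\<in>UNIV. christoffel g u l m j * g u [i, l]) = (\<Sum>l\<in>UNIV. christoffel g u l m j * g u [l, i])"
    by (simp add: g_sym[OF assms, of i])
  then show ?thesis
    by (simp add: christoffel_lower[OF assms] partial_deriv_g_sym[OF assms, of _ j] field_simps)
qed

lemma partial_deriv_inv_metric_christoffel:
  assumes "u \<in> V"
  shows "partial_deriv m (\<lambda>v. inv_metric (g v) a b) u =
    - (\<Sum>l\<in>UNIV. christoffel g u a m l * inv_metric (g u) l b + christoffel g u b m l * inv_metric (g u) a l)"
proof -
  let ?G = "inv_metric (g u)" and ?C = "\<lambda>l c. christoffel g u l m c"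
  have 1: "(\<Sum>c\<in>UNIV. \<Sum>d\<in>UNIV. ?G a c * (\<Sum>l\<in>UNIV. ?C l c * g u [l, d]) * ?G d b) = (\<Sum>c\<in>UNIV. ?C b c * ?G a c)"
  proof -
    have "(\<Sum>d\<in>UNIV. ?G a c * (\<Sum>l\<in>UNIV. ?C l c * g u [l, d]) * ?G d b) = ?C b c * ?G a c" for c
    proof -
      have "(\<Sum>d\<in>UNIV. ?G a c * (\<Sum>l\<in>UNIV. ?C l c * g u [l, d]) * ?G d b) =
          (\<Sum>d\<in>UNIV. \<Sum>l\<in>UNIV. ?G a c * ?C l c * (g u [l, d] * ?G d b))"
        by (simp add: sum_distrib_left sum_distrib_right mult_ac)
      also have "\<dots> = (\<Sum>l\<in>UNIV. ?G a c * ?C l c * (\<Sum>d\<in>UNIV. g u [l, d] * ?G d b))"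
        by (subst sum.swap) (simp add: sum_distrib_left)
      finally show ?thesis
        by (simp add: inv_metric_right[OF assms] if_distrib[where f="\<lambda>x. _ * x"] cong: if_cong)
    qed
    then show ?thesis by simp
  qed
  have 2: "(\<Sum>c\<in>UNIV. \<Sum>d\<in>UNIV. ?G a c * (\<Sum>l\<in>UNIV. ?C l d * g u [c, l]) * ?G d b) = (\<Sum>d\<in>UNIV. ?C a d * ?G d b)"
  proof -
    have "(\<Sum>c\<in>UNIV. ?G a c * (\<Sum>l\<in>UNIV. ?C l d * g u [c, l]) * ?G d b) = ?C a d * ?G d b" for d
    proof -
      have "(\<Sum>c\<in>UNIV. ?G a c * (\<Sum>l\<in>UNIV. ?C l d * g u [c, l]) * ?G d b) =
          (\<Sum>c\<in>UNIV. \<Sum>l\<in>UNIV. ?G d b * ?C l d * (?G a c * g u [c, l]))"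
        by (simp add: sum_distrib_left sum_distrib_right mult_ac)
      also have "\<dots> = (\<Sum>l\<in>UNIV. ?G d b * ?C l d * (\<Sum>c\<in>UNIV. ?G a c * g u [c, l]))"
        by (subst sum.swap) (simp add: sum_distrib_left)
      finally show ?thesis
        by (simp add: inv_metric_left[OF assms] if_distrib[where f="\<lambda>x. _ * x"] cong: if_cong)
    qed
    then show ?thesis by (subst sum.swap) simp
  qed
  show ?thesis
    unfolding partial_deriv_inv_metric[OF assms] metric_compatible[OF assms] distrib_left distrib_right sum.distrib 1 2
    by simp
qed

lemma has_real_derivative_volume:
  assumes "u \<in> V"
  shows "((\<lambda>s. sqrt (det (metric_matrix (g (u + s *\<^sub>R axis m 1))))) has_real_derivative
    (\<Sum>l\<in>UNIV. christoffel g u l m l) * sqrt (det (metric_matrix (g u)))) (at 0)"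
proof -
  let ?M = "metric_matrix (g u)" and ?N = "\<chi> l i. christoffel g u l m i"
  let ?D = "transpose ?N ** ?M + ?M ** ?N" and ?f = "\<lambda>s. det (metric_matrix (g (u + s *\<^sub>R axis m 1)))"
  have "?D $ i $ j = partial_deriv m (\<lambda>v. g v [i, j]) u" for i j
    by (simp add: metric_compatible[OF assms] matrix_matrix_mult_def transpose_def mult.commute)
  then have "(?f has_real_derivative det_derivative (metric_matrix (g (u + 0 *\<^sub>R axis m 1))) ?D) (at 0)"
    using has_real_derivative_axis[OF differentiable_g[OF assms]] by (intro has_real_derivative_det) simp
  then have f: "(?f has_real_derivative 2 * trace ?N * det ?M) (at 0)"
    by (simp add: det_derivative_add det_derivative_left_mult det_derivative_right_mult)
       (simp add: trace_def transpose_def mult_ac)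
  have "det ?M > 0"
    by (rule det_pos[OF assms])
  have "((\<lambda>s. sqrt (?f s)) has_real_derivative 2 * trace ?N * det ?M * (inverse (sqrt (?f 0)) / 2)) (at 0)"
    using DERIV_chain2[OF DERIV_real_sqrt f] \<open>det ?M > 0\<close> by (simp add: mult_ac)
  moreover have "2 * trace ?N * det ?M * (inverse (sqrt (?f 0)) / 2) = trace ?N * sqrt (det ?M)"
    using \<open>det ?M > 0\<close> by (simp add: field_simps)
  ultimately have "((\<lambda>s. sqrt (?f s)) has_real_derivative trace ?N * sqrt (det ?M)) (at 0)"
    by (simp only:)
  then show ?thesis
    by (simp add: trace_def)
qed

end

section \<open>The covariant derivative of the dual form\<close>

locale chart_G2 = chart_metric +
  fixes \<phi> T :: local_field
  assumes smooth_\<phi>: "\<And>is. length is = 3 \<Longrightarrow> smooth_on V (\<lambda>v. \<phi> v is)"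
    and smooth_T: "\<And>is. length is = 2 \<Longrightarrow> smooth_on V (\<lambda>v. T v is)"
    and alternating_\<phi>: "\<And>v. v \<in> V \<Longrightarrow> alternating 3 (\<phi> v)"
    and torsion: "\<And>v m i j k. v \<in> V \<Longrightarrow> cov_deriv g \<phi> v [m, i, j, k] =
      (\<Sum>p\<in>UNIV. \<Sum>q\<in>UNIV. T v [m, p] * inv_metric (g v) p q * hodge 3 (g v) (\<phi> v) [q, i, j, k])"
begin

definition \<psi> :: local_field where "\<psi> v = hodge 3 (g v) (\<phi> v)"

lemma differentiable_\<phi>: "u \<in> V \<Longrightarrow> length is = 3 \<Longrightarrow> (\<lambda>v. \<phi> v is) differentiable (at u)"
  using smooth_on_differentiable[OF smooth_\<phi>] by blast

lemma differentiable_T: "u \<in> V \<Longrightarrow> length is = 2 \<Longrightarrow> (\<lambda>v. T v is) differentiable (at u)"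
  using smooth_on_differentiable[OF smooth_T] by blast

lemma differentiable_\<psi>:
  assumes "u \<in> V"
  shows "(\<lambda>v. \<psi> v is) differentiable (at u)"
proof -
  have det: "(\<lambda>v. det (metric_matrix (g v))) differentiable (at u)"
    by (rule differentiable_det) (simp add: differentiable_g[OF assms])
  have "((\<lambda>v. sqrt (det (metric_matrix (g v)))) has_derivative
     (\<lambda>x. frechet_derivative (\<lambda>v. det (metric_matrix (g v))) (at u) x * (inverse (sqrt (det (metric_matrix (g u)))) / 2))) (at u)"
    using has_derivative_real_sqrt[OF det_pos[OF assms] frechet_derivative_works[THEN iffD1, OF det]]
    by (simp add: mult_ac)
  then have vol: "(\<lambda>v. sqrt (det (metric_matrix (g v)))) differentiable (at u)"
    by (auto simp: differentiable_def)
  have pairing: "(\<lambda>v. multi_pairing (inv_metric (g v)) is js) differentiable (at u)" for "is" js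
    unfolding multi_pairing_def by (rule differentiable_prod) (auto intro: differentiable_inv_metric[OF assms])
  show ?thesis
    unfolding \<psi>_def hodge_eq
    by (intro differentiable_mult differentiable_divide differentiable_sum vol pairing differentiable_const
        finite_lists_length ballI differentiable_\<phi>[OF assms]) auto
qed

lemma partial_deriv_\<phi>:
  assumes "u \<in> V" "length is = 3"
  shows "partial_deriv m (\<lambda>v. \<phi> v is) u = index_action (\<lambda>l i. christoffel g u l m i) (\<phi> u) is +
    (\<Sum>p\<in>UNIV. \<Sum>q\<in>UNIV. T u [m, p] * inv_metric (g u) p q * \<psi> u (q # is))"
proof -
  obtain i j k where "is = [i, j, k]"
    using assms(2) by (auto simp: numeral_eq_Suc length_Suc_conv)
  then show ?thesis
    using torsion[OF assms(1), of m i j k] by (simp add: index_action_def \<psi>_def)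
qed

text \<open>This is \<open>\<nabla>\<^sub>m\<psi> = \<phi> \<and> T\<^sub>m\<close>: as the Hodge star is parallel, \<open>\<nabla>\<^sub>m\<psi> = *\<nabla>\<^sub>m\<phi>\<close>, and \<open>\<nabla>\<^sub>m\<phi> = T\<^sub>m \<lrcorner> *\<phi>\<close> by the
  definition of the torsion.\<close>

lemma partial_deriv_\<psi>:
  assumes "u \<in> V" "length is = 4"
  shows "partial_deriv m (\<lambda>v. \<psi> v is) u =
    index_action (\<lambda>l i. christoffel g u l m i) (\<psi> u) is + wedge_covector (\<phi> u) (\<lambda>p. T u [m, p]) is"
proof (rule partial_deriv_axis_unique[OF differentiable_\<psi>[OF assms(1)]])
  let ?N = "\<lambda>l i. christoffel g u l m i" and ?h = "\<lambda>s. g (u + s *\<^sub>R axis m 1)"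
  let ?\<alpha> = "\<lambda>s. \<phi> (u + s *\<^sub>R axis m 1)"
  let ?\<sigma> = "\<lambda>is. \<Sum>p\<in>UNIV. \<Sum>q\<in>UNIV. T u [m, p] * inv_metric (g u) p q * \<psi> u (q # is)"
  have "((\<lambda>s. hodge 3 (?h s) (?\<alpha> s) is) has_real_derivative
    index_action ?N (hodge 3 (?h 0) (?\<alpha> 0)) is + hodge 3 (?h 0) ?\<sigma> is) (at 0)"
  proof (rule has_real_derivative_hodge)
    show "((\<lambda>s. inv_metric (?h s) i j) has_real_derivative
        - (\<Sum>l\<in>UNIV. ?N i l * inv_metric (?h 0) l j + ?N j l * inv_metric (?h 0) i l)) (at 0)" for i j
      using has_real_derivative_axis[OF differentiable_inv_metric[OF assms(1), of i j], of m]
      by (simp add: partial_deriv_inv_metric_christoffel[OF assms(1)])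
    show "((\<lambda>s. sqrt (det (metric_matrix (?h s)))) has_real_derivative
        (\<Sum>l\<in>UNIV. ?N l l) * sqrt (det (metric_matrix (?h 0)))) (at 0)"
      using has_real_derivative_volume[OF assms(1)] by simp
    show "((\<lambda>s. ?\<alpha> s is) has_real_derivative index_action ?N (?\<alpha> 0) is + ?\<sigma> is) (at 0)"
      if "length is = 3" for "is"
      using has_real_derivative_axis[OF differentiable_\<phi>[OF assms(1) that], of m]
      by (simp add: partial_deriv_\<phi>[OF assms(1) that])
    show "3 + length is = 7" using assms(2) by simp
  qed
  moreover have "hodge 3 (g u) ?\<sigma> is = wedge_covector (\<phi> u) (\<lambda>p. T u [m, p]) is"
    unfolding \<psi>_def
    by (rule hodge_interior_product_hodge)
       (use assms det_pos matrix_inv_g inv_metric_sym alternating_\<phi> in auto)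
  ultimately show "((\<lambda>s. \<psi> (u + s *\<^sub>R axis m 1) is) has_real_derivative
      index_action ?N (\<psi> u) is + wedge_covector (\<phi> u) (\<lambda>p. T u [m, p]) is) (at 0)"
    by (simp add: \<psi>_def)
qed

text \<open>The right-hand side of \<open>partial_deriv_\<psi>\<close> contains no derivative of \<open>\<psi>\<close>, so each order of
  differentiability gives the next one.\<close>

lemma smooth_\<psi>:
  assumes "length is = 4"
  shows "smooth_on V (\<lambda>v. \<psi> v is)"
proof -
  have "Ck_on k V (\<lambda>v. \<psi> v is)" if "length is = 4" for k "is"
    using that
  proof (induction k arbitrary: "is")
    case 0
    show ?case
      by (auto intro!: continuous_at_imp_continuous_on differentiable_imp_continuous_within differentiable_\<psi>)
  next
    case (Suc k)
    have C: "Ck_on k V (\<lambda>v. christoffel g v l m i)" for l m i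
      using smooth_christoffel by (simp add: smooth_on_def)
    have F: "Ck_on k V (\<lambda>v. \<phi> v [a, b, c])" and T: "Ck_on k V (\<lambda>v. T v [a, b])" for a b c
      using smooth_\<phi> smooth_T by (simp_all add: smooth_on_def)
    have "Ck_on k V (\<lambda>u. index_action (\<lambda>l i. christoffel g u l m i) (\<psi> u) is +
        wedge_covector (\<phi> u) (\<lambda>p. T u [m, p]) is)" for m
      unfolding index_action_def wedge_covector_def using Suc.prems
      by (intro Ck_on_add Ck_on_sum Ck_on_diff Ck_on_mult open_V C F T Suc.IH) auto
    then have "Ck_on k V (partial_deriv m (\<lambda>v. \<psi> v is))" for m
      using Ck_on_cong[OF open_V partial_deriv_\<psi>[OF _ Suc.prems]] by simp
    then show ?case
      using differentiable_\<psi> by simp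
  qed
  then show ?thesis using assms by (simp add: smooth_on_def)
qed

end

section \<open>Geodesics and normal coordinates\<close>

text \<open>The function \<open>exp (- 2 L t) |z t|\<^sup>2\<close> is nonincreasing.\<close>

lemma gronwall_zero:
  fixes z :: "real \<Rightarrow> 'a::real_inner"
  assumes z: "\<And>t. t \<in> {a..b} \<Longrightarrow> (z has_vector_derivative z' t) (at t within {a..b})"
    and bound: "\<And>t. t \<in> {a..b} \<Longrightarrow> norm (z' t) \<le> L * norm (z t)"
    and "z a = 0" "t \<in> {a..b}"
  shows "z t = 0"
proof -
  let ?h = "\<lambda>s. exp (- 2 * L * s) * (z s \<bullet> z s)"
  have cont: "continuous_on {a..b} z"
    by (rule continuous_on_vector_derivative) (rule z)
  have "?h t \<le> ?h a"
  proof (rule DERIV_nonpos_imp_decreasing_open[where f="?h"])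
    show "a \<le> t" using assms(4) by simp
    show "continuous_on {a..t} ?h"
      using assms(4) by (intro continuous_intros continuous_on_subset[OF cont]) auto
    fix s assume s: "a < s" "s < t"
    then have "(z has_vector_derivative z' s) (at s)"
      using z[of s] assms(4) by (simp add: at_within_Icc_at)
    then have "((\<lambda>s. z s \<bullet> z s) has_real_derivative 2 * (z s \<bullet> z' s)) (at s)"
      unfolding has_vector_derivative_def has_field_derivative_def
      by (auto intro!: derivative_eq_intros simp: inner_commute algebra_simps)
    then have "(?h has_real_derivative
        exp (- 2 * L * s) * (2 * (z s \<bullet> z' s)) + (- 2 * L * exp (- 2 * L * s)) * (z s \<bullet> z s)) (at s)"
      by (auto intro!: derivative_eq_intros)
    moreover have "exp (- 2 * L * s) * (2 * (z s \<bullet> z' s)) + (- 2 * L * exp (- 2 * L * s)) * (z s \<bullet> z s) \<le> 0"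
    proof -
      have "z s \<bullet> z' s \<le> norm (z s) * norm (z' s)"
        by (rule norm_cauchy_schwarz)
      also have "\<dots> \<le> norm (z s) * (L * norm (z s))"
        using bound[of s] s assms(4) by (intro mult_left_mono) auto
      finally have "z s \<bullet> z' s - L * (z s \<bullet> z s) \<le> 0"
        by (simp add: power2_norm_eq_inner[symmetric] power2_eq_square mult_ac)
      then have "2 * exp (- 2 * L * s) * (z s \<bullet> z' s - L * (z s \<bullet> z s)) \<le> 0"
        by (intro mult_nonneg_nonpos) auto
      then show ?thesis by (simp add: algebra_simps)
    qed
    ultimately show "\<exists>y. (?h has_real_derivative y) (at s) \<and> y \<le> 0" by blast
  qed
  then have "z t \<bullet> z t \<le> 0"
    using assms(3) by (simp add: mult_le_0_iff)
  then show ?thesis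
    by (metis inner_gt_zero_iff linorder_not_less)
qed

lemma C1_lipschitz_on_cball:
  fixes f :: "real ^ 'n::finite \<Rightarrow> real"
  assumes f: "Ck_on 1 V f" and V: "cball p r \<subseteq> V"
  shows "\<exists>L\<ge>0. (\<forall>x\<in>cball p r. \<forall>y\<in>cball p r. \<bar>f x - f y\<bar> \<le> L * norm (x - y)) \<and>
    (\<forall>x\<in>cball p r. \<bar>f x\<bar> \<le> L)"
proof -
  have bdd: "\<exists>B\<ge>0. \<forall>x\<in>cball p r. \<bar>h x\<bar> \<le> B" if "continuous_on V h" for h :: "real ^ 'n \<Rightarrow> real"
  proof -
    have "bounded (h ` cball p r)"
      by (intro compact_imp_bounded compact_continuous_image continuous_on_subset[OF that V] compact_cball)
    then obtain B where "\<forall>x\<in>cball p r. \<bar>h x\<bar> \<le> B"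
      by (auto simp: bounded_iff simp del: mem_cball)
    then show ?thesis
      by (intro exI[of _ "max B 0"]) (auto simp: le_max_iff_disj)
  qed
  have "continuous_on V f"
    using Ck_on_SucD[of 0 V f] f by simp
  then obtain B0 where B0: "B0 \<ge> 0" "\<And>x. x \<in> cball p r \<Longrightarrow> \<bar>f x\<bar> \<le> B0"
    using bdd by blast
  have "\<forall>i. \<exists>B\<ge>0. \<forall>x\<in>cball p r. \<bar>partial_deriv i f x\<bar> \<le> B"
    using f by (intro allI bdd) simp
  from choice[OF this] obtain B where
    "\<forall>i. B i \<ge> 0 \<and> (\<forall>x\<in>cball p r. \<bar>partial_deriv i f x\<bar> \<le> B i)" ..
  then have B: "B i \<ge> 0" "x \<in> cball p r \<Longrightarrow> \<bar>partial_deriv i f x\<bar> \<le> B i" for i x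
    by blast+
  have lip: "norm (f x - f y) \<le> (\<Sum>i\<in>UNIV. B i) * norm (x - y)" if "x \<in> cball p r" "y \<in> cball p r" for x y
  proof (rule differentiable_bound[OF convex_cball _ _ that])
    fix u assume u: "u \<in> cball p r"
    have "f differentiable (at u)"
      using f u V by auto
    then show "(f has_derivative (\<lambda>h. \<Sum>i\<in>UNIV. h $ i * partial_deriv i f u)) (at u within cball p r)"
      by (rule has_derivative_at_withinI[OF has_derivative_partial_deriv])
    show "onorm (\<lambda>h. \<Sum>i\<in>UNIV. h $ i * partial_deriv i f u) \<le> (\<Sum>i\<in>UNIV. B i)"
    proof (rule onorm_bound)
      show "0 \<le> (\<Sum>i\<in>UNIV. B i)"
        using B(1) by (simp add: sum_nonneg)
      fix h :: "real ^ 'n"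
      have "\<bar>h $ i * partial_deriv i f u\<bar> \<le> B i * norm h" for i
        using mult_mono[OF B(2)[OF u] component_le_norm_cart[of h i]] B(1) by (simp add: abs_mult mult.commute)
      then show "norm (\<Sum>i\<in>UNIV. h $ i * partial_deriv i f u) \<le> (\<Sum>i\<in>UNIV. B i) * norm h"
        unfolding sum_distrib_right by (intro order_trans[OF norm_sum] sum_mono) simp
    qed
  qed
  show ?thesis
  proof (intro exI[of _ "B0 + (\<Sum>i\<in>UNIV. B i)"] conjI ballI)
    show "0 \<le> B0 + (\<Sum>i\<in>UNIV. B i)"
      using B0(1) B(1) by (simp add: sum_nonneg)
    show "\<bar>f x\<bar> \<le> B0 + (\<Sum>i\<in>UNIV. B i)" if "x \<in> cball p r" for x
      by (rule order_trans[OF B0(2)[OF that]]) (simp add: sum_nonneg B(1))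
    show "\<bar>f x - f y\<bar> \<le> (B0 + (\<Sum>i\<in>UNIV. B i)) * norm (x - y)" if "x \<in> cball p r" "y \<in> cball p r" for x y
      using lip[OF that] mult_nonneg_nonneg[OF B0(1) norm_ge_zero[of "x - y"]] by (simp add: distrib_right)
  qed
qed

context chart_metric
begin

definition geodesic_acceleration :: "coords \<Rightarrow> coords \<Rightarrow> coords" where
  "geodesic_acceleration p w = (\<chi> k. - (\<Sum>i\<in>UNIV. \<Sum>j\<in>UNIV. christoffel g p k i j * w $ i * w $ j))"

lemma geodesic_acceleration_lipschitz:
  assumes V: "cball p r \<subseteq> V"
  shows "\<exists>L. \<forall>x\<in>cball p r. \<forall>y\<in>cball p r. \<forall>v w :: coords. norm v \<le> B \<longrightarrow> norm w \<le> B \<longrightarrow>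
    norm (geodesic_acceleration x v - geodesic_acceleration y w) \<le> L * norm (x - y, v - w)"
proof -
  \<comment> \<open>A common constant for the values and the increments of each Christoffel symbol.\<close>
  define lip where "lip f L \<longleftrightarrow> L \<ge> 0 \<and>
      (\<forall>x\<in>cball p r. \<forall>y\<in>cball p r. \<bar>f x - f y\<bar> \<le> L * norm (x - y)) \<and> (\<forall>x\<in>cball p r. \<bar>f x\<bar> \<le> L)"
    for f :: "coords \<Rightarrow> real" and L
  define L where "L k i j = (SOME L. lip (\<lambda>v. christoffel g v k i j) L)" for k i j
  have L: "lip (\<lambda>v. christoffel g v k i j) (L k i j)" for k i j
    unfolding L_def
  proof (rule someI_ex)
    have C1: "Ck_on 1 V (\<lambda>v. christoffel g v k i j)"
      using smooth_christoffel by (simp add: smooth_on_def del: Ck_on.simps)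
    show "\<exists>L. lip (\<lambda>v. christoffel g v k i j) L"
      using C1_lipschitz_on_cball[OF C1 V] unfolding lip_def .
  qed
  have L0: "L k i j \<ge> 0"
    and L1: "x \<in> cball p r \<Longrightarrow> y \<in> cball p r \<Longrightarrow> \<bar>christoffel g x k i j - christoffel g y k i j\<bar> \<le> L k i j * norm (x - y)"
    and L2: "x \<in> cball p r \<Longrightarrow> \<bar>christoffel g x k i j\<bar> \<le> L k i j" for k i j x y
    using L[of k i j] by (auto simp: lip_def)
  define M where "M = (\<Sum>k\<in>UNIV. \<Sum>i\<in>UNIV. \<Sum>j\<in>UNIV. L k i j * (B * B + 2 * B))"
  show ?thesis
  proof (intro exI[of _ M] ballI allI impI)
    fix x y v w :: coords assume x: "x \<in> cball p r" and y: "y \<in> cball p r" and v: "norm v \<le> B" and w: "norm w \<le> B"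
    let ?z = "(x - y, v - w)"
    have B: "B \<ge> 0" using v norm_ge_zero order_trans by blast
    have summand: "\<bar>christoffel g y k i j * w $ i * w $ j - christoffel g x k i j * v $ i * v $ j\<bar>
        \<le> L k i j * (B * B + 2 * B) * norm ?z" for k i j
    proof -
      let ?a = "christoffel g x k i j" and ?b = "christoffel g y k i j"
      have comp: "\<bar>v $ i\<bar> \<le> B" "\<bar>w $ i\<bar> \<le> B" "\<bar>v $ i - w $ i\<bar> \<le> norm ?z" for i
        using component_le_norm_cart[of v i] component_le_norm_cart[of w i] component_le_norm_cart[of "v - w" i]
          v w norm_snd_le[of "v - w" "x - y"] by auto
      have xy: "norm (x - y) \<le> norm ?z"
        using norm_fst_le[of "x - y" "v - w"] by auto
      have "\<bar>(?a - ?b) * v $ i * v $ j\<bar> \<le> (L k i j * norm ?z) * B * B"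
        unfolding abs_mult
        by (intro mult_mono mult_nonneg_nonneg abs_ge_zero norm_ge_zero L0 B comp
            order_trans[OF L1[OF x y] mult_left_mono[OF xy L0]])
      moreover have "\<bar>?b * (v $ i - w $ i) * v $ j\<bar> \<le> L k i j * norm ?z * B"
        unfolding abs_mult
        by (intro mult_mono mult_nonneg_nonneg abs_ge_zero norm_ge_zero L0 B comp L2[OF y])
      moreover have "\<bar>?b * w $ i * (v $ j - w $ j)\<bar> \<le> L k i j * B * norm ?z"
        unfolding abs_mult
        by (intro mult_mono mult_nonneg_nonneg abs_ge_zero norm_ge_zero L0 B comp L2[OF y])
      ultimately have "\<bar>(?a - ?b) * v $ i * v $ j + ?b * (v $ i - w $ i) * v $ j + ?b * w $ i * (v $ j - w $ j)\<bar> \<le>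
          (L k i j * norm ?z) * B * B + L k i j * norm ?z * B + L k i j * B * norm ?z"
        by (intro order_trans[OF abs_triangle_ineq] add_mono)
      also have "(?a - ?b) * v $ i * v $ j + ?b * (v $ i - w $ i) * v $ j + ?b * w $ i * (v $ j - w $ j) =
          ?a * v $ i * v $ j - ?b * w $ i * w $ j"
        by (simp add: algebra_simps)
      also have "(L k i j * norm ?z) * B * B + L k i j * norm ?z * B + L k i j * B * norm ?z =
          L k i j * (B * B + 2 * B) * norm ?z"
        by (simp add: algebra_simps)
      finally show ?thesis
        by (subst abs_minus_commute)
    qed
    have "norm (geodesic_acceleration x v - geodesic_acceleration y w) \<le>
        (\<Sum>k\<in>UNIV. \<bar>(geodesic_acceleration x v - geodesic_acceleration y w) $ k\<bar>)"
      by (rule norm_le_l1_cart)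
    also have "\<dots> = (\<Sum>k\<in>UNIV. \<bar>\<Sum>i\<in>UNIV. \<Sum>j\<in>UNIV.
        christoffel g y k i j * w $ i * w $ j - christoffel g x k i j * v $ i * v $ j\<bar>)"
      by (simp add: geodesic_acceleration_def sum_subtractf)
    also have "\<dots> \<le> (\<Sum>k\<in>UNIV. \<Sum>i\<in>UNIV. \<Sum>j\<in>UNIV. L k i j * (B * B + 2 * B) * norm ?z)"
      by (intro sum_mono order_trans[OF sum_abs] summand)
    also have "\<dots> = M * norm ?z"
      unfolding M_def sum_distrib_right ..
    finally show "norm (geodesic_acceleration x v - geodesic_acceleration y w) \<le> M * norm ?z" .
  qed
qed

lemma geodesic_equation_unique:
  assumes V: "cball p r \<subseteq> V"
    and p1: "\<And>t. t \<in> {a..b} \<Longrightarrow> (p1 has_vector_derivative w1 t) (at t within {a..b})"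
    and w1: "\<And>t. t \<in> {a..b} \<Longrightarrow> (w1 has_vector_derivative geodesic_acceleration (p1 t) (w1 t)) (at t within {a..b})"
    and p2: "\<And>t. t \<in> {a..b} \<Longrightarrow> (p2 has_vector_derivative w2 t) (at t within {a..b})"
    and w2: "\<And>t. t \<in> {a..b} \<Longrightarrow> (w2 has_vector_derivative geodesic_acceleration (p2 t) (w2 t)) (at t within {a..b})"
    and mem: "\<And>t. t \<in> {a..b} \<Longrightarrow> p1 t \<in> cball p r" "\<And>t. t \<in> {a..b} \<Longrightarrow> p2 t \<in> cball p r"
    and init: "p1 a = p2 a" "w1 a = w2 a" and t: "t \<in> {a..b}"
  shows "p1 t = p2 t"
proof -
  have bdd: "\<exists>B. \<forall>t\<in>{a..b}. norm (w t) \<le> B"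
    if "\<And>t. t \<in> {a..b} \<Longrightarrow> (w has_vector_derivative w' t) (at t within {a..b})" for w w' :: "real \<Rightarrow> coords"
  proof -
    have "bounded (w ` {a..b})"
      using continuous_on_vector_derivative[of "{a..b}" w w'] that
      by (intro compact_imp_bounded compact_continuous_image) auto
    then show ?thesis by (auto simp: bounded_iff)
  qed
  have "\<exists>B. \<forall>t\<in>{a..b}. norm (w1 t) \<le> B" "\<exists>B. \<forall>t\<in>{a..b}. norm (w2 t) \<le> B"
    by (rule bdd, erule w1) (rule bdd, erule w2)
  then obtain B1 B2 where "\<forall>t\<in>{a..b}. norm (w1 t) \<le> B1" "\<forall>t\<in>{a..b}. norm (w2 t) \<le> B2"
    by (elim exE)
  then have B: "norm (w1 t) \<le> max B1 B2" "norm (w2 t) \<le> max B1 B2" if "t \<in> {a..b}" for t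
    using that by (auto simp: le_max_iff_disj)
  obtain L where "\<forall>x\<in>cball p r. \<forall>y\<in>cball p r. \<forall>v w :: coords. norm v \<le> max B1 B2 \<longrightarrow>
      norm w \<le> max B1 B2 \<longrightarrow>
      norm (geodesic_acceleration x v - geodesic_acceleration y w) \<le> L * norm (x - y, v - w)"
    using geodesic_acceleration_lipschitz[OF V, of "max B1 B2"] by (elim exE)
  note L = this[rule_format]
  let ?z = "\<lambda>t. (p1 t - p2 t, w1 t - w2 t)"
  let ?z' = "\<lambda>t. (w1 t - w2 t, geodesic_acceleration (p1 t) (w1 t) - geodesic_acceleration (p2 t) (w2 t))"
  have "?z t = 0"
  proof (rule gronwall_zero[where z'="?z'" and L="1 + L" and a=a and b=b])
    fix t assume t: "t \<in> {a..b}"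
    show "(?z has_vector_derivative ?z' t) (at t within {a..b})"
      using p1[OF t] p2[OF t] w1[OF t] w2[OF t]
      by (intro has_vector_derivative_Pair has_vector_derivative_diff)
    have "norm (?z' t) \<le> norm (w1 t - w2 t) +
        norm (geodesic_acceleration (p1 t) (w1 t) - geodesic_acceleration (p2 t) (w2 t))"
      by (rule norm_Pair_le)
    also have "\<dots> \<le> norm (?z t) + L * norm (?z t)"
      using norm_snd_le[of "w1 t - w2 t" "p1 t - p2 t"] L[OF mem(1)[OF t] mem(2)[OF t] B[OF t]] by (intro add_mono) auto
    finally show "norm (?z' t) \<le> (1 + L) * norm (?z t)"
      by (simp add: distrib_right)
  qed (use init t in \<open>simp_all add: zero_prod_def\<close>)
  then show ?thesis by (simp add: zero_prod_def)
qed

end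

lemma geodesic_rescale:
  assumes \<gamma>: "geodesic A g \<gamma>" and t: "t \<in> {0..1}"
  shows "geodesic A g (\<lambda>s. \<gamma> (t * s))"
  unfolding geodesic_def
proof (intro conjI ballI)
  have im: "(\<lambda>s. t * s) ` {0..1} \<subseteq> {0..1}"
    using t by (auto intro: mult_le_one)
  show "continuous_on {0..1} (\<lambda>s. \<gamma> (t * s))"
  proof (rule continuous_on_compose2[OF _ _ im])
    show "continuous_on {0..1} \<gamma>" using \<gamma> by (simp add: geodesic_def)
  qed (intro continuous_intros)
  fix c assume "c \<in> A"
  then have "\<exists>w. \<forall>t\<in>{0..1}. \<gamma> t \<in> chart_dom c \<longrightarrow>
      ((chart_map c \<circ> \<gamma>) has_vector_derivative w t) (at t within {0..1}) \<and>
      (w has_vector_derivative (\<chi> k. - (\<Sum>i\<in>UNIV. \<Sum>j\<in>UNIV.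
          christoffel (g c) (chart_map c (\<gamma> t)) k i j * w t $ i * w t $ j))) (at t within {0..1})"
    using \<gamma> unfolding geodesic_def by blast
  then obtain w where w': "\<forall>t\<in>{0..1}. \<gamma> t \<in> chart_dom c \<longrightarrow>
      ((chart_map c \<circ> \<gamma>) has_vector_derivative w t) (at t within {0..1}) \<and>
      (w has_vector_derivative (\<chi> k. - (\<Sum>i\<in>UNIV. \<Sum>j\<in>UNIV.
          christoffel (g c) (chart_map c (\<gamma> t)) k i j * w t $ i * w t $ j))) (at t within {0..1})" ..
  note w = w'[rule_format]
  have scale: "((\<lambda>s. f (t * s)) has_vector_derivative t *\<^sub>R f') (at s within {0..1})"
    if "(f has_vector_derivative f') (at (t * s) within {0..1})" for f :: "real \<Rightarrow> coords" and f' s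
  proof -
    have "((\<lambda>s. t * s) has_vector_derivative t) (at s within {0..1})"
      by (auto intro!: derivative_eq_intros simp: has_vector_derivative_def)
    then have "((f \<circ> (\<lambda>s. t * s)) has_vector_derivative t *\<^sub>R f') (at s within {0..1})"
      using has_vector_derivative_within_subset[OF that im] by (rule vector_diff_chain_within)
    then show ?thesis by (simp add: o_def)
  qed
  show "\<exists>w. \<forall>s\<in>{0..1}. \<gamma> (t * s) \<in> chart_dom c \<longrightarrow>
      ((chart_map c \<circ> (\<lambda>s. \<gamma> (t * s))) has_vector_derivative w s) (at s within {0..1}) \<and>
      (w has_vector_derivative (\<chi> k. - (\<Sum>i\<in>UNIV. \<Sum>j\<in>UNIV.
          christoffel (g c) (chart_map c (\<gamma> (t * s))) k i j * w s $ i * w s $ j))) (at s within {0..1})"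
  proof (intro exI[of _ "\<lambda>s. t *\<^sub>R w (t * s)"] ballI impI conjI)
    fix s :: real assume "s \<in> {0..1}" and dom: "\<gamma> (t * s) \<in> chart_dom c"
    then have ts: "t * s \<in> {0..1}" using im by blast
    show "((chart_map c \<circ> (\<lambda>s. \<gamma> (t * s))) has_vector_derivative t *\<^sub>R w (t * s)) (at s within {0..1})"
      using scale[of "chart_map c \<circ> \<gamma>"] w[OF ts dom] by (simp add: o_def)
    let ?a = "\<chi> k. - (\<Sum>i\<in>UNIV. \<Sum>j\<in>UNIV.
          christoffel (g c) (chart_map c (\<gamma> (t * s))) k i j * w (t * s) $ i * w (t * s) $ j)"
    have "((\<lambda>s. t *\<^sub>R w (t * s)) has_vector_derivative t *\<^sub>R t *\<^sub>R ?a) (at s within {0..1})"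
      using bounded_linear.has_vector_derivative[OF bounded_linear_scaleR_right scale[of w ?a s]] w[OF ts dom] by simp
    moreover have "t *\<^sub>R t *\<^sub>R ?a = (\<chi> k. - (\<Sum>i\<in>UNIV. \<Sum>j\<in>UNIV.
          christoffel (g c) (chart_map c (\<gamma> (t * s))) k i j * (t *\<^sub>R w (t * s)) $ i * (t *\<^sub>R w (t * s)) $ j))"
      by (simp add: vec_eq_iff sum_distrib_left mult_ac)
    ultimately show "((\<lambda>s. t *\<^sub>R w (t * s)) has_vector_derivative (\<chi> k. - (\<Sum>i\<in>UNIV. \<Sum>j\<in>UNIV.
          christoffel (g c) (chart_map c (\<gamma> (t * s))) k i j * (t *\<^sub>R w (t * s)) $ i * (t *\<^sub>R w (t * s)) $ j)))
       (at s within {0..1})"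
      by simp
  qed
qed

lemma geodesic_stays_near:
  fixes c :: "'m::topological_space chart" and \<gamma> :: "real \<Rightarrow> 'm"
  assumes \<gamma>: "continuous_on {0..1} \<gamma>" and c: "is_chart c"
    and t: "t \<in> {0..<1}" "\<gamma> t \<in> chart_dom c" and r: "r > 0"
  shows "\<exists>d>0. t + d \<le> 1 \<and> (\<forall>s\<in>{t..t + d}. \<gamma> s \<in> chart_dom c \<and> chart_map c (\<gamma> s) \<in> cball (chart_map c (\<gamma> t)) r)"
proof -
  let ?U = "chart_dom c \<inter> chart_map c -` ball (chart_map c (\<gamma> t)) r"
  have "open ?U"
    using c by (intro continuous_open_preimage) (auto simp: is_chart_def homeomorphism_def)
  moreover have "\<gamma> t \<in> ?U" using t r by simp
  moreover have "(\<gamma> \<longlongrightarrow> \<gamma> t) (at t within {0..1})"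
  proof -
    have "t \<in> {0..1}" using t by auto
    then show ?thesis using \<gamma> unfolding continuous_on by blast
  qed
  ultimately have "eventually (\<lambda>s. \<gamma> s \<in> ?U) (at t within {0..1})"
    by (auto dest: topological_tendstoD)
  then obtain e where e: "e > 0" "\<And>s. s \<in> {0..1} \<Longrightarrow> s \<noteq> t \<Longrightarrow> dist s t < e \<Longrightarrow> \<gamma> s \<in> ?U"
    unfolding eventually_at by blast
  have near: "\<gamma> s \<in> ?U" if "s \<in> {t..t + min (e / 2) (1 - t)}" for s
    using that e(2)[of s] t \<open>\<gamma> t \<in> ?U\<close> e(1) by (cases "s = t") (auto simp: dist_real_def)
  show ?thesis
  proof (intro exI[of _ "min (e / 2) (1 - t)"] conjI ballI)
    show "0 < min (e / 2) (1 - t)" "t + min (e / 2) (1 - t) \<le> 1"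
      using e(1) t by auto
    fix s assume "s \<in> {t..t + min (e / 2) (1 - t)}"
    from near[OF this]
    show "\<gamma> s \<in> chart_dom c" "chart_map c (\<gamma> s) \<in> cball (chart_map c (\<gamma> t)) r"
      by auto
  qed
qed

lemma at_within_Icc_right_nontrivial: "a < b \<Longrightarrow> at b within {a..b} \<noteq> (bot :: real filter)"
  using trivial_limit_at_left_real[of b] by (simp add: at_within_Icc_at_left)

lemma at_within_Icc_left_nontrivial: "a < b \<Longrightarrow> at a within {a..b} \<noteq> (bot :: real filter)"
  using trivial_limit_at_right_real[of a] by (simp add: at_within_Icc_at_right)

text \<open>Only \<open>\<gamma>1\<close> is assumed to stay in the chart.  At the infimum \<open>\<tau>\<close> of the times at which the curves differ,
  their positions agree by continuity and their velocities agree as derivatives from the left, or by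
  the initial condition.  Hence both curves stay near the same point of the chart for some time after
  \<open>\<tau>\<close>, where they solve the same Lipschitz equation with the same initial values.\<close>

lemma geodesic_unique_in_chart:
  fixes c :: "'m::t2_space chart"
  assumes cA: "c \<in> A" and c: "is_chart c" and metric: "chart_metric (chart_image c) (g c)"
    and g1: "geodesic A g \<gamma>1" and g2: "geodesic A g \<gamma>2"
    and dom: "\<And>t. t \<in> {0..1} \<Longrightarrow> \<gamma>1 t \<in> chart_dom c" and init: "\<gamma>1 0 = \<gamma>2 0"
    and v1: "((chart_map c \<circ> \<gamma>1) has_vector_derivative v) (at 0 within {0..1})"
    and v2: "((chart_map c \<circ> \<gamma>2) has_vector_derivative v) (at 0 within {0..1})"
    and t: "t \<in> {0..1}"
  shows "\<gamma>1 t = \<gamma>2 t"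
proof (rule ccontr)
  interpret chart_metric "chart_image c" "g c" by (rule metric)
  assume neq: "\<gamma>1 t \<noteq> \<gamma>2 t"
  have cont: "continuous_on {0..1} \<gamma>1" "continuous_on {0..1} \<gamma>2"
    using g1 g2 by (auto simp: geodesic_def)
  have "\<exists>w. \<forall>t\<in>{0..1}. \<gamma>1 t \<in> chart_dom c \<longrightarrow>
      ((chart_map c \<circ> \<gamma>1) has_vector_derivative w t) (at t within {0..1}) \<and>
      (w has_vector_derivative geodesic_acceleration (chart_map c (\<gamma>1 t)) (w t)) (at t within {0..1})"
    using g1 cA unfolding geodesic_def geodesic_acceleration_def by blast
  then obtain w1 where w1': "\<forall>t\<in>{0..1}. \<gamma>1 t \<in> chart_dom c \<longrightarrow>
      ((chart_map c \<circ> \<gamma>1) has_vector_derivative w1 t) (at t within {0..1}) \<and>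
      (w1 has_vector_derivative geodesic_acceleration (chart_map c (\<gamma>1 t)) (w1 t)) (at t within {0..1})" ..
  note w1 = w1'[rule_format]
  have "\<exists>w. \<forall>t\<in>{0..1}. \<gamma>2 t \<in> chart_dom c \<longrightarrow>
      ((chart_map c \<circ> \<gamma>2) has_vector_derivative w t) (at t within {0..1}) \<and>
      (w has_vector_derivative geodesic_acceleration (chart_map c (\<gamma>2 t)) (w t)) (at t within {0..1})"
    using g2 cA unfolding geodesic_def geodesic_acceleration_def by blast
  then obtain w2 where w2': "\<forall>t\<in>{0..1}. \<gamma>2 t \<in> chart_dom c \<longrightarrow>
      ((chart_map c \<circ> \<gamma>2) has_vector_derivative w2 t) (at t within {0..1}) \<and>
      (w2 has_vector_derivative geodesic_acceleration (chart_map c (\<gamma>2 t)) (w2 t)) (at t within {0..1})" ..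
  note w2 = w2'[rule_format]
  define B where "B = {t \<in> {0..1}. \<gamma>1 t \<noteq> \<gamma>2 t}"
  define \<tau> where "\<tau> = Inf B"
  have tB: "t \<in> B" using t neq by (simp add: B_def)
  have bdd: "bdd_below B" by (rule bdd_belowI[of _ 0]) (simp add: B_def)
  have \<tau>0: "0 \<le> \<tau>" unfolding \<tau>_def using tB by (intro cInf_greatest) (auto simp: B_def)
  have \<tau>t: "\<tau> \<le> t" unfolding \<tau>_def by (rule cInf_lower[OF tB bdd])
  have before: "\<gamma>1 s = \<gamma>2 s" if "0 \<le> s" "s < \<tau>" for s
  proof (rule ccontr)
    assume "\<gamma>1 s \<noteq> \<gamma>2 s"
    then have "s \<in> B" using that \<tau>t t by (simp add: B_def)
    then have "\<tau> \<le> s" unfolding \<tau>_def by (rule cInf_lower[OF _ bdd])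
    with that show False by simp
  qed
  have at_\<tau>: "\<gamma>1 \<tau> = \<gamma>2 \<tau>"
  proof (cases "\<tau> = 0")
    case False
    then have pos: "0 < \<tau>" using \<tau>0 by simp
    have sub: "{0..\<tau>} \<subseteq> {0..1}" and mem: "\<tau> \<in> {0..1}"
      using \<tau>0 \<tau>t t by auto
    have lim: "(\<gamma>1 \<longlongrightarrow> \<gamma>1 \<tau>) (at \<tau> within {0..\<tau>})" "(\<gamma>2 \<longlongrightarrow> \<gamma>2 \<tau>) (at \<tau> within {0..\<tau>})"
      using tendsto_within_subset[OF _ sub] cont mem unfolding continuous_on by blast+
    have "eventually (\<lambda>s. \<gamma>1 s = \<gamma>2 s) (at \<tau> within {0..\<tau>})"
      unfolding eventually_at_filter using before by (auto intro: always_eventually)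
    with lim(1) have "(\<gamma>2 \<longlongrightarrow> \<gamma>1 \<tau>) (at \<tau> within {0..\<tau>})"
      by (rule Lim_transform_eventually)
    moreover have "at \<tau> within {0..\<tau>} \<noteq> bot"
      by (rule at_within_Icc_right_nontrivial[OF pos])
    ultimately show ?thesis
      using lim(2) tendsto_unique by blast
  qed (use init in simp)
  have upto: "\<gamma>1 s = \<gamma>2 s" if "s \<in> {0..\<tau>}" for s
    using that before at_\<tau> by (cases "s = \<tau>") auto
  have "\<tau> \<noteq> t" using at_\<tau> neq by auto
  with \<tau>t t have \<tau>1: "\<tau> < 1" "\<tau> < t" by auto
  have \<tau>mem: "\<tau> \<in> {0..1}" using \<tau>0 \<tau>1 by simp
  have dom1: "\<gamma>1 \<tau> \<in> chart_dom c" and dom2: "\<gamma>2 \<tau> \<in> chart_dom c"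
    using dom[OF \<tau>mem] at_\<tau> by auto
  have w_\<tau>: "w1 \<tau> = w2 \<tau>"
  proof (cases "\<tau> = 0")
    case True
    have "w1 0 = v" "w2 0 = v"
      using w1[OF \<tau>mem dom1] w2[OF \<tau>mem dom2] v1 v2 True
        vector_derivative_unique_within[OF at_within_Icc_left_nontrivial[OF zero_less_one]] by auto
    with True show ?thesis by simp
  next
    case False
    then have pos: "0 < \<tau>" using \<tau>0 by simp
    have sub: "{0..\<tau>} \<subseteq> {0..1}" using \<tau>1 by auto
    have d1: "((chart_map c \<circ> \<gamma>1) has_vector_derivative w1 \<tau>) (at \<tau> within {0..\<tau>})"
      using w1[OF \<tau>mem dom1] has_vector_derivative_within_subset[OF _ sub] by blast
    have "((chart_map c \<circ> \<gamma>2) has_vector_derivative w2 \<tau>) (at \<tau> within {0..\<tau>})"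
      using w2[OF \<tau>mem dom2] has_vector_derivative_within_subset[OF _ sub] by blast
    then have "((chart_map c \<circ> \<gamma>1) has_vector_derivative w2 \<tau>) (at \<tau> within {0..\<tau>})"
      by (rule has_vector_derivative_transform[rotated 2]) (use upto pos in auto)
    with d1 show ?thesis
      using vector_derivative_unique_within[OF at_within_Icc_right_nontrivial[OF pos]] by blast
  qed
  have "chart_map c (\<gamma>1 \<tau>) \<in> chart_image c"
    using dom1 by (simp add: chart_image_def)
  then obtain r where r: "r > 0" "cball (chart_map c (\<gamma>1 \<tau>)) r \<subseteq> chart_image c"
    using open_V open_contains_cball by blast
  obtain d1 where d1: "d1 > 0" "\<tau> + d1 \<le> 1"
      "\<And>s. s \<in> {\<tau>..\<tau> + d1} \<Longrightarrow> \<gamma>1 s \<in> chart_dom c \<and> chart_map c (\<gamma>1 s) \<in> cball (chart_map c (\<gamma>1 \<tau>)) r"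
    using geodesic_stays_near[OF cont(1) c, of \<tau> r] \<tau>0 \<tau>1 dom1 r(1) by auto
  obtain d2 where d2: "d2 > 0" "\<tau> + d2 \<le> 1"
      "\<And>s. s \<in> {\<tau>..\<tau> + d2} \<Longrightarrow> \<gamma>2 s \<in> chart_dom c \<and> chart_map c (\<gamma>2 s) \<in> cball (chart_map c (\<gamma>1 \<tau>)) r"
    using geodesic_stays_near[OF cont(2) c, of \<tau> r] \<tau>0 \<tau>1 dom2 r(1) unfolding at_\<tau> by auto
  define d where "d = min d1 d2"
  have d: "d > 0" using d1(1) d2(1) by (simp add: d_def)
  have sub: "{\<tau>..\<tau> + d} \<subseteq> {0..1}" using \<tau>0 d1(2) by (auto simp: d_def)
  have after: "\<gamma>1 s = \<gamma>2 s" if s: "s \<in> {\<tau>..\<tau> + d}" for s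
  proof -
    have mem1: "\<gamma>1 s \<in> chart_dom c" "chart_map c (\<gamma>1 s) \<in> cball (chart_map c (\<gamma>1 \<tau>)) r"
      and mem2: "\<gamma>2 s \<in> chart_dom c" "chart_map c (\<gamma>2 s) \<in> cball (chart_map c (\<gamma>1 \<tau>)) r"
      if "s \<in> {\<tau>..\<tau> + d}" for s
      using that d1(3)[of s] d2(3)[of s] by (auto simp: d_def)
    have eq: "(chart_map c \<circ> \<gamma>1) s = (chart_map c \<circ> \<gamma>2) s"
    proof (rule geodesic_equation_unique[OF r(2), where ?w1.0=w1 and ?w2.0=w2])
      fix s assume s: "s \<in> {\<tau>..\<tau> + d}"
      then have "s \<in> {0..1}" using sub by blast
      note W1 = w1[OF this mem1(1)[OF s]] and W2 = w2[OF this mem2(1)[OF s]]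
      show "((chart_map c \<circ> \<gamma>1) has_vector_derivative w1 s) (at s within {\<tau>..\<tau> + d})"
        "((chart_map c \<circ> \<gamma>2) has_vector_derivative w2 s) (at s within {\<tau>..\<tau> + d})"
        "(w1 has_vector_derivative geodesic_acceleration ((chart_map c \<circ> \<gamma>1) s) (w1 s)) (at s within {\<tau>..\<tau> + d})"
        "(w2 has_vector_derivative geodesic_acceleration ((chart_map c \<circ> \<gamma>2) s) (w2 s)) (at s within {\<tau>..\<tau> + d})"
        using W1 W2 has_vector_derivative_within_subset[OF _ sub] by (auto simp: o_def)
      show "(chart_map c \<circ> \<gamma>1) s \<in> cball (chart_map c (\<gamma>1 \<tau>)) r" "(chart_map c \<circ> \<gamma>2) s \<in> cball (chart_map c (\<gamma>1 \<tau>)) r"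
        using mem1(2)[OF s] mem2(2)[OF s] by simp_all
    next
      show "(chart_map c \<circ> \<gamma>1) \<tau> = (chart_map c \<circ> \<gamma>2) \<tau>"
        using at_\<tau> by simp
    qed (rule w_\<tau>, rule s)
    show ?thesis
      using eq c mem1(1)[OF s] mem2(1)[OF s] unfolding is_chart_def homeomorphism_def by (metis comp_apply)
  qed
  have "\<tau> + d \<le> b" if "b \<in> B" for b
  proof (rule ccontr)
    assume "\<not> \<tau> + d \<le> b"
    moreover have "\<tau> \<le> b" unfolding \<tau>_def by (rule cInf_lower[OF that bdd])
    ultimately have "\<gamma>1 b = \<gamma>2 b" by (intro after) auto
    with that show False by (simp add: B_def)
  qed
  then have "\<tau> + d \<le> \<tau>"
    unfolding \<tau>_def using tB by (intro cInf_greatest) auto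
  with d show False by simp
qed

lemma chart_map_inv:
  assumes "is_chart c" "u \<in> chart_image c"
  shows "chart_map c (chart_inv c u) = u" "chart_inv c u \<in> chart_dom c"
  using assms by (auto simp: is_chart_def homeomorphism_def)

text \<open>Let \<open>\<gamma>\<close> be the geodesic with \<open>\<gamma> 1 = exp\<^sub>x (u\<^sup>i e\<^sub>i)\<close>.  By uniqueness \<open>\<gamma> t = exp\<^sub>x (t u\<^sup>i e\<^sub>i)\<close>, which has the
  coordinates \<open>t u\<close>.  So the ray \<open>t u\<close> is a geodesic with velocity \<open>u\<close>, and its acceleration vanishes.
  Uniqueness is applied in a single chart and hence only for small \<open>t\<close>.\<close>

lemma radial_geodesic:
  fixes c :: "'m::t2_space chart"
  assumes nc: "normal_coordinates A g x e c" and c: "is_chart c"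
    and metric: "chart_metric (chart_image c) (g c)"
    and ball: "ball 0 \<rho> \<subseteq> chart_image c" and u: "u \<in> ball 0 \<rho>"
  shows "(\<Sum>i\<in>UNIV. u $ i *\<^sub>R e i c) = u \<and>
    (\<exists>\<tau>>0. \<forall>t\<in>{0..\<tau>}. chart_metric.geodesic_acceleration (g c) (t *\<^sub>R u) u = 0)"
proof -
  interpret chart_metric "chart_image c" "g c" by (rule metric)
  have cA: "c \<in> A" and x: "x \<in> chart_dom c" "chart_map c x = 0"
    and exp: "\<And>u. u \<in> chart_image c \<Longrightarrow> is_exp A g x (\<lambda>d. \<Sum>i\<in>UNIV. u $ i *\<^sub>R e i d) (chart_inv c u)"
    using nc by (auto simp: normal_coordinates_def)
  define v where "v = (\<Sum>i\<in>UNIV. u $ i *\<^sub>R e i c)"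
  have "u \<in> chart_image c" using ball u by blast
  then obtain \<gamma> where \<gamma>: "geodesic A g \<gamma>" "\<gamma> 0 = x" "\<gamma> 1 = chart_inv c u"
    and vel: "((chart_map c \<circ> \<gamma>) has_vector_derivative v) (at 0 within {0..1})"
    using exp[of u] cA x(1) unfolding is_exp_def v_def by blast
  have cont: "continuous_on {0..1} \<gamma>" using \<gamma>(1) by (simp add: geodesic_def)
  have "\<exists>d>0. 0 + d \<le> 1 \<and> (\<forall>s\<in>{0..0 + d}. \<gamma> s \<in> chart_dom c \<and> chart_map c (\<gamma> s) \<in> cball (chart_map c (\<gamma> 0)) 1)"
    by (rule geodesic_stays_near[OF cont c]) (use x \<gamma>(2) in auto)
  then obtain \<tau> where \<tau>: "\<tau> > 0" "\<tau> \<le> 1" and stay: "\<And>s. s \<in> {0..\<tau>} \<Longrightarrow> \<gamma> s \<in> chart_dom c"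
    by auto
  have radial: "chart_map c (\<gamma> t) = t *\<^sub>R u" if t: "t \<in> {0..\<tau>}" for t
  proof -
    have t01: "t \<in> {0..1}" using t \<tau> by auto
    have "norm (t *\<^sub>R u) \<le> norm u"
      using t01 by (simp add: mult_left_le_one_le)
    then have tu: "t *\<^sub>R u \<in> chart_image c"
      using u ball by (auto simp: subset_eq)
    then obtain \<delta> where \<delta>: "geodesic A g \<delta>" "\<delta> 0 = x" "\<delta> 1 = chart_inv c (t *\<^sub>R u)"
      and vel\<delta>: "((chart_map c \<circ> \<delta>) has_vector_derivative (\<Sum>i\<in>UNIV. (t *\<^sub>R u) $ i *\<^sub>R e i c)) (at 0 within {0..1})"
      using exp[of "t *\<^sub>R u"] cA x(1) unfolding is_exp_def by blast
    have im: "(\<lambda>s. t * s) ` {0..1} \<subseteq> {0..1}"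
      using t01 by (auto intro: mult_le_one)
    have "((\<lambda>s. t * s) has_vector_derivative t) (at 0 within {0..1})"
      by (auto intro!: derivative_eq_intros simp: has_vector_derivative_def)
    then have "((chart_map c \<circ> \<gamma>) \<circ> (\<lambda>s. t * s) has_vector_derivative t *\<^sub>R v) (at 0 within {0..1})"
      using has_vector_derivative_within_subset[OF vel im] by (intro vector_diff_chain_within) auto
    then have "((chart_map c \<circ> (\<lambda>s. \<gamma> (t * s))) has_vector_derivative t *\<^sub>R v) (at 0 within {0..1})"
      by (simp add: o_def)
    moreover have "(\<Sum>i\<in>UNIV. (t *\<^sub>R u) $ i *\<^sub>R e i c) = t *\<^sub>R v"
      by (simp add: v_def scaleR_sum_right)
    moreover have "\<gamma> (t * s) \<in> chart_dom c" if "s \<in> {0..1}" for s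
    proof (rule stay)
      have "t * s \<le> t" using that t by (simp add: mult_left_le)
      then show "t * s \<in> {0..\<tau>}" using that t by simp
    qed
    \<comment> \<open>Both \<open>s \<mapsto> \<gamma> (t s)\<close> and \<open>\<delta>\<close> start at \<open>x\<close> with velocity \<open>t v\<close>.\<close>
    ultimately have "\<gamma> (t * 1) = \<delta> 1"
      using vel\<delta> \<gamma>(2) \<delta>(2)
      by (intro geodesic_unique_in_chart[OF cA c metric geodesic_rescale[OF \<gamma>(1) t01] \<delta>(1), where t=1]) auto
    then show ?thesis
      using \<delta>(3) chart_map_inv[OF c tu] by simp
  qed
  have sub: "{0..\<tau>} \<subseteq> {0..1}" using \<tau> by auto
  have ray: "((chart_map c \<circ> \<gamma>) has_vector_derivative u) (at t within {0..\<tau>})" if "t \<in> {0..\<tau>}" for t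
  proof (rule has_vector_derivative_transform[OF that])
    show "((\<lambda>t. t *\<^sub>R u) has_vector_derivative u) (at t within {0..\<tau>})"
      by (auto intro!: derivative_eq_intros simp: has_vector_derivative_def)
  qed (simp add: radial)
  have nontrivial: "at t within {0..\<tau>} \<noteq> bot" if "t \<in> {0..\<tau>}" for t
    using \<tau>(1) that at_within_Icc_left_nontrivial at_within_Icc_right_nontrivial at_within_Icc_at[of 0 t \<tau>]
    by (cases "t = 0"; cases "t = \<tau>") auto
  have "v = u"
    using vector_derivative_unique_within[OF nontrivial has_vector_derivative_within_subset[OF vel sub] ray] \<tau>(1) by simp
  moreover have "geodesic_acceleration (t *\<^sub>R u) u = 0" if t: "t \<in> {0..\<tau>}" for t
  proof -
    have "\<exists>w. \<forall>t\<in>{0..1}. \<gamma> t \<in> chart_dom c \<longrightarrow>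
        ((chart_map c \<circ> \<gamma>) has_vector_derivative w t) (at t within {0..1}) \<and>
        (w has_vector_derivative geodesic_acceleration (chart_map c (\<gamma> t)) (w t)) (at t within {0..1})"
      using \<gamma>(1) cA unfolding geodesic_def geodesic_acceleration_def by blast
    then obtain w where w: "\<forall>t\<in>{0..1}. \<gamma> t \<in> chart_dom c \<longrightarrow>
        ((chart_map c \<circ> \<gamma>) has_vector_derivative w t) (at t within {0..1}) \<and>
        (w has_vector_derivative geodesic_acceleration (chart_map c (\<gamma> t)) (w t)) (at t within {0..1})" ..
    have w_eq: "w s = u" if s: "s \<in> {0..\<tau>}" for s
    proof -
      have "((chart_map c \<circ> \<gamma>) has_vector_derivative w s) (at s within {0..\<tau>})"
        using w s sub stay[OF s] by (intro has_vector_derivative_within_subset[OF _ sub]) blast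
      then show ?thesis
        using vector_derivative_unique_within[OF nontrivial[OF s] _ ray[OF s]] by blast
    qed
    have "(w has_vector_derivative geodesic_acceleration (chart_map c (\<gamma> t)) (w t)) (at t within {0..\<tau>})"
      using w t sub stay[OF t] by (intro has_vector_derivative_within_subset[OF _ sub]) blast
    then have "((\<lambda>_. u) has_vector_derivative geodesic_acceleration (t *\<^sub>R u) u) (at t within {0..\<tau>})"
      unfolding radial[OF t] w_eq[OF t]
      by (rule has_vector_derivative_transform[OF t, rotated]) (simp add: w_eq)
    then show ?thesis
      using vector_derivative_unique_within[OF nontrivial[OF t] _ has_vector_derivative_const[of u]] by blast
  qed
  ultimately show ?thesis
    using \<tau>(1) unfolding v_def by blast
qed

section \<open>The connection at the origin of normal coordinates\<close>

lemma sum_axis: "(\<Sum>i\<in>UNIV. axis p 1 $ i * f i) = (f p :: real)"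
  by (simp add: axis_def if_distrib[where f="\<lambda>x. x * _"] cong: if_cong)

text \<open>A chart in which every ray from the origin is initially a geodesic.\<close>

locale radial_chart_metric = chart_metric +
  fixes \<rho> :: real
  assumes origin: "0 \<in> V" and \<rho>: "\<rho> > 0"
    and radial: "\<And>u. u \<in> ball 0 \<rho> \<Longrightarrow> \<exists>\<tau>>0. \<forall>t\<in>{0..\<tau>}. geodesic_acceleration (t *\<^sub>R u) u = 0"
begin

lemma differentiable_christoffel: "v \<in> V \<Longrightarrow> (\<lambda>v. christoffel g v k i j) differentiable (at v)"
  using smooth_on_differentiable[OF smooth_christoffel] by blast

text \<open>The value and the derivative at \<open>t = 0\<close> of the geodesic equation \<open>\<Gamma>\<^sup>k\<^sub>i\<^sub>j(t u) u\<^sup>i u\<^sup>j = 0\<close>.\<close>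

lemma christoffel_radial:
  shows "(\<Sum>i\<in>UNIV. \<Sum>j\<in>UNIV. christoffel g 0 k i j * u $ i * u $ j) = 0" (is "?Q u = 0")
    and "(\<Sum>i\<in>UNIV. \<Sum>j\<in>UNIV. \<Sum>p\<in>UNIV. partial_deriv p (\<lambda>v. christoffel g v k i j) 0 * u $ p * u $ i * u $ j) = 0"
      (is "?C u = 0")
proof -
  have ball: "?Q u = 0 \<and> ?C u = 0" if u: "u \<in> ball 0 \<rho>" for u
  proof -
    let ?F = "\<lambda>t. \<Sum>i\<in>UNIV. \<Sum>j\<in>UNIV. christoffel g (t *\<^sub>R u) k i j * u $ i * u $ j"
    obtain \<tau> where \<tau>: "\<tau> > 0" "\<forall>t\<in>{0..\<tau>}. geodesic_acceleration (t *\<^sub>R u) u = 0"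
      using radial[OF u] by blast
    have F: "?F t = 0" if "t \<in> {0..\<tau>}" for t
    proof -
      have "geodesic_acceleration (t *\<^sub>R u) u $ k = 0"
        using \<tau>(2) that by simp
      then show ?thesis by (simp add: geodesic_acceleration_def)
    qed
    have "?Q u = 0" using F[of 0] \<tau>(1) by simp
    have line: "((\<lambda>t. christoffel g (t *\<^sub>R u) k i j) has_real_derivative
        (\<Sum>p\<in>UNIV. u $ p * partial_deriv p (\<lambda>v. christoffel g v k i j) 0)) (at 0)" for i j
      using has_real_derivative_along_line[of "\<lambda>v. christoffel g v k i j" 0 0 u]
        differentiable_christoffel[OF origin] by simp
    have "(?F has_real_derivative (\<Sum>i\<in>UNIV. \<Sum>j\<in>UNIV.
        (\<Sum>p\<in>UNIV. u $ p * partial_deriv p (\<lambda>v. christoffel g v k i j) 0) * u $ i * u $ j)) (at 0)"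
      by (intro DERIV_sum DERIV_cmult_right line)
    moreover have "(\<Sum>i\<in>UNIV. \<Sum>j\<in>UNIV.
        (\<Sum>p\<in>UNIV. u $ p * partial_deriv p (\<lambda>v. christoffel g v k i j) 0) * u $ i * u $ j) = ?C u"
      by (simp add: sum_distrib_left sum_distrib_right mult_ac)
    ultimately have "(?F has_vector_derivative ?C u) (at 0 within {0..\<tau>})"
      by (simp add: has_real_derivative_iff_has_vector_derivative[symmetric] has_field_derivative_at_within)
    moreover have "(?F has_vector_derivative 0) (at 0 within {0..\<tau>})"
      by (rule has_vector_derivative_transform[OF _ _ has_vector_derivative_const[of 0]])
         (use \<tau>(1) F in auto)
    ultimately have "?C u = 0"
      using vector_derivative_unique_within[OF at_within_Icc_left_nontrivial[OF \<tau>(1)]] by blast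
    with \<open>?Q u = 0\<close> show ?thesis by simp
  qed
  define s where "s = \<rho> / (2 * (norm u + 1))"
  have s: "s > 0" using \<rho> by (simp add: s_def add_nonneg_pos)
  \<comment> \<open>Both forms are homogeneous, so it suffices to consider a multiple of \<open>u\<close> in the ball.\<close>
  have "s *\<^sub>R u \<in> ball 0 \<rho>"
  proof -
    have "norm u < 2 * (norm u + 1)" by (smt (verit) norm_ge_zero)
    then have "norm u * \<rho> < 2 * (norm u + 1) * \<rho>" using \<rho> by simp
    then have "\<rho> * norm u / (2 * (norm u + 1)) < \<rho>"
      using norm_ge_zero[of u] by (simp add: divide_less_eq mult_ac add_nonneg_pos)
    then show ?thesis using s \<rho> by (simp add: s_def)
  qed
  from ball[OF this] have "s * s * ?Q u = 0" "s * s * s * ?C u = 0"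
    by (simp_all add: sum_distrib_left mult_ac)
  then show "?Q u = 0" "?C u = 0" using s by simp_all
qed

lemma christoffel_origin: "christoffel g 0 k i j = 0"
proof -
  define b where "b x y = (\<Sum>i\<in>UNIV. \<Sum>j\<in>UNIV. christoffel g 0 k i j * x $ i * y $ j)" for x y :: coords
  have axis: "b (axis p 1) (axis q 1) = christoffel g 0 k p q" for p q
  proof -
    have "b (axis p 1) (axis q 1) = (\<Sum>i\<in>UNIV. axis p 1 $ i * (\<Sum>j\<in>UNIV. axis q 1 $ j * christoffel g 0 k i j))"
      unfolding b_def sum_distrib_left by (simp add: mult_ac)
    then show ?thesis by (simp only: sum_axis)
  qed
  have zero: "b x x = 0" for x
    unfolding b_def by (rule christoffel_radial(1))
  have "b (axis i 1 + axis j 1) (axis i 1 + axis j 1) =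
      b (axis i 1) (axis i 1) + b (axis i 1) (axis j 1) + b (axis j 1) (axis i 1) + b (axis j 1) (axis j 1)"
    by (simp add: b_def algebra_simps sum.distrib)
  then have "b (axis i 1) (axis j 1) + b (axis j 1) (axis i 1) = 0"
    by (simp add: zero)
  then show ?thesis
    unfolding axis using christoffel_sym[OF origin, of k i j] by simp
qed

lemma partial_deriv_christoffel_sym:
  "partial_deriv p (\<lambda>v. christoffel g v k i j) 0 = partial_deriv p (\<lambda>v. christoffel g v k j i) 0"
  by (rule partial_deriv_cong[OF open_V origin]) (rule christoffel_sym)

text \<open>The polarisation of the cubic identity in \<open>christoffel_radial\<close>: its derivative at \<open>u\<close> in the direction \<open>m\<close>.\<close>

lemma christoffel_cyclic:
  "(\<Sum>p\<in>UNIV. \<Sum>q\<in>UNIV. partial_deriv m (\<lambda>v. christoffel g v k p q) 0 * u $ p * u $ q) =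
    - 2 * (\<Sum>p\<in>UNIV. \<Sum>q\<in>UNIV. partial_deriv p (\<lambda>v. christoffel g v k q m) 0 * u $ p * u $ q)"
proof -
  let ?d = "\<lambda>p i j. partial_deriv p (\<lambda>v. christoffel g v k i j) 0"
  let ?x = "\<lambda>s. u + s *\<^sub>R axis m 1" and ?e = "axis m 1 :: coords"
  let ?C = "\<lambda>s. \<Sum>i\<in>UNIV. \<Sum>j\<in>UNIV. \<Sum>p\<in>UNIV. ?d p i j * ?x s $ p * ?x s $ i * ?x s $ j"
  have "(?C has_real_derivative (\<Sum>i\<in>UNIV. \<Sum>j\<in>UNIV. \<Sum>p\<in>UNIV.
      ?d p i j * ?e $ p * u $ i * u $ j + ?d p i j * u $ p * ?e $ i * u $ j + ?d p i j * u $ p * u $ i * ?e $ j)) (at 0)"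
    by (intro DERIV_sum) (auto intro!: derivative_eq_intros simp: algebra_simps)
  moreover have "?C = (\<lambda>s. 0)"
    by (rule ext) (rule christoffel_radial(2))
  ultimately have "(\<Sum>i\<in>UNIV. \<Sum>j\<in>UNIV. \<Sum>p\<in>UNIV.
      ?d p i j * ?e $ p * u $ i * u $ j + ?d p i j * u $ p * ?e $ i * u $ j + ?d p i j * u $ p * u $ i * ?e $ j) = 0"
    by (simp add: DERIV_unique[OF _ DERIV_const])
  then have "(\<Sum>i\<in>UNIV. \<Sum>j\<in>UNIV. \<Sum>p\<in>UNIV. ?d p i j * ?e $ p * u $ i * u $ j) +
      (\<Sum>i\<in>UNIV. \<Sum>j\<in>UNIV. \<Sum>p\<in>UNIV. ?d p i j * u $ p * ?e $ i * u $ j) +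
      (\<Sum>i\<in>UNIV. \<Sum>j\<in>UNIV. \<Sum>p\<in>UNIV. ?d p i j * u $ p * u $ i * ?e $ j) = 0"
    by (simp add: sum.distrib)
  moreover have "(\<Sum>i\<in>UNIV. \<Sum>j\<in>UNIV. \<Sum>p\<in>UNIV. ?d p i j * ?e $ p * u $ i * u $ j) =
      (\<Sum>p\<in>UNIV. \<Sum>q\<in>UNIV. ?d m p q * u $ p * u $ q)"
  proof -
    have "(\<Sum>p\<in>UNIV. ?d p i j * ?e $ p * u $ i * u $ j) = ?d m i j * u $ i * u $ j" for i j
      using sum_axis[of m "\<lambda>p. ?d p i j * u $ i * u $ j"] by (simp add: mult_ac)
    then show ?thesis by simp
  qed
  moreover have "(\<Sum>i\<in>UNIV. \<Sum>j\<in>UNIV. \<Sum>p\<in>UNIV. ?d p i j * u $ p * ?e $ i * u $ j) =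
      (\<Sum>p\<in>UNIV. \<Sum>q\<in>UNIV. ?d p q m * u $ p * u $ q)"
  proof -
    have "(\<Sum>i\<in>UNIV. \<Sum>j\<in>UNIV. \<Sum>p\<in>UNIV. ?d p i j * u $ p * ?e $ i * u $ j) =
        (\<Sum>i\<in>UNIV. ?e $ i * (\<Sum>j\<in>UNIV. \<Sum>p\<in>UNIV. ?d p i j * u $ p * u $ j))"
      by (simp add: sum_distrib_left mult_ac)
    also have "\<dots> = (\<Sum>j\<in>UNIV. \<Sum>p\<in>UNIV. ?d p m j * u $ p * u $ j)"
      by (rule sum_axis)
    finally show ?thesis
      by (subst sum.swap) (simp add: partial_deriv_christoffel_sym[of _ k m])
  qed
  moreover have "(\<Sum>i\<in>UNIV. \<Sum>j\<in>UNIV. \<Sum>p\<in>UNIV. ?d p i j * u $ p * u $ i * ?e $ j) =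
      (\<Sum>p\<in>UNIV. \<Sum>q\<in>UNIV. ?d p q m * u $ p * u $ q)"
  proof -
    have "(\<Sum>j\<in>UNIV. \<Sum>p\<in>UNIV. ?d p i j * u $ p * u $ i * ?e $ j) = (\<Sum>p\<in>UNIV. ?d p i m * u $ p * u $ i)" for i
      using sum_axis[of m "\<lambda>j. \<Sum>p\<in>UNIV. ?d p i j * u $ p * u $ i"] by (simp add: sum_distrib_left mult_ac)
    then show ?thesis by (simp only:) (rule sum.swap)
  qed
  ultimately show ?thesis by simp
qed

end

locale normal_chart_metric = radial_chart_metric +
  assumes g_origin: "g 0 [i, j] = (if i = j then 1 else 0)"
begin

lemma inv_metric_origin: "inv_metric (g 0) i j = (if i = j then 1 else 0)"
  using inv_metric_right[OF origin, of i j]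
  by (simp add: g_origin if_distrib[where f="\<lambda>x. x * _"] cong: if_cong)

lemma riemann_origin:
  "riemann g 0 i j k l =
    partial_deriv i (\<lambda>v. christoffel g v l j k) 0 - partial_deriv j (\<lambda>v. christoffel g v l i k) 0"
  by (simp add: riemann_def christoffel_origin g_origin if_distrib[where f="\<lambda>x. x * _"] cong: if_cong)

text \<open>At the origin \<open>R\<^sub>p\<^sub>i\<^sub>q\<^sub>m = \<partial>\<^sub>p\<Gamma>\<^sup>m\<^sub>i\<^sub>q - \<partial>\<^sub>i\<Gamma>\<^sup>m\<^sub>p\<^sub>q\<close>, and by \<open>christoffel_cyclic\<close> the second term, contracted with
  \<open>u\<^sup>p u\<^sup>q\<close>, is \<open>-2\<close> times the first.\<close>

lemma radial_christoffel_riemann: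
  "(\<Sum>p\<in>UNIV. \<Sum>q\<in>UNIV. partial_deriv p (\<lambda>v. christoffel g v m q i) 0 * u $ p * u $ q) =
    1 / 3 * (\<Sum>p\<in>UNIV. \<Sum>q\<in>UNIV. riemann g 0 p i q m * u $ p * u $ q)"
proof -
  have "(\<Sum>p\<in>UNIV. \<Sum>q\<in>UNIV. riemann g 0 p i q m * u $ p * u $ q) =
      (\<Sum>p\<in>UNIV. \<Sum>q\<in>UNIV. partial_deriv p (\<lambda>v. christoffel g v m q i) 0 * u $ p * u $ q) -
      (\<Sum>p\<in>UNIV. \<Sum>q\<in>UNIV. partial_deriv i (\<lambda>v. christoffel g v m p q) 0 * u $ p * u $ q)"
    by (simp add: riemann_origin partial_deriv_christoffel_sym[of _ m i] left_diff_distrib sum_subtractf)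
  then show ?thesis
    unfolding christoffel_cyclic by simp
qed

end

section \<open>Second order Taylor expansion\<close>

lemma taylor_second_order_bigo:
  fixes f :: "real ^ 'n::finite \<Rightarrow> real"
  assumes f: "Ck_on 3 (ball 0 r) f" and r: "r > 0"
  shows "(\<lambda>u. f u - (f 0 + (\<Sum>q\<in>UNIV. partial_deriv q f 0 * u $ q) +
      1 / 2 * (\<Sum>p\<in>UNIV. \<Sum>q\<in>UNIV. partial_deriv p (partial_deriv q f) 0 * u $ p * u $ q)))
    \<in> O[at 0](\<lambda>u. norm u ^ 3)"
proof -
  let ?V = "ball (0 :: real ^ 'n) r" and ?K = "cball (0 :: real ^ 'n) (r / 2)"
  let ?d1 = "\<lambda>q. partial_deriv q f" and ?d2 = "\<lambda>p q. partial_deriv p (partial_deriv q f)"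
  let ?d3 = "\<lambda>m p q. partial_deriv m (partial_deriv p (partial_deriv q f))"
  have K: "?K \<subseteq> ?V" using r by (simp add: subset_eq)
  have diff: "f differentiable (at v)" "?d1 q differentiable (at v)" "?d2 p q differentiable (at v)"
    if "v \<in> ?V" for v p q
    using f that by (auto simp: numeral_eq_Suc)
  have "continuous_on ?V (?d3 m p q)" for m p q
    using f by (auto simp: numeral_eq_Suc)
  then have "compact (?d3 m p q ` ?K)" for m p q
    by (intro compact_continuous_image continuous_on_subset[OF _ K] compact_cball)
  then have "\<exists>B. \<forall>x\<in>?K. \<bar>?d3 m p q x\<bar> \<le> B" for m p q
    using compact_imp_bounded[of "?d3 m p q ` ?K"] by (auto simp: bounded_iff simp del: mem_cball)
  then have B: "\<forall>x\<in>?K. \<bar>?d3 m p q x\<bar> \<le> (SOME B. \<forall>x\<in>?K. \<bar>?d3 m p q x\<bar> \<le> B)" for m p q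
    by (rule someI_ex)
  define B where "B m p q = (SOME B. \<forall>x\<in>?K. \<bar>?d3 m p q x\<bar> \<le> B)" for m p q
  define M where "M = (\<Sum>q\<in>UNIV. \<Sum>p\<in>UNIV. \<Sum>m\<in>UNIV. B m p q)"
  have bound: "\<bar>f u - (f 0 + (\<Sum>q\<in>UNIV. ?d1 q 0 * u $ q) + 1 / 2 * (\<Sum>p\<in>UNIV. \<Sum>q\<in>UNIV. ?d2 p q 0 * u $ p * u $ q))\<bar>
      \<le> M / 6 * norm u ^ 3" if u: "u \<in> ?K" for u
  proof -
    have tu: "t *\<^sub>R u \<in> ?K" if "0 \<le> t" "t \<le> 1" for t
    proof -
      have "norm (t *\<^sub>R u) \<le> norm u" using that by (simp add: mult_left_le_one_le)
      then show ?thesis using u by simp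
    qed
    \<comment> \<open>\<open>h n\<close> is the \<open>n\<close>-th derivative of \<open>t \<mapsto> f (t u)\<close>.\<close>
    define h where "h n t = (if n = 0 then f (t *\<^sub>R u)
      else if n = 1 then \<Sum>q\<in>UNIV. u $ q * ?d1 q (t *\<^sub>R u)
      else if n = 2 then \<Sum>q\<in>UNIV. u $ q * (\<Sum>p\<in>UNIV. u $ p * ?d2 p q (t *\<^sub>R u))
      else \<Sum>q\<in>UNIV. u $ q * (\<Sum>p\<in>UNIV. u $ p * (\<Sum>m\<in>UNIV. u $ m * ?d3 m p q (t *\<^sub>R u))))" for n :: nat and t
    have line: "((\<lambda>t. \<phi> (t *\<^sub>R u)) has_real_derivative (\<Sum>i\<in>UNIV. u $ i * partial_deriv i \<phi> (t *\<^sub>R u))) (at t)"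
      if "\<phi> differentiable (at (t *\<^sub>R u))" for \<phi> :: "real ^ 'n \<Rightarrow> real" and t
      using has_real_derivative_along_line[of \<phi> 0 t u] that by simp
    have h': "(h n has_real_derivative h (Suc n) t) (at t)" if n: "n < 3" and t: "0 \<le> t" "t \<le> 1" for n t
    proof -
      have V: "t *\<^sub>R u \<in> ?V" using tu[OF t] K by blast
      consider "n = 0" | "n = 1" | "n = 2" using n by linarith
      then show ?thesis
      proof cases
        case 1
        then show ?thesis using line[OF diff(1)[OF V]] by (simp add: h_def[abs_def])
      next
        case 2
        have "((\<lambda>t. \<Sum>q\<in>UNIV. u $ q * ?d1 q (t *\<^sub>R u)) has_real_derivative
            (\<Sum>q\<in>UNIV. u $ q * (\<Sum>p\<in>UNIV. u $ p * ?d2 p q (t *\<^sub>R u)))) (at t)"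
          by (intro DERIV_sum DERIV_cmult line diff V)
        then show ?thesis using 2 by (simp add: h_def[abs_def])
      next
        case 3
        have "((\<lambda>t. \<Sum>q\<in>UNIV. u $ q * (\<Sum>p\<in>UNIV. u $ p * ?d2 p q (t *\<^sub>R u))) has_real_derivative
            (\<Sum>q\<in>UNIV. u $ q * (\<Sum>p\<in>UNIV. u $ p * (\<Sum>m\<in>UNIV. u $ m * ?d3 m p q (t *\<^sub>R u))))) (at t)"
          by (intro DERIV_sum DERIV_cmult line diff V)
        then show ?thesis using 3 by (simp add: h_def[abs_def])
      qed
    qed
    have "\<exists>t. 0 < t \<and> t < 1 \<and> h 0 1 = (\<Sum>m<3. h m 0 / fact m * 1 ^ m) + h 3 t / fact 3 * 1 ^ 3"
      using h' by (intro Maclaurin[of 1 3 h "h 0"]) auto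
    then obtain t where t: "0 < t" "t < 1" and eq: "h 0 1 = h 0 0 + h 1 0 + h 2 0 / 2 + h 3 t / 6"
      by (auto simp: numeral_eq_Suc)
    have "h 2 0 = (\<Sum>p\<in>UNIV. \<Sum>q\<in>UNIV. ?d2 p q 0 * u $ p * u $ q)"
    proof -
      have "h 2 0 = (\<Sum>q\<in>UNIV. \<Sum>p\<in>UNIV. ?d2 p q 0 * u $ p * u $ q)"
        by (simp add: h_def sum_distrib_left mult_ac)
      then show ?thesis by (subst sum.swap)
    qed
    moreover have "h 1 0 = (\<Sum>q\<in>UNIV. ?d1 q 0 * u $ q)" "h 0 0 = f 0" "h 0 1 = f u"
      by (simp_all add: h_def mult.commute)
    ultimately have remainder: "f u - (f 0 + (\<Sum>q\<in>UNIV. ?d1 q 0 * u $ q) +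
        1 / 2 * (\<Sum>p\<in>UNIV. \<Sum>q\<in>UNIV. ?d2 p q 0 * u $ p * u $ q)) = h 3 t / 6"
      using eq by simp
    have "\<bar>h 3 t\<bar> \<le> M * norm u ^ 3"
    proof -
      have 1: "\<bar>u $ q * (u $ p * (u $ m * ?d3 m p q (t *\<^sub>R u)))\<bar> \<le> B m p q * norm u ^ 3" for m p q
      proof -
        have d3: "\<bar>?d3 m p q (t *\<^sub>R u)\<bar> \<le> B m p q"
          using B tu[of t] t unfolding B_def by simp
        then have "B m p q \<ge> 0" by linarith
        have "\<bar>u $ q\<bar> * (\<bar>u $ p\<bar> * (\<bar>u $ m\<bar> * \<bar>?d3 m p q (t *\<^sub>R u)\<bar>)) \<le> norm u * (norm u * (norm u * B m p q))"
          by (intro mult_mono component_le_norm_cart d3 mult_nonneg_nonneg abs_ge_zero norm_ge_zero \<open>B m p q \<ge> 0\<close>)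
        then show ?thesis by (simp add: abs_mult power3_eq_cube mult_ac)
      qed
      have "h 3 t = (\<Sum>q\<in>UNIV. \<Sum>p\<in>UNIV. \<Sum>m\<in>UNIV. u $ q * (u $ p * (u $ m * ?d3 m p q (t *\<^sub>R u))))"
        by (simp add: h_def sum_distrib_left)
      then show ?thesis
        unfolding M_def sum_distrib_right by (simp only:) (intro order_trans[OF sum_abs] sum_mono 1)
    qed
    then show ?thesis
      unfolding remainder by simp
  qed
  show ?thesis
  proof (rule bigoI)
    have "eventually (\<lambda>u. u \<in> ball 0 (r / 2)) (at (0 :: real ^ 'n))"
      by (rule eventually_at_in_open') (use r in auto)
    then show "eventually (\<lambda>u. norm (f u - (f 0 + (\<Sum>q\<in>UNIV. ?d1 q 0 * u $ q) +
        1 / 2 * (\<Sum>p\<in>UNIV. \<Sum>q\<in>UNIV. ?d2 p q 0 * u $ p * u $ q))) \<le> M / 6 * norm (norm u ^ 3)) (at 0)"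
      by eventually_elim (use bound in auto)
  qed
qed

section \<open>The expansion of the dual form\<close>

locale normal_chart_G2 = normal_chart_metric V g \<rho> + chart_G2 V g \<phi> T
  for V g \<rho> \<phi> T
begin

lemma partial_deriv_\<psi>_origin:
  "length is = 4 \<Longrightarrow>
    partial_deriv q (\<lambda>v. \<psi> v is) 0 = wedge_covector (\<phi> 0) (\<lambda>p. T 0 [q, p]) is"
  by (simp add: partial_deriv_\<psi>[OF origin] index_action_def christoffel_origin)

lemma partial_deriv_\<phi>_origin:
  assumes "length is = 3"
  shows "partial_deriv p (\<lambda>v. \<phi> v is) 0 = (\<Sum>m\<in>UNIV. T 0 [p, m] * \<psi> 0 (m # is))"
  by (simp add: partial_deriv_\<phi>[OF origin assms] index_action_def christoffel_origin inv_metric_origin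
      if_distrib[where f="\<lambda>x. x * _"] if_distrib[where f="\<lambda>x. _ * x"] cong: if_cong)

lemma cov_deriv_T_origin: "cov_deriv g T 0 [p, q, i] = partial_deriv p (\<lambda>v. T v [q, i]) 0"
  by (simp add: christoffel_origin)

lemma second_partial_deriv_\<psi>_origin:
  assumes len: "length is = 4"
  shows "partial_deriv p (partial_deriv q (\<lambda>v. \<psi> v is)) 0 =
    (\<Sum>r<4. \<Sum>m\<in>UNIV. partial_deriv p (\<lambda>v. christoffel g v m q (is ! r)) 0 * \<psi> 0 (is[r := m])) +
    partial_deriv p (\<lambda>v. wedge_covector (\<phi> v) (\<lambda>a. T v [q, a]) is) 0"
proof -
  let ?S = "\<lambda>v. \<Sum>r<4. \<Sum>m\<in>UNIV. christoffel g v m q (is ! r) * \<psi> v (is[r := m])"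
  let ?W = "\<lambda>v. wedge_covector (\<phi> v) (\<lambda>a. T v [q, a]) is"
  note diff = differentiable_christoffel[OF origin] differentiable_\<psi>[OF origin]
  have dS: "?S differentiable (at 0)"
    by (intro differentiable_sum differentiable_mult diff finite_lessThan finite_class.finite_UNIV ballI)
  have dW: "?W differentiable (at 0)"
    unfolding wedge_covector_def
    by (intro differentiable_add differentiable_diff differentiable_mult differentiable_\<phi>[OF origin] differentiable_T[OF origin]) auto
  have "partial_deriv p (partial_deriv q (\<lambda>v. \<psi> v is)) 0 = partial_deriv p (\<lambda>v. ?S v + ?W v) 0"
    by (rule partial_deriv_cong[OF open_V origin]) (simp add: partial_deriv_\<psi>[OF _ len] index_action_def len)
  also have "\<dots> = partial_deriv p ?S 0 + partial_deriv p ?W 0"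
    by (rule partial_deriv_add[OF dS dW])
  also have "partial_deriv p ?S 0 =
      (\<Sum>r<4. \<Sum>m\<in>UNIV. partial_deriv p (\<lambda>v. christoffel g v m q (is ! r)) 0 * \<psi> 0 (is[r := m]))"
    by (simp add: partial_deriv_sum partial_deriv_mult diff differentiable_sum differentiable_mult christoffel_origin)
  finally show ?thesis .
qed

text \<open>The terms quadratic in the torsion come from the derivative of \<open>\<phi>\<close>, which is \<open>T\<^sub>p \<lrcorner> \<psi>\<close> at the origin.\<close>

lemma partial_deriv_wedge_origin:
  "partial_deriv p (\<lambda>v. wedge_covector (\<phi> v) (\<lambda>a. T v [q, a]) [i, j, k, l]) 0 =
    (- cov_deriv g T 0 [p,q,i] * \<phi> 0 [j,k,l] + cov_deriv g T 0 [p,q,j] * \<phi> 0 [i,k,l]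
      - cov_deriv g T 0 [p,q,k] * \<phi> 0 [i,j,l] + cov_deriv g T 0 [p,q,l] * \<phi> 0 [i,j,k])
    + (\<Sum>m\<in>UNIV. - T 0 [q,i] * T 0 [p,m] * \<psi> 0 [m,j,k,l] + T 0 [q,j] * T 0 [p,m] * \<psi> 0 [m,i,k,l]
      - T 0 [q,k] * T 0 [p,m] * \<psi> 0 [m,i,j,l] + T 0 [q,l] * T 0 [p,m] * \<psi> 0 [m,i,j,k])"
proof -
  have \<phi>: "((\<lambda>s. \<phi> (0 + s *\<^sub>R axis p 1) [a, b, c]) has_real_derivative
      (\<Sum>m\<in>UNIV. T 0 [p, m] * \<psi> 0 [m, a, b, c])) (at 0)" for a b c
    using has_real_derivative_axis[OF differentiable_\<phi>[OF origin], of "[a, b, c]" p]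
    by (simp add: partial_deriv_\<phi>_origin)
  have T: "((\<lambda>s. T (0 + s *\<^sub>R axis p 1) [a, b]) has_real_derivative cov_deriv g T 0 [p, a, b]) (at 0)" for a b
    using has_real_derivative_axis[OF differentiable_T[OF origin], of "[a, b]" p]
    by (simp only: cov_deriv_T_origin) simp
  show ?thesis
  proof (rule partial_deriv_axis_unique)
    show "(\<lambda>v. wedge_covector (\<phi> v) (\<lambda>a. T v [q, a]) [i, j, k, l]) differentiable (at 0)"
      unfolding wedge_covector_def
      by (intro differentiable_add differentiable_diff differentiable_mult differentiable_\<phi>[OF origin] differentiable_T[OF origin]) auto
    have "((\<lambda>s. wedge_covector (\<phi> (0 + s *\<^sub>R axis p 1)) (\<lambda>a. T (0 + s *\<^sub>R axis p 1) [q, a]) [i, j, k, l])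
      has_real_derivative
        ((\<Sum>m\<in>UNIV. T 0 [p, m] * \<psi> 0 [m, i, j, k]) * T 0 [q, l] + cov_deriv g T 0 [p, q, l] * \<phi> 0 [i, j, k])
      - ((\<Sum>m\<in>UNIV. T 0 [p, m] * \<psi> 0 [m, i, j, l]) * T 0 [q, k] + cov_deriv g T 0 [p, q, k] * \<phi> 0 [i, j, l])
      + ((\<Sum>m\<in>UNIV. T 0 [p, m] * \<psi> 0 [m, i, k, l]) * T 0 [q, j] + cov_deriv g T 0 [p, q, j] * \<phi> 0 [i, k, l])
      - ((\<Sum>m\<in>UNIV. T 0 [p, m] * \<psi> 0 [m, j, k, l]) * T 0 [q, i] + cov_deriv g T 0 [p, q, i] * \<phi> 0 [j, k, l]))
      (at 0)"
      unfolding wedge_covector_list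
      using DERIV_diff[OF DERIV_add[OF DERIV_diff[OF DERIV_mult[OF \<phi> T] DERIV_mult[OF \<phi> T]] DERIV_mult[OF \<phi> T]]
          DERIV_mult[OF \<phi> T]] by simp
    then show "((\<lambda>s. wedge_covector (\<phi> (0 + s *\<^sub>R axis p 1)) (\<lambda>a. T (0 + s *\<^sub>R axis p 1) [q, a]) [i, j, k, l])
      has_real_derivative (- cov_deriv g T 0 [p,q,i] * \<phi> 0 [j,k,l] + cov_deriv g T 0 [p,q,j] * \<phi> 0 [i,k,l]
      - cov_deriv g T 0 [p,q,k] * \<phi> 0 [i,j,l] + cov_deriv g T 0 [p,q,l] * \<phi> 0 [i,j,k])
    + (\<Sum>m\<in>UNIV. - T 0 [q,i] * T 0 [p,m] * \<psi> 0 [m,j,k,l] + T 0 [q,j] * T 0 [p,m] * \<psi> 0 [m,i,k,l]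
      - T 0 [q,k] * T 0 [p,m] * \<psi> 0 [m,i,j,l] + T 0 [q,l] * T 0 [p,m] * \<psi> 0 [m,i,j,k])) (at 0)"
      by (rule DERIV_cong)
         (simp add: sum.distrib sum_subtractf sum_negf sum_distrib_left mult_ac del: cov_deriv.simps)
  qed
qed

text \<open>The derivative of \<open>\<partial>\<^sub>q\<psi> = index_action \<Gamma>\<^sub>q \<psi> + \<phi> \<and> T\<^sub>q\<close> at the origin has two parts.  The derivative of
  the Christoffel symbols, contracted with \<open>u\<^sup>p u\<^sup>q\<close>, is a third of the curvature, and together with the
  factor \<open>1/2\<close> of the Taylor formula gives the coefficient \<open>1/6\<close>.  The derivative of \<open>\<phi> \<and> T\<^sub>q\<close> gives the
  terms with \<open>\<nabla>T\<close> and with \<open>T T\<close>.\<close>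

lemma dual_form_expansion:
  "(\<lambda>u. \<psi> u [i,j,k,l] -
      (\<psi> 0 [i,j,k,l]
       + (\<Sum>q\<in>UNIV. (- T 0 [q,i] * \<phi> 0 [j,k,l] + T 0 [q,j] * \<phi> 0 [i,k,l]
                     - T 0 [q,k] * \<phi> 0 [i,j,l] + T 0 [q,l] * \<phi> 0 [i,j,k]) * u $ q)
       + (\<Sum>p\<in>UNIV. \<Sum>q\<in>UNIV.
            Q_coeff (T 0) (cov_deriv g T 0) (riemann g 0) (\<phi> 0) (\<psi> 0) p q i j k l * u $ p * u $ q)))
   \<in> O[at 0](\<lambda>u. norm u ^ 3)"
proof -
  let ?is = "[i, j, k, l]" and ?f = "\<lambda>v. \<psi> v [i, j, k, l]"
  let ?W = "\<lambda>p q. partial_deriv p (\<lambda>v. wedge_covector (\<phi> v) (\<lambda>a. T v [q, a]) ?is) 0"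
  let ?R = "\<lambda>p q. \<Sum>r<4. \<Sum>m\<in>UNIV. riemann g 0 p (?is ! r) q m * \<psi> 0 (?is[r := m])"
  let ?Z = "\<lambda>p q. \<Sum>r<4. \<Sum>m\<in>UNIV. partial_deriv p (\<lambda>v. christoffel g v m q (?is ! r)) 0 * \<psi> 0 (?is[r := m])"
  obtain r where r: "r > 0" "ball 0 r \<subseteq> V"
    using open_V origin open_contains_ball by blast
  have "\<forall>n. Ck_on n V ?f"
    using smooth_\<psi>[of ?is] by (simp add: smooth_on_def del: Ck_on.simps)
  then have "Ck_on 3 (ball 0 r) ?f"
    by (intro Ck_on_subset[OF _ r(2)]) blast
  note taylor = taylor_second_order_bigo[OF this r(1)]
  have linear: "partial_deriv q ?f 0 = - T 0 [q,i] * \<phi> 0 [j,k,l] + T 0 [q,j] * \<phi> 0 [i,k,l]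
                     - T 0 [q,k] * \<phi> 0 [i,j,l] + T 0 [q,l] * \<phi> 0 [i,j,k]" for q
    by (simp add: partial_deriv_\<psi>_origin wedge_covector_list)
  have Q: "Q_coeff (T 0) (cov_deriv g T 0) (riemann g 0) (\<phi> 0) (\<psi> 0) p q i j k l =
      1 / 2 * ?W p q + 1 / 6 * ?R p q" for p q
  proof -
    have "?R p q = (\<Sum>m\<in>UNIV. riemann g 0 p i q m * \<psi> 0 [m,j,k,l] + riemann g 0 p j q m * \<psi> 0 [i,m,k,l]
        + riemann g 0 p k q m * \<psi> 0 [i,j,m,l] + riemann g 0 p l q m * \<psi> 0 [i,j,k,m])"
      by (simp add: numeral_eq_Suc sum.distrib)
    then show ?thesis
      unfolding Q_coeff_def partial_deriv_wedge_origin distrib_left by (simp only:)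
  qed
  have Z: "(\<Sum>p\<in>UNIV. \<Sum>q\<in>UNIV. ?Z p q * u $ p * u $ q) = 1 / 3 * (\<Sum>p\<in>UNIV. \<Sum>q\<in>UNIV. ?R p q * u $ p * u $ q)" for u
  proof -
    have move: "(\<Sum>p\<in>UNIV. \<Sum>q\<in>UNIV. (\<Sum>r<4. \<Sum>m\<in>UNIV. C p q r m * \<psi> 0 (?is[r := m])) * u $ p * u $ q) =
        (\<Sum>r<4. \<Sum>m\<in>UNIV. (\<Sum>p\<in>UNIV. \<Sum>q\<in>UNIV. C p q r m * u $ p * u $ q) * \<psi> 0 (?is[r := m]))"
      for C :: "idx \<Rightarrow> idx \<Rightarrow> nat \<Rightarrow> idx \<Rightarrow> real"
      unfolding sum_distrib_right sum.cartesian_product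
      by (rule sum.reindex_bij_witness[where i="\<lambda>(r, m, p, q). (p, q, r, m)" and j="\<lambda>(p, q, r, m). (r, m, p, q)"])
         auto
    have factor: "(\<Sum>r<4. \<Sum>m\<in>UNIV. (1 / 3 * X r m) * Y r m) = 1 / 3 * (\<Sum>r<4. \<Sum>m\<in>UNIV. X r m * Y r m)"
      for X Y :: "nat \<Rightarrow> idx \<Rightarrow> real"
      by (simp add: sum_distrib_left mult.assoc)
    show ?thesis
      unfolding move radial_christoffel_riemann by (rule factor)
  qed
  have quadratic: "1 / 2 * (\<Sum>p\<in>UNIV. \<Sum>q\<in>UNIV. partial_deriv p (partial_deriv q ?f) 0 * u $ p * u $ q) =
      (\<Sum>p\<in>UNIV. \<Sum>q\<in>UNIV. Q_coeff (T 0) (cov_deriv g T 0) (riemann g 0) (\<phi> 0) (\<psi> 0) p q i j k l * u $ p * u $ q)" for u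
  proof -
    have split: "(\<Sum>p\<in>UNIV. \<Sum>q\<in>UNIV. (1 / 2 * X p q + 1 / 6 * Y p q) * u $ p * u $ q) =
        1 / 2 * (\<Sum>p\<in>UNIV. \<Sum>q\<in>UNIV. X p q * u $ p * u $ q) + 1 / 6 * (\<Sum>p\<in>UNIV. \<Sum>q\<in>UNIV. Y p q * u $ p * u $ q)"
      for X Y :: "idx \<Rightarrow> idx \<Rightarrow> real"
      by (simp only: distrib_right sum.distrib sum_distrib_left mult.assoc)
    have "(\<Sum>p\<in>UNIV. \<Sum>q\<in>UNIV. partial_deriv p (partial_deriv q ?f) 0 * u $ p * u $ q) =
        (\<Sum>p\<in>UNIV. \<Sum>q\<in>UNIV. ?Z p q * u $ p * u $ q) + (\<Sum>p\<in>UNIV. \<Sum>q\<in>UNIV. ?W p q * u $ p * u $ q)"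
      by (subst second_partial_deriv_\<psi>_origin) (simp_all add: distrib_right sum.distrib)
    moreover have "(\<Sum>p\<in>UNIV. \<Sum>q\<in>UNIV. (1 / 2 * ?W p q + 1 / 6 * ?R p q) * u $ p * u $ q) =
        1 / 2 * (\<Sum>p\<in>UNIV. \<Sum>q\<in>UNIV. ?W p q * u $ p * u $ q) + 1 / 6 * (\<Sum>p\<in>UNIV. \<Sum>q\<in>UNIV. ?R p q * u $ p * u $ q)"
      by (rule split)
    ultimately show ?thesis
      unfolding Q Z by (simp only:) simp
  qed
  show ?thesis
    using taylor unfolding quadratic linear .
qed

end

lemma frame_components_2_axis:
  assumes "\<And>i. e i = axis i 1"
  shows "frame_components 2 \<tau> e [i, j] = \<tau> [i, j]"
proof -
  have "frame_components 2 \<tau> e [i, j] = (\<Sum>a\<in>UNIV. axis i 1 $ a * (\<Sum>b\<in>UNIV. axis j 1 $ b * \<tau> [a, b]))"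
    unfolding frame_components_def by (simp add: numeral_eq_Suc sum_lists_Suc assms sum_distrib_left mult_ac)
  then show ?thesis by (simp only: sum_axis)
qed

theorem theoremA1:
  fixes A :: "'m::{t2_space, second_countable_topology} chart set"
    and \<phi> \<psi> g T :: "'m field"
    and x :: 'm and c :: "'m chart"
    and i j k l :: idx
  assumes "oriented_smooth_manifold A"
    and "G2_structure A \<phi> g"
    and "\<psi> = dual_form g \<phi>"
    and "torsion_of A \<phi> g T"
    and "G2_adapted_normal_coordinates A \<phi> g x c"
  shows "(\<lambda>u. \<psi> c u [i,j,k,l] -
            (\<psi> c 0 [i,j,k,l]
             + (\<Sum>q\<in>UNIV. (- T c 0 [q,i] * \<phi> c 0 [j,k,l] + T c 0 [q,j] * \<phi> c 0 [i,k,l]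
                           - T c 0 [q,k] * \<phi> c 0 [i,j,l] + T c 0 [q,l] * \<phi> c 0 [i,j,k]) * u $ q)
             + (\<Sum>p\<in>UNIV. \<Sum>q\<in>UNIV.
                  Q_coeff (T c 0) (cov_deriv (g c) (T c) 0) (riemann (g c) 0) (\<phi> c 0) (\<psi> c 0)
                    p q i j k l * u $ p * u $ q)))
         \<in> O[at 0](\<lambda>u. norm u ^ 3)"
proof -
  let ?V = "chart_image c"
  obtain e where nc: "normal_coordinates A g x e c"
    using assms(5) by (auto simp: G2_adapted_normal_coordinates_def)
  then have cA: "c \<in> A" and x: "x \<in> chart_dom c" "chart_map c x = 0" and frame: "orthonormal_frame A g x e"
    by (auto simp: normal_coordinates_def)
  have chart: "is_chart c"
    using assms(1) cA by (simp add: oriented_smooth_manifold_def)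
  interpret chart_G2 ?V "g c" "\<phi> c" "T c"
  proof
    show "open ?V" using chart by (simp add: is_chart_def)
    show "smooth_on ?V (\<lambda>v. g c v [i, j])" for i j
      using assms(2) cA by (simp add: G2_structure_def tensor_field_def)
    show "inner_product (g c v)" if "v \<in> ?V" for v
      using assms(2) cA that by (simp add: G2_structure_def induces_inner_product_def)
    show "smooth_on ?V (\<lambda>v. \<phi> c v is)" if "length is = 3" for "is"
      using assms(2) cA that by (simp add: G2_structure_def differential_form_def tensor_field_def)
    show "smooth_on ?V (\<lambda>v. T c v is)" if "length is = 2" for "is"
      using assms(4) cA that by (simp add: torsion_of_def tensor_field_def)
    show "alternating 3 (\<phi> c v)" if "v \<in> ?V" for v
      using assms(2) cA that by (simp add: G2_structure_def differential_form_def)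
    show "cov_deriv (g c) (\<phi> c) v [m, i, j, k] = (\<Sum>p\<in>UNIV. \<Sum>q\<in>UNIV.
        T c v [m, p] * inv_metric (g c v) p q * hodge 3 (g c v) (\<phi> c v) [q, i, j, k])" if "v \<in> ?V" for v m i j k
      using assms(4) cA that by (simp add: torsion_of_def dual_form_def del: cov_deriv.simps)
  qed
  have origin: "0 \<in> ?V"
    using x by (force simp: chart_image_def)
  then obtain \<rho> where \<rho>: "\<rho> > 0" "ball 0 \<rho> \<subseteq> ?V"
    using open_V open_contains_ball by blast
  note radial = radial_geodesic[OF nc chart chart_metric_axioms \<rho>(2)]
  have e: "e i c = axis i 1" for i
  proof -
    let ?u = "(\<rho> / 2) *\<^sub>R axis i (1::real)"
    have "(\<Sum>j\<in>UNIV. ?u $ j *\<^sub>R e j c) = ?u"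
      using radial[of ?u] \<rho>(1) by simp
    moreover have "?u $ j *\<^sub>R e j c = (if j = i then (\<rho> / 2) *\<^sub>R e i c else 0)" for j
      by (simp add: axis_def)
    then have "(\<Sum>j\<in>UNIV. ?u $ j *\<^sub>R e j c) = (\<rho> / 2) *\<^sub>R e i c"
      by simp
    ultimately show ?thesis using \<rho>(1) by simp
  qed
  interpret normal_chart_G2 ?V "g c" \<rho> "\<phi> c" "T c"
  proof
    show "0 \<in> ?V" "\<rho> > 0" by (fact origin, fact \<rho>(1))
    show "\<exists>\<tau>>0. \<forall>t\<in>{0..\<tau>}. geodesic_acceleration (t *\<^sub>R u) u = 0" if "u \<in> ball 0 \<rho>" for u
      using radial[OF that] by blast
    have "frame_components 2 (g c (chart_map c x)) (\<lambda>i. e i c) [i, j] = (if i = j then 1 else 0)" for i j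
      using frame cA x(1) unfolding orthonormal_frame_def by blast
    then have "frame_components 2 (g c 0) (\<lambda>i. e i c) [i, j] = (if i = j then 1 else 0)" for i j
      unfolding x(2) .
    then show "g c 0 [i, j] = (if i = j then 1 else 0)" for i j
      using frame_components_2_axis[of "\<lambda>i. e i c"] e by simp
  qed
  show ?thesis
    using dual_form_expansion[of i j k l] unfolding \<psi>_def assms(3) dual_form_def .
qed

end
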